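(* Let $\tilde\psi^{\rm per}_{i,n}$, $\alpha_{i_1,i_2,i_3,\mu_1,\mu_2,\mu_3}$, $\epsilon_0$, $m$, $S$ and the periodized local cascade operator $C=C^{\rm per}$ on $\mathbb T^3$ be as in the context, and let $n_0\in\mathbb N$ be sufficiently large. Assume that $u:[0,\infty)\to H^{10}_{\rm df}(\mathbb T^3)$ is a mild solution to $$\partial_tu=\Delta u+C(u,u),\qquad u(0,\cdot)=\tilde\psi^{\rm per}_{1,n_0}.$$ For $n\in\mathbb Z$, $i\in\{1,\dots,m\}$, $t\ge0$ define $u_{i,n}(t)$ by $(\mathcal F_{\mathbb T^3}u_{i,n}(t))(k)=(\mathcal F_{\mathbb T^3}u(t))(k)\,\mathbf 1_{\{k\in\mathbb Z^3\cap(1+\epsilon_0)^n(B_i\cup-B_i)\}}$, and $$X_{i,n}(t)=\langle u(t),\tilde\psi^{\rm per}_{i,n}\rangle_{L^2(\mathbb T^3)},\qquad E_{i,n}(t)=\tfrac12\|u_{i,n}(t)\|_{L^2(\mathbb T^3)}^2 .$$ Then: (1) For all $T\in(0,\infty)$, $$\sup_{t\in[0,T]}\sup_{n\in\mathbb Z}\sup_{i\in\{1,\dots,m\}}\left(1+(1+\epsilon_0)^{10n}\right)|X_{i,n}(t)|<\infty,$$ $$\sup_{t\in[0,T]}\sup_{n\in\mathbb Z}\sup_{i\in\{1,\dots,m\}}\left(1+(1+\epsilon_0)^{10n}\right)|E_{i,n}(t)|<\infty.$$ (2) For all $n\in\mathbb Z$, $i\in\{1,\dots,m\}$: $E_{i,n}(0)=\tfrac12X_{i,n}(0)^2$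 and $X_{i,n}(0)=\mathbf 1_{\{(i,n)=(1,n_0)\}}$. (3) For all $n\in\mathbb Z$, $i\in\{1,\dots,m\}$, $$\partial_tX_{i,n}=\sum_{i_1,i_2\in\{1,\dots,m\}}\sum_{\mu\in S}\alpha_{i_1,i_2,i,\mu_1,\mu_2,\mu_3}(1+\epsilon_0)^{\frac{5(n-\mu_3)}2}X_{i_1,n-\mu_3+\mu_1}X_{i_2,n-\mu_3+\mu_2}+O\left((1+\epsilon_0)^{2n}\sqrt{E_{i,n}}\right)$$ and $$\partial_tE_{i,n}\le\sum_{i_1,i_2\in\{1,\dots,m\}}\sum_{\mu\in S}\alpha_{i_1,i_2,i,\mu_1,\mu_2,\mu_3}(1+\epsilon_0)^{\frac{5(n-\mu_3)}2}X_{i_1,n-\mu_3+\mu_1}X_{i_2,n-\mu_3+\mu_2}X_{i,n}.$$ (4) For all $n\in\mathbb Z$, $i\in\{1,\dots,m\}$, $t\ge0$, $$\tfrac12X_{i,n}(t)^2\le E_{i,n}(t)\le\tfrac12X_{i,n}(t)^2+O\left((1+\epsilon_0)^{2n}\int_0^tE_{i,n}(s)\,\mathrm ds\right).$$ (5) $X_{i,n}(t)=0=E_{i,n}(t)$ for all $n<n_0$, $i\in\{1,\dots,m\}$, $t\ge0$.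
   Context: $\mathbb T^3=\mathbb R^3/\mathbb Z^3$; $\|f\|_{H^s}=\|(\mathrm{Id}-\Delta)^{s/2}f\|_{L^2}$, and $H^s_{\rm df}$ is the subspace of divergence-free ($\mathbb R^3$-valued) fields in $H^s$. Fourier transform: $(\mathcal F_{\mathbb T^3}f)(k)=\int_{\mathbb T^3}f(x)e^{-2\pi\mathrm ik\cdot x}\mathrm dx$, $k\in\mathbb Z^3$, and analogously $\mathcal F_{\mathbb R^3}$. $O(Y)$ denotes a quantity bounded in absolute value by $K\,Y$ with a constant $K$ independent of $i,n,t,u$. Fix $\epsilon_0\in(0,1)$, $m\in\mathbb N$, and balls $B_1,\dots,B_m$ in the annulus $\{\xi\in\mathbb R^3:1<|\xi|<1+\frac{\epsilon_0}2\}$ such that $B_1,\dots,B_m,-B_1,\dots,-B_m$ are disjoint. Let $\psi_i\in H^{10}_{\rm df}(\mathbb R^3)$ be $\mathbb R^3$-valued divergence-free Schwartz functions with Fourier transform supported on $B_i\cup-B_i$ and $\|\psi_i\|_{L^2}=1$, and $\psi_{i,n}(x)=(1+\epsilon_0)^{\frac{3n}2}\psi_i((1+\epsilon_0)^nx)$ for $n\in\mathbb Z$. Let $\psi^{\rm per}_{i,n}(x)=\sum_{l\in\mathbb Z^3}\psi_{i,n}(x+l)$ and let $\tilde\psi^{\rm per}_{i,n}=\psi^{\rm per}_{i,n}/\|\psi^{\rm per}_{i,n}\|_{L^2(\mathbb T^3)}$ be its $L^2$-normalization (with $\tilde\psi^{\rm per}_{i,n}=0$ if $\psi^{\rm per}_{i,n}=0$).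 Let $S=\{(0,0,0),(1,0,0),(0,1,0),(0,0,1)\}$ and let $\alpha_{i_1,i_2,i_3,\mu_1,\mu_2,\mu_3}\in\mathbb R$, $i_1,i_2,i_3\in\{1,\dots,m\}$, $(\mu_1,\mu_2,\mu_3)\in S$, be bounded structure constants satisfying the symmetry condition $\alpha_{i_1,i_2,i_3,\mu_1,\mu_2,\mu_3}=\alpha_{i_2,i_1,i_3,\mu_2,\mu_1,\mu_3}$ and the cancellation condition $\sum_{\{a,b,c\}=\{1,2,3\}}\alpha_{i_a,i_b,i_c,\mu_a,\mu_b,\mu_c}=0$ for all $i_1,i_2,i_3$ and $(\mu_1,\mu_2,\mu_3)\in S$. The periodized local cascade operator is $$C^{\rm per}(u,v)=\sum_{n\in\mathbb Z}\ \sum_{(i_1,i_2,i_3,\mu_1,\mu_2,\mu_3)\in\{1,\dots,m\}^3\times S}\alpha_{i_1,i_2,i_3,\mu_1,\mu_2,\mu_3}(1+\epsilon_0)^{\frac{5n}2}\langle u,\tilde\psi^{\rm per}_{i_1,n+\mu_1}\rangle_{L^2(\mathbb T^3)}\langle v,\tilde\psi^{\rm per}_{i_2,n+\mu_2}\rangle_{L^2(\mathbb T^3)}\tilde\psi^{\rm per}_{i_3,n+\mu_3}.$$ *)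

theory Defs
  imports "HOL-Analysis.Analysis"
begin

section \<open>Function spaces on the torus\<close>

text \<open>Fields on \<open>\<real>\<^sup>3/\<int>\<^sup>3\<close> are \<open>\<int>\<^sup>3\<close>-periodic functions on \<open>\<real>\<^sup>3\<close>, integrated over the unit
  cube. Elements of \<open>L\<^sup>2\<close> are given by Borel representatives.\<close>

type_synonym vfield = "real ^ 3 \<Rightarrow> real ^ 3"

definition lat :: "int ^ 3 \<Rightarrow> real ^ 3"
  where "lat k = (\<chi> j. real_of_int (k $ j))"

definition T3 :: "(real ^ 3) measure"
  where "T3 = restrict_space lborel (cbox 0 1)"

definition periodic :: "(real ^ 3 \<Rightarrow> 'b) \<Rightarrow> bool"
  where "periodic f \<longleftrightarrow> (\<forall>x l. f (x + lat l) = f x)"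

definition L2_T :: "vfield \<Rightarrow> bool"
  where "L2_T f \<longleftrightarrow> periodic f \<and> f \<in> borel_measurable borel \<and> integrable T3 (\<lambda>x. (norm (f x))\<^sup>2)"

definition inner_T :: "vfield \<Rightarrow> vfield \<Rightarrow> real"
  where "inner_T f g = (LINT x|T3. f x \<bullet> g x)"

definition norm_T :: "vfield \<Rightarrow> real"
  where "norm_T f = sqrt (LINT x|T3. (norm (f x))\<^sup>2)"

definition fourier_T :: "vfield \<Rightarrow> int ^ 3 \<Rightarrow> complex ^ 3"
  where "fourier_T f k =
    (\<chi> j. LINT x|T3. complex_of_real (f x $ j) * exp (- 2 * pi * \<i> * complex_of_real (lat k \<bullet> x)))"

definition fourier_R :: "vfield \<Rightarrow> real ^ 3 \<Rightarrow> complex ^ 3"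
  where "fourier_R f \<xi> =
    (\<chi> j. LINT x|lborel. complex_of_real (f x $ j) * exp (- 2 * pi * \<i> * complex_of_real (\<xi> \<bullet> x)))"

definition is_multiplier_image :: "(int ^ 3 \<Rightarrow> real) \<Rightarrow> vfield \<Rightarrow> vfield \<Rightarrow> bool"
  where "is_multiplier_image \<sigma> f g \<longleftrightarrow> L2_T g \<and> (\<forall>k. fourier_T g k = \<sigma> k *\<^sub>R fourier_T f k)"

text \<open>The \<open>L\<^sup>2\<close> field with Fourier coefficients \<open>\<sigma> k *\<^sub>R fourier_T f k\<close>; it is unique up to null
  sets, so the choice of representative is immaterial.\<close>

definition multiplier :: "(int ^ 3 \<Rightarrow> real) \<Rightarrow> vfield \<Rightarrow> vfield"
  where "multiplier \<sigma> f = (SOME g. is_multiplier_image \<sigma> f g)"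

text \<open>With this Fourier transform, \<open>- \<Delta>\<close> has symbol \<open>4 \<pi>\<^sup>2 |k|\<^sup>2\<close>.\<close>

definition bessel_symbol :: "real \<Rightarrow> int ^ 3 \<Rightarrow> real"
  where "bessel_symbol s k = (1 + 4 * pi\<^sup>2 * (norm (lat k))\<^sup>2) powr (s / 2)"

definition in_Hs :: "real \<Rightarrow> vfield \<Rightarrow> bool"
  where "in_Hs s f \<longleftrightarrow> L2_T f \<and> (\<exists>g. is_multiplier_image (bessel_symbol s) f g)"

definition Hs_norm :: "real \<Rightarrow> vfield \<Rightarrow> real"
  where "Hs_norm s f = norm_T (multiplier (bessel_symbol s) f)"

definition heat :: "real \<Rightarrow> vfield \<Rightarrow> vfield"
  where "heat t = multiplier (\<lambda>k. exp (- 4 * pi\<^sup>2 * (norm (lat k))\<^sup>2 * t))"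


section \<open>Smoothness, divergence and Schwartz functions\<close>

fun dpartial :: "3 list \<Rightarrow> (real ^ 3 \<Rightarrow> 'b::real_normed_vector) \<Rightarrow> real ^ 3 \<Rightarrow> 'b"
  where
    "dpartial [] f = f"
  | "dpartial (j # js) f = (\<lambda>x. frechet_derivative (dpartial js f) (at x) (axis j 1))"

definition smooth :: "(real ^ 3 \<Rightarrow> 'b::real_normed_vector) \<Rightarrow> bool"
  where "smooth f \<longleftrightarrow> (\<forall>js x. dpartial js f differentiable (at x))"

definition schwartz :: "vfield \<Rightarrow> bool"
  where "schwartz f \<longleftrightarrow>
    smooth f \<and> (\<forall>js (N::nat). bounded (range (\<lambda>x. (1 + norm x) ^ N *\<^sub>R dpartial js f x)))"

definition div_free :: "vfield \<Rightarrow> bool"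
  where "div_free f \<longleftrightarrow> (\<forall>x. (\<Sum>j\<in>UNIV. dpartial [j] f x $ j) = 0)"

text \<open>Vanishing divergence in the sense of distributions on the torus.\<close>

definition weakly_div_free_T :: "vfield \<Rightarrow> bool"
  where "weakly_div_free_T f \<longleftrightarrow>
    (\<forall>\<phi> :: real ^ 3 \<Rightarrow> real. smooth \<phi> \<and> periodic \<phi> \<longrightarrow>
      (LINT x|T3. (\<Sum>j\<in>UNIV. f x $ j * dpartial [j] \<phi> x)) = 0)"

definition H10_df :: "vfield \<Rightarrow> bool"
  where "H10_df f \<longleftrightarrow> in_Hs 10 f \<and> weakly_div_free_T f"


section \<open>Mild solutions\<close>

text \<open>The vector-valued integral over \<open>[0, t]\<close> is the weak (Pettis) integral in \<open>L\<^sup>2\<close>, which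
  coincides with the Bochner integral whenever the latter exists.\<close>

definition has_L2_integral :: "(real \<Rightarrow> vfield) \<Rightarrow> vfield \<Rightarrow> real \<Rightarrow> bool"
  where "has_L2_integral F I t \<longleftrightarrow>
    L2_T I \<and> (\<forall>\<phi>. L2_T \<phi> \<longrightarrow> ((\<lambda>s. inner_T (F s) \<phi>) has_integral inner_T I \<phi>) {0..t})"

text \<open>\<open>u \<in> C([0, \<infinity>); H\<^sup>1\<^sup>0\<^sub>d\<^sub>f)\<close> satisfying Duhamel's formula. The values of \<open>u\<close> at negative
  times are irrelevant, and Duhamel's formula at \<open>t = 0\<close> is the initial condition.\<close>

definition mild_solution :: "(vfield \<Rightarrow> vfield \<Rightarrow> vfield) \<Rightarrow> vfield \<Rightarrow> (real \<Rightarrow> vfield) \<Rightarrow> bool"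
  where "mild_solution C u0 u \<longleftrightarrow>
    (\<forall>t\<ge>0. H10_df (u t)) \<and>
    (\<forall>t\<ge>0. ((\<lambda>s. Hs_norm 10 (\<lambda>x. u s x - u t x)) \<longlongrightarrow> 0) (at t within {0..})) \<and>
    (\<forall>t\<ge>0. \<exists>I. has_L2_integral (\<lambda>s. heat (t - s) (C (u s) (u s))) I t \<and>
      (AE x in T3. u t x = heat t u0 x + I x))"


section \<open>The periodized local cascade operator\<close>

definition psi_scaled :: "real \<Rightarrow> (nat \<Rightarrow> vfield) \<Rightarrow> nat \<Rightarrow> int \<Rightarrow> vfield"
  where "psi_scaled \<epsilon>0 \<psi> i n x =
    (1 + \<epsilon>0) powr (3 * real_of_int n / 2) *\<^sub>R \<psi> i ((1 + \<epsilon>0) powr (real_of_int n) *\<^sub>R x)"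

definition psi_per :: "real \<Rightarrow> (nat \<Rightarrow> vfield) \<Rightarrow> nat \<Rightarrow> int \<Rightarrow> vfield"
  where "psi_per \<epsilon>0 \<psi> i n x = infsum (\<lambda>l. psi_scaled \<epsilon>0 \<psi> i n (x + lat l)) UNIV"

text \<open>This is 0 if \<open>psi_per \<epsilon>0 \<psi> i n = 0\<close>, because \<open>inverse 0 = 0\<close>.\<close>

definition psi_tilde :: "real \<Rightarrow> (nat \<Rightarrow> vfield) \<Rightarrow> nat \<Rightarrow> int \<Rightarrow> vfield"
  where "psi_tilde \<epsilon>0 \<psi> i n x =
    inverse (norm_T (psi_per \<epsilon>0 \<psi> i n)) *\<^sub>R psi_per \<epsilon>0 \<psi> i n x"

definition shift_set :: "(int \<times> int \<times> int) set"
  where "shift_set = {(0,0,0), (1,0,0), (0,1,0), (0,0,1)}"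

type_synonym structure_constants = "nat \<Rightarrow> nat \<Rightarrow> nat \<Rightarrow> int \<Rightarrow> int \<Rightarrow> int \<Rightarrow> real"

definition symmetry_condition :: "nat \<Rightarrow> structure_constants \<Rightarrow> bool"
  where "symmetry_condition m \<alpha> \<longleftrightarrow>
    (\<forall>i1\<in>{1..m}. \<forall>i2\<in>{1..m}. \<forall>i3\<in>{1..m}. \<forall>(\<mu>1,\<mu>2,\<mu>3)\<in>shift_set.
      \<alpha> i1 i2 i3 \<mu>1 \<mu>2 \<mu>3 = \<alpha> i2 i1 i3 \<mu>2 \<mu>1 \<mu>3)"

definition cancellation_condition :: "nat \<Rightarrow> structure_constants \<Rightarrow> bool"
  where "cancellation_condition m \<alpha> \<longleftrightarrow>
    (\<forall>i1\<in>{1..m}. \<forall>i2\<in>{1..m}. \<forall>i3\<in>{1..m}. \<forall>(\<mu>1,\<mu>2,\<mu>3)\<in>shift_set.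
      \<alpha> i1 i2 i3 \<mu>1 \<mu>2 \<mu>3 + \<alpha> i1 i3 i2 \<mu>1 \<mu>3 \<mu>2 +
      \<alpha> i2 i1 i3 \<mu>2 \<mu>1 \<mu>3 + \<alpha> i2 i3 i1 \<mu>2 \<mu>3 \<mu>1 +
      \<alpha> i3 i1 i2 \<mu>3 \<mu>1 \<mu>2 + \<alpha> i3 i2 i1 \<mu>3 \<mu>2 \<mu>1 = 0)"

text \<open>For \<open>u, v \<in> H\<^sup>1\<^sup>0\<close> the coefficients decay so fast in \<open>n\<close> that the sum over \<open>n\<close> converges
  absolutely and uniformly in \<open>x\<close>, so it may be taken pointwise.\<close>

definition cascade_op ::
  "real \<Rightarrow> nat \<Rightarrow> structure_constants \<Rightarrow> (nat \<Rightarrow> vfield) \<Rightarrow> vfield \<Rightarrow> vfield \<Rightarrow> vfield"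
  where "cascade_op \<epsilon>0 m \<alpha> \<psi> u v x =
    infsum (\<lambda>n::int.
      \<Sum>i1\<in>{1..m}. \<Sum>i2\<in>{1..m}. \<Sum>i3\<in>{1..m}. \<Sum>(\<mu>1,\<mu>2,\<mu>3)\<in>shift_set.
        (\<alpha> i1 i2 i3 \<mu>1 \<mu>2 \<mu>3 * (1 + \<epsilon>0) powr (5 * real_of_int n / 2)
          * inner_T u (psi_tilde \<epsilon>0 \<psi> i1 (n + \<mu>1)) * inner_T v (psi_tilde \<epsilon>0 \<psi> i2 (n + \<mu>2)))
        *\<^sub>R psi_tilde \<epsilon>0 \<psi> i3 (n + \<mu>3) x) UNIV"

definition freq_set :: "real \<Rightarrow> (nat \<Rightarrow> (real ^ 3) set) \<Rightarrow> nat \<Rightarrow> int \<Rightarrow> (real ^ 3) set"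
  where "freq_set \<epsilon>0 B i n =
    (\<lambda>\<xi>. (1 + \<epsilon>0) powr (real_of_int n) *\<^sub>R \<xi>) ` (B i \<union> uminus ` B i)"

definition freq_part ::
  "real \<Rightarrow> (nat \<Rightarrow> (real ^ 3) set) \<Rightarrow> (real \<Rightarrow> vfield) \<Rightarrow> nat \<Rightarrow> int \<Rightarrow> real \<Rightarrow> vfield"
  where "freq_part \<epsilon>0 B u i n t = multiplier (\<lambda>k. indicator (freq_set \<epsilon>0 B i n) (lat k)) (u t)"

definition X_mode ::
  "real \<Rightarrow> (nat \<Rightarrow> vfield) \<Rightarrow> (real \<Rightarrow> vfield) \<Rightarrow> nat \<Rightarrow> int \<Rightarrow> real \<Rightarrow> real"
  where "X_mode \<epsilon>0 \<psi> u i n t = inner_T (u t) (psi_tilde \<epsilon>0 \<psi> i n)"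

definition E_mode ::
  "real \<Rightarrow> (nat \<Rightarrow> (real ^ 3) set) \<Rightarrow> (real \<Rightarrow> vfield) \<Rightarrow> nat \<Rightarrow> int \<Rightarrow> real \<Rightarrow> real"
  where "E_mode \<epsilon>0 B u i n t = (norm_T (freq_part \<epsilon>0 B u i n t))\<^sup>2 / 2"

definition cascade_rhs ::
  "real \<Rightarrow> nat \<Rightarrow> structure_constants \<Rightarrow> (nat \<Rightarrow> int \<Rightarrow> real \<Rightarrow> real) \<Rightarrow> nat \<Rightarrow> int \<Rightarrow> real \<Rightarrow> real"
  where "cascade_rhs \<epsilon>0 m \<alpha> X i n t =
    (\<Sum>i1\<in>{1..m}. \<Sum>i2\<in>{1..m}. \<Sum>(\<mu>1,\<mu>2,\<mu>3)\<in>shift_set.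
      \<alpha> i1 i2 i \<mu>1 \<mu>2 \<mu>3 * (1 + \<epsilon>0) powr (5 * real_of_int (n - \<mu>3) / 2)
        * X i1 (n - \<mu>3 + \<mu>1) t * X i2 (n - \<mu>3 + \<mu>2) t)"

end

theory Submission
  imports Defs
begin

text \<open>Periodization samples the Fourier transform at the lattice, so each periodized wavelet is a
  trigonometric polynomial supported on the lattice points of its own frequency set, and these sets
  are pairwise disjoint. For such a frequency \<open>k\<close>, testing Duhamel's formula against trigonometric
  polynomials turns the equation into the linear ODE
  \<open>U' = rhs W - 4 \<pi>\<^sup>2 |k|\<^sup>2 U\<close> for the \<open>k\<close>-th Fourier coefficient \<open>U\<close> of the solution, where \<open>W\<close> is
  the coefficient of the wavelet. Pairing this equation with \<open>W\<close> and with \<open>U\<close> gives the equations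
  for the modes and their energies, with \<open>|k|\<close> comparable to the scale. Modes below the initial scale
  stay zero by Gronwall. The bound for the modes needs normalized wavelets, which is where \<open>n0\<close> must be
  large: a periodized wavelet is nonzero at small scales because the translates separate.\<close>

section \<open>Integration over the torus\<close>

text \<open>\<open>multiplier\<close>, and with it \<open>heat\<close> and \<open>freq_part\<close>,
  is a choice among fields with prescribed coefficients, so nothing can be computed from it before
  such a field is known to exist. Existence is shown by writing the field down. Initial datum and
  frequency parts have finitely many frequencies, so trigonometric polynomials serve. For the heat
  flow of the cascade term, the symbol is applied to each wavelet inside the series, which converges
  uniformly by the H^10 decay of the modes. Uniqueness of coefficients then pins down the chosen
  field up to null sets. The other obstacle is normalization. A periodized wavelet may vanish at a
  coarse scale, and pairing the coefficient equation with it leaves the factor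
  \<open>(norm_T (wavelet i n))\<^sup>2\<close>, which is then 0. The energy equation has no such
  factor, so Gronwall's argument is run on energies; it makes the forcing vanish below
  \<open>n0\<close>, and only then can the factor be dropped at all scales. The constant
  \<open>18 * pi\<^sup>2\<close> arises from
  \<open>heat_rate k \<le> 9 * pi\<^sup>2 * (dil n)\<^sup>2\<close> and a factor of at most 2 for
  passing from \<open>2 * E\<close> to \<open>E\<close>.\<close>

definition unit_cube :: "(real ^ 3) set"
  where "unit_cube = {x. \<forall>j. 0 \<le> x $ j \<and> x $ j < 1}"

lemma lat_simps [simp]:
  "lat 0 = 0" "lat (k + l) = lat k + lat l" "lat (- k) = - lat k" "lat (k - l) = lat k - lat l"
  "lat k $ j = of_int (k $ j)"
  by (auto simp: lat_def vec_eq_iff)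

lemma unit_cube_borel [measurable]: "unit_cube \<in> sets borel"
proof -
  have "unit_cube = (\<Inter>j. {x. 0 \<le> x $ j} \<inter> {x. x $ j < 1})"
    by (auto simp: unit_cube_def)
  also have "\<dots> \<in> sets borel"
    by (intro sets.countable_INT) auto
  finally show ?thesis .
qed

lemma cbox01: "x \<in> cbox (0::real^3) 1 \<longleftrightarrow> (\<forall>j. 0 \<le> x $ j \<and> x $ j \<le> 1)"
  by (auto simp: mem_box_cart)

lemma box01: "x \<in> box (0::real^3) 1 \<longleftrightarrow> (\<forall>j. 0 < x $ j \<and> x $ j < 1)"
  by (auto simp: mem_box_cart)

lemma unit_cube_subset: "unit_cube \<subseteq> cbox 0 1" "box 0 1 \<subseteq> unit_cube"
  by (auto simp: unit_cube_def cbox01 box01 less_imp_le)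

lemma AE_cbox_imp_box: "AE x in lborel. x \<in> cbox (0::real^3) 1 \<longrightarrow> x \<in> box 0 1"
proof -
  have "negligible (cbox (0::real^3) 1 - box 0 1)"
    by (rule negligible_frontier_interval)
  hence "cbox (0::real^3) 1 - box 0 1 \<in> null_sets lborel"
    by (subst (asm) negligible_iff_null_sets) (auto simp: null_sets_completion_iff)
  from AE_not_in[OF this] show ?thesis by eventually_elim auto
qed

text \<open>\<open>T3\<close> lives on the closed cube, where a point of the torus may have several
  representatives on opposite faces. Tiling needs exactly one, which the half-open cube provides;
  the faces are null, so integrals may be taken over either.\<close>

lemma AE_cbox_iff_unit_cube: "AE x in lborel. x \<in> cbox (0::real^3) 1 \<longleftrightarrow> x \<in> unit_cube"
  using AE_cbox_imp_box by eventually_elim (use unit_cube_subset in auto)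

lemma space_T3 [simp]: "space T3 = cbox 0 1"
  by (simp add: T3_def space_restrict_space)

lemma measurable_T3 [measurable (raw)]: "f \<in> borel_measurable borel \<Longrightarrow> f \<in> borel_measurable T3"
  unfolding T3_def by (intro measurable_restrict_space1) simp

lemma nn_integral_T3:
  assumes [measurable]: "f \<in> borel_measurable borel"
  shows "(\<integral>\<^sup>+x. f x \<partial>T3) = (\<integral>\<^sup>+x. f x * indicator unit_cube x \<partial>lborel)"
  unfolding T3_def
  by (subst nn_integral_restrict_space)
    (auto intro!: nn_integral_cong_AE eventually_mono[OF AE_cbox_iff_unit_cube] simp: indicator_def)

lemma integral_T3:
  fixes f :: "real^3 \<Rightarrow> 'a::{banach,second_countable_topology}"
  assumes [measurable]: "f \<in> borel_measurable borel"
  shows "(\<integral>x. f x \<partial>T3) = (\<integral>x. indicator unit_cube x *\<^sub>R f x \<partial>lborel)"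
  unfolding T3_def
  by (subst integral_restrict_space)
    (auto intro!: integral_cong_AE eventually_mono[OF AE_cbox_iff_unit_cube] simp: indicator_def)

lemma AE_T3:
  assumes "AE x in T3. P x"
  shows "AE x in lborel. x \<in> cbox 0 1 \<longrightarrow> P x"
  using assms unfolding T3_def by (subst (asm) AE_restrict_space_iff) auto

lemma emeasure_T3: "emeasure T3 (space T3) = 1"
proof -
  have "emeasure T3 (cbox 0 1) = emeasure lborel (cbox (0::real^3) 1)"
    unfolding T3_def by (subst emeasure_restrict_space) auto
  also have "\<dots> = 1"
    by (auto simp: emeasure_lborel_cbox_eq Basis_vec_def inner_axis intro!: prod.neutral)
  finally show ?thesis by simp
qed

interpretation T3: finite_measure T3
  by standard (simp only: emeasure_T3, simp)

lemma measure_T3 [simp]: "measure T3 (cbox 0 1) = 1"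
  using emeasure_T3 by (simp add: measure_def)

lemma integrable_T3_bounded:
  fixes f :: "real^3 \<Rightarrow> 'a::{banach,second_countable_topology}"
  assumes [measurable]: "f \<in> borel_measurable borel" and "\<And>x. norm (f x) \<le> C"
  shows "integrable T3 f"
  by (rule T3.integrable_const_bound[where B = C]) (use assms in auto)

section \<open>Tiling space by lattice translates of the cube\<close>

lemma infinite_UNIV_int3: "infinite (UNIV :: (int^3) set)"
proof
  assume "finite (UNIV :: (int^3) set)"
  hence "finite (range (\<lambda>n::int. (\<chi> j. n) :: int^3))"
    by (rule finite_subset[rotated]) auto
  hence "finite (UNIV :: int set)"
    by (rule finite_imageD) (auto simp: inj_on_def vec_eq_iff)
  thus False by simp
qed

lemma unit_cube_translate: "\<exists>!l. x - lat l \<in> unit_cube"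
proof (rule ex1I[of _ "\<chi> j. \<lfloor>x $ j\<rfloor>"])
  show "x - lat (\<chi> j. \<lfloor>x $ j\<rfloor>) \<in> unit_cube"
    by (auto simp: unit_cube_def) linarith
next
  fix l assume "x - lat l \<in> unit_cube"
  hence "l $ j = \<lfloor>x $ j\<rfloor>" for j
    by (auto simp: unit_cube_def intro!: floor_unique[symmetric]) (smt (verit))
  thus "l = (\<chi> j. \<lfloor>x $ j\<rfloor>)"
    by (simp add: vec_eq_iff)
qed

lemma nn_integral_lborel_shift:
  fixes c :: "'a :: euclidean_space"
  assumes [measurable]: "f \<in> borel_measurable borel"
  shows "(\<integral>\<^sup>+x. f (x + c) \<partial>lborel) = (\<integral>\<^sup>+x. f x \<partial>lborel)"
  by (subst (2) lborel_distr_plus[of c, symmetric], subst nn_integral_distr) (auto simp: add.commute)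

lemma integral_lborel_shift:
  fixes c :: "'a :: euclidean_space" and f :: "'a \<Rightarrow> 'b::{banach,second_countable_topology}"
  assumes [measurable]: "f \<in> borel_measurable borel"
  shows "(\<integral>x. f (x + c) \<partial>lborel) = (\<integral>x. f x \<partial>lborel)"
  by (subst (2) lborel_distr_plus[of c, symmetric], subst integral_distr) (auto simp: add.commute)

text \<open>Unfolding: the translates of the half-open cube partition space, and moving each cell
  back to the cube turns the integral into a sum. The majorant \<open>M\<close> yields both the
  integrability of \<open>h\<close> and the interchange of sum and integral.\<close>

lemma integral_lborel_tiling:
  fixes h :: "real^3 \<Rightarrow> 'a::{banach,second_countable_topology}"
  assumes [measurable]: "h \<in> borel_measurable borel"
    and M: "M summable_on (UNIV :: (int^3) set)"
    and bound: "\<And>x l. x \<in> cbox 0 1 \<Longrightarrow> norm (h (x + lat l)) \<le> M l"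
  shows "(\<integral>x. h x \<partial>lborel) = (\<integral>x. (\<Sum>\<^sub>\<infinity>l. h (x + lat l)) \<partial>T3)"
proof -
  have Mpos: "M l \<ge> 0" for l
    by (rule order_trans[OF norm_ge_zero bound[of 0 l]]) (simp add: cbox01)
  \<comment> \<open>Countable additivity and termwise integration are applied to sequences, so the
    lattice is enumerated.\<close>
  obtain b :: "nat \<Rightarrow> int^3" where b: "bij_betw b UNIV UNIV"
    using bij_betw_from_nat_into[OF countableI_type infinite_UNIV_int3] by blast
  have sM: "summable (\<lambda>i. M (b i))"
    using M Mpos summable_on_reindex_bij_betw[OF b, of M]
    by (simp add: summable_on_UNIV_nonneg_real_iff)
  define A where "A i = (\<lambda>x. x - lat (b i)) -` unit_cube" for i
  have A_meas [measurable]: "A i \<in> sets borel" for i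
  proof -
    have "(\<lambda>x. x - lat (b i)) \<in> borel_measurable borel" by simp
    from measurable_sets[OF this unit_cube_borel] show ?thesis by (simp add: A_def)
  qed
  have A_disj: "disjoint_family A"
    unfolding disjoint_family_on_def
  proof (intro ballI impI equals0I)
    fix i j x assume "i \<noteq> j" and x: "x \<in> A i \<inter> A j"
    have "b i = b j"
      using x unit_cube_translate[of x] by (auto simp: A_def)
    thus False
      using \<open>i \<noteq> j\<close> b by (auto simp: bij_betw_def inj_def)
  qed
  have A_UN: "(\<Union>i. A i) = UNIV"
  proof -
    have "x \<in> (\<Union>i. A i)" for x
    proof -
      obtain l where "x - lat l \<in> unit_cube" using unit_cube_translate by blast
      moreover obtain i where "b i = l" using b by (metis bij_betw_def imageE UNIV_I)
      ultimately show ?thesis by (auto simp: A_def)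
    qed
    thus ?thesis by blast
  qed
  have ind: "indicator (A i) (x + lat (b i)) = (indicator unit_cube x :: 'z::zero_neq_one)" for i x
    by (auto simp: A_def indicator_def)
  \<comment> \<open>Each cell has measure 1 and so contributes at most \<open>M (b i)\<close>; this
    gives the integrability of \<open>h\<close>.\<close>
  have "(\<integral>\<^sup>+x. norm (h x) \<partial>lborel) = (\<Sum>i. \<integral>\<^sup>+x. ennreal (norm (h x)) * indicator (A i) x \<partial>lborel)"
    using nn_integral_disjoint_family[of "\<lambda>x. ennreal (norm (h x))" lborel A] A_disj A_UN by simp
  also have "\<dots> = (\<Sum>i. \<integral>\<^sup>+x. ennreal (norm (h (x + lat (b i)))) * indicator unit_cube x \<partial>lborel)"
  proof (rule arg_cong[of _ _ suminf], rule ext)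
    fix i
    show "(\<integral>\<^sup>+x. ennreal (norm (h x)) * indicator (A i) x \<partial>lborel) =
      (\<integral>\<^sup>+x. ennreal (norm (h (x + lat (b i)))) * indicator unit_cube x \<partial>lborel)"
      by (subst nn_integral_lborel_shift[of _ "lat (b i)", symmetric]) (simp_all add: ind)
  qed
  also have "\<dots> \<le> (\<Sum>i. \<integral>\<^sup>+x. ennreal (M (b i)) * indicator unit_cube x \<partial>lborel)"
    by (intro suminf_le nn_integral_mono)
      (use unit_cube_subset in \<open>auto simp: indicator_def intro!: ennreal_leI bound\<close>)
  also have "\<dots> = (\<Sum>i. ennreal (M (b i)))"
  proof -
    have "emeasure lborel unit_cube = 1"
      using nn_integral_T3[of "\<lambda>x. 1"] emeasure_T3 by simp
    thus ?thesis by (simp add: nn_integral_cmult_indicator)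
  qed
  also have "\<dots> < \<infinity>"
    using sM Mpos by (simp add: suminf_ennreal2 less_top)
  finally have int: "integrable lborel h"
    by (intro integrableI_bounded) auto
  have [measurable]: "h \<in> borel_measurable lborel" by simp
  have "(\<integral>x. h x \<partial>lborel) = (\<Sum>i. set_lebesgue_integral lborel (A i) h)"
    using lebesgue_integral_countable_add[of A lborel h] A_disj A_UN int
    by (auto simp: disjoint_family_on_def set_integrable_def set_lebesgue_integral_def)
  also have "\<dots> = (\<Sum>i. \<integral>x. h (x + lat (b i)) \<partial>T3)"
  proof (rule arg_cong[of _ _ suminf], rule ext)
    fix i
    show "set_lebesgue_integral lborel (A i) h = (\<integral>x. h (x + lat (b i)) \<partial>T3)"
      unfolding set_lebesgue_integral_def
      by (subst integral_lborel_shift[of _ "lat (b i)", symmetric]) (simp_all add: ind integral_T3)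
  qed
  also have "\<dots> = (\<integral>x. (\<Sum>i. h (x + lat (b i))) \<partial>T3)"
  proof (rule integral_suminf[symmetric])
    show "integrable T3 (\<lambda>x. h (x + lat (b i)))" for i
      by (rule T3.integrable_const_bound[where B = "M (b i)"]) (auto simp: bound intro!: AE_I2)
    show "AE x in T3. summable (\<lambda>i. norm (h (x + lat (b i))))"
      by (intro AE_I2, rule summable_comparison_test'[OF sM]) (auto simp: bound)
    show "summable (\<lambda>i. \<integral>x. norm (h (x + lat (b i))) \<partial>T3)"
    proof (rule summable_comparison_test'[OF sM])
      fix i
      have "(\<integral>x. norm (h (x + lat (b i))) \<partial>T3) \<le> (\<integral>x. M (b i) \<partial>T3)"
      proof (rule integral_mono)
        show "integrable T3 (\<lambda>x. norm (h (x + lat (b i))))"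
          by (rule T3.integrable_const_bound[where B = "M (b i)"]) (auto simp: bound intro!: AE_I2)
      qed (auto simp: bound)
      thus "norm (\<integral>x. norm (h (x + lat (b i))) \<partial>T3) \<le> M (b i)"
        by simp
    qed
  qed
  also have "\<dots> = (\<integral>x. (\<Sum>\<^sub>\<infinity>l. h (x + lat l)) \<partial>T3)"
  proof (rule Bochner_Integration.integral_cong[OF refl])
    fix x assume "x \<in> space T3"
    hence nsum: "summable (\<lambda>i. norm (h (x + lat (b i))))"
      by (intro summable_comparison_test'[OF sM]) (auto simp: bound)
    \<comment> \<open>Absolute convergence makes the value independent of the enumeration
      \<open>b\<close>.\<close>
    have "((\<lambda>i. h (x + lat (b i))) has_sum (\<Sum>i. h (x + lat (b i)))) UNIV"
      by (rule norm_summable_imp_has_sum[OF nsum summable_sums[OF summable_norm_cancel[OF nsum]]])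
    hence "(\<Sum>i. h (x + lat (b i))) = (\<Sum>\<^sub>\<infinity>i. h (x + lat (b i)))"
      by (simp add: infsumI)
    also have "\<dots> = (\<Sum>\<^sub>\<infinity>l. h (x + lat l))"
      by (rule infsum_reindex_bij_betw[OF b])
    finally show "(\<Sum>i. h (x + lat (b i))) = (\<Sum>\<^sub>\<infinity>l. h (x + lat l))" .
  qed
  finally show "(\<integral>x. h x \<partial>lborel) = (\<integral>x. (\<Sum>\<^sub>\<infinity>l. h (x + lat l)) \<partial>T3)" .
qed

section \<open>Exponentials on the torus\<close>

definition fexp :: "int^3 \<Rightarrow> real^3 \<Rightarrow> complex"
  where "fexp k x = cis (2 * pi * (lat k \<bullet> x))"

lemma fexp_0 [simp]: "fexp 0 x = 1"
  by (simp add: fexp_def)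

lemma fexp_add: "fexp (k + l) x = fexp k x * fexp l x"
  by (simp add: fexp_def cis_mult algebra_simps)

lemma fexp_add_right: "fexp k (x + y) = fexp k x * fexp k y"
  by (simp add: fexp_def cis_mult algebra_simps)

lemma fexp_minus: "fexp (- k) x = cnj (fexp k x)"
  by (simp add: fexp_def cis_cnj)

lemma norm_fexp [simp]: "norm (fexp k x) = 1"
  by (simp add: fexp_def)

lemma lat_inner_lat: "lat k \<bullet> lat l = of_int (\<Sum>j\<in>UNIV. k $ j * l $ j)"
  by (simp add: inner_vec_def)

lemma fexp_lat [simp]: "fexp k (lat l) = 1"
  unfolding fexp_def lat_inner_lat
  by (metis cis_multiple_2pi Ints_of_int mult.commute)

lemma fexp_periodic [simp]: "fexp k (x + lat l) = fexp k x"
  by (simp add: fexp_add_right)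

lemma continuous_fexp [continuous_intros]: "continuous_on S (fexp k)"
  unfolding fexp_def cis_conv_exp by (intro continuous_intros)

lemma fexp_measurable [measurable]: "fexp k \<in> borel_measurable borel"
  by (intro borel_measurable_continuous_onI continuous_intros)

lemma finite_lat_cube: "finite {l :: int^3. \<forall>j. \<bar>l $ j\<bar> \<le> N}"
proof (rule finite_imageD)
  show "finite (vec_nth ` {l :: int^3. \<forall>j. \<bar>l $ j\<bar> \<le> N})"
    by (rule finite_subset[of _ "PiE UNIV (\<lambda>_. {-N..N})"]) (auto intro!: finite_PiE simp: abs_le_iff minus_le_iff)
qed (auto simp: inj_on_def vec_nth_inject)

lemma finite_lat_ball: "finite {l :: int^3. norm (lat l) \<le> R}"
proof (rule finite_subset[OF _ finite_lat_cube[of "\<lceil>R\<rceil>"]], safe)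
  fix l :: "int^3" and j assume "norm (lat l) \<le> R"
  hence "\<bar>lat l $ j\<bar> \<le> R" using component_le_norm_cart[of "lat l" j] by linarith
  thus "\<bar>l $ j\<bar> \<le> \<lceil>R\<rceil>" by (simp add: le_ceiling_iff)
qed

text \<open>Translating by half a period of the exponential flips its sign.\<close>

lemma integral_fexp: "(\<integral>x. fexp k x \<partial>T3) = (if k = 0 then 1 else 0)"
proof (cases "k = 0")
  case False
  then obtain j where j: "k $ j \<noteq> 0" by (auto simp: vec_eq_iff)
  define y :: "real^3" where "y = axis j (1 / (2 * of_int (k $ j)))"
  have flip: "fexp k (x + y) = - fexp k x" for x
  proof -
    have "lat k \<bullet> y = 1 / 2" using j by (simp add: y_def inner_axis)
    hence "fexp k y = cis pi" unfolding fexp_def by (simp only:) simp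
    thus ?thesis by (simp add: fexp_add_right)
  qed
  \<comment> \<open>The exponential cut off to the cube translated by \<open>y\<close>, which is
    again a fundamental domain. Its lattice sum is therefore \<open>fexp k\<close>, while
    translating it back by \<open>y\<close> gives \<open>- fexp k\<close> on the standard cube. Only
    finitely many translates meet the cube, since \<open>x\<close> and \<open>y\<close> have
    coordinates of size at most 1.\<close>
  define h where "h x = indicator unit_cube (x - y) *\<^sub>R fexp k x" for x
  have [measurable]: "h \<in> borel_measurable borel"
    unfolding h_def by measurable
  let ?F = "{l :: int^3. \<forall>j. \<bar>l $ j\<bar> \<le> 3}"
  have y_le: "\<bar>y $ i\<bar> \<le> 1" for i
    using j by (auto simp: y_def axis_def field_simps abs_if)
  have "(\<integral>x. h x \<partial>lborel) = (\<integral>x. (\<Sum>\<^sub>\<infinity>l. h (x + lat l)) \<partial>T3)"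
  proof (rule integral_lborel_tiling[where M = "indicator ?F"])
    show "(indicator ?F :: _ \<Rightarrow> real) summable_on UNIV"
      by (rule finite_nonzero_values_imp_summable_on)
        (use finite_lat_cube[of 3] in \<open>auto simp: indicator_def\<close>)
    fix x l assume x: "x \<in> cbox (0::real^3) 1"
    have "l \<in> ?F" if "x + lat l - y \<in> unit_cube"
    proof safe
      fix i
      have "0 \<le> x $ i + of_int (l $ i) - y $ i" "x $ i + of_int (l $ i) - y $ i < 1"
        "0 \<le> x $ i" "x $ i \<le> 1"
        using that x by (auto simp: unit_cube_def cbox01)
      thus "\<bar>l $ i\<bar> \<le> 3" using y_le[of i] by linarith
    qed
    thus "norm (h (x + lat l)) \<le> indicator ?F l"
      by (auto simp: h_def indicator_def)
  qed auto
  also have "(\<lambda>x. \<Sum>\<^sub>\<infinity>l. h (x + lat l)) = fexp k"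
  proof
    fix x
    obtain l0 where l0: "x - y - lat l0 \<in> unit_cube" "\<And>l. x - y - lat l \<in> unit_cube \<Longrightarrow> l = l0"
      using unit_cube_translate[of "x - y"] by blast
    have "(\<Sum>\<^sub>\<infinity>l. h (x + lat l)) = (\<Sum>\<^sub>\<infinity>l\<in>{- l0}. h (x + lat l))"
    proof (rule infsum_cong_neutral)
      fix l assume "l \<in> UNIV - {- l0}"
      hence "x - y - lat (- l) \<notin> unit_cube" using l0(2) by fastforce
      thus "h (x + lat l) = 0" by (simp add: h_def algebra_simps)
    qed auto
    also have "\<dots> = fexp k x" using l0(1) by (simp add: h_def algebra_simps)
    finally show "(\<Sum>\<^sub>\<infinity>l. h (x + lat l)) = fexp k x" .
  qed
  also have "(\<integral>x. h x \<partial>lborel) = (\<integral>x. h (x + y) \<partial>lborel)"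
    by (rule integral_lborel_shift[symmetric]) simp
  also have "\<dots> = (\<integral>x. - fexp k x \<partial>T3)"
    by (subst integral_T3) (simp_all add: h_def flip)
  finally show ?thesis using False by (simp add: eq_neg_iff_add_eq_0 mult_2[symmetric] flip: minus_equation_iff)
qed simp

section \<open>Uniqueness of Fourier coefficients\<close>

text \<open>Vanishing of all Fourier coefficients is preserved by multiplication with exponentials, hence
  with polynomials in the coordinates of the embedded torus. Stone--Weierstrass on its compact
  image extends this to continuous functions, and these approximate indicators of compact sets.\<close>

definition null_coeffs :: "(real^3 \<Rightarrow> complex) \<Rightarrow> bool"
  where "null_coeffs g \<longleftrightarrow> g \<in> borel_measurable borel \<and> integrable T3 g \<and>
    (\<forall>k. (\<integral>x. g x * fexp k x \<partial>T3) = 0)"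

definition torus_embedding :: "real^3 \<Rightarrow> complex^3"
  where "torus_embedding x = (\<chi> j. cis (2 * pi * x $ j))"

lemma torus_embedding_nth: "torus_embedding x $ j = fexp (axis j 1) x"
proof -
  have "lat (axis j 1) = axis j 1" by (simp add: vec_eq_iff axis_def)
  thus ?thesis by (simp add: torus_embedding_def fexp_def inner_axis')
qed

lemma continuous_torus_embedding [continuous_intros]: "continuous_on S torus_embedding"
  unfolding torus_embedding_def cis_conv_exp by (intro continuous_intros)

lemma torus_embedding_measurable [measurable]: "torus_embedding \<in> borel_measurable borel"
  by (intro borel_measurable_continuous_onI continuous_intros)

lemma integrable_mult_bounded:
  fixes f g :: "'a \<Rightarrow> complex"
  assumes "integrable M f" "g \<in> borel_measurable M" "\<And>x. x \<in> space M \<Longrightarrow> norm (g x) \<le> C"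
  shows "integrable M (\<lambda>x. f x * g x)"
proof (rule Bochner_Integration.integrable_bound)
  show "integrable M (\<lambda>x. C *\<^sub>R f x)" using assms by auto
  show "AE x in M. norm (f x * g x) \<le> norm (C *\<^sub>R f x)"
  proof (rule AE_I2)
    fix x assume "x \<in> space M"
    hence "norm (g x) \<le> \<bar>C\<bar>" using assms(3)[of x] by linarith
    thus "norm (f x * g x) \<le> norm (C *\<^sub>R f x)"
      using mult_left_mono[of "norm (g x)" "\<bar>C\<bar>" "norm (f x)"] by (simp add: norm_mult mult.commute)
  qed
qed (use assms in auto)

lemma null_coeffs_integrable_fexp: "null_coeffs g \<Longrightarrow> integrable T3 (\<lambda>x. g x * fexp k x)"
  unfolding null_coeffs_def by (intro integrable_mult_bounded[where C = 1]) auto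

lemma null_coeffs_fexp: "null_coeffs g \<Longrightarrow> null_coeffs (\<lambda>x. g x * fexp k x)"
  using null_coeffs_integrable_fexp[of g k]
  unfolding null_coeffs_def by (auto simp: mult.assoc fexp_add[symmetric])

lemma null_coeffs_cmult: "null_coeffs g \<Longrightarrow> null_coeffs (\<lambda>x. g x * c)"
proof -
  assume g: "null_coeffs g"
  have "(\<integral>x. g x * c * fexp k x \<partial>T3) = (\<integral>x. g x * fexp k x * c \<partial>T3)" for k
    by (simp add: mult_ac)
  thus ?thesis using g unfolding null_coeffs_def by auto
qed

lemma null_coeffs_add: "null_coeffs f \<Longrightarrow> null_coeffs g \<Longrightarrow> null_coeffs (\<lambda>x. f x + g x)"
  using null_coeffs_integrable_fexp[of f] null_coeffs_integrable_fexp[of g]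
  unfolding null_coeffs_def by (auto simp: distrib_right)

lemma null_coeffs_sum:
  "finite I \<Longrightarrow> (\<And>i. i \<in> I \<Longrightarrow> null_coeffs (f i)) \<Longrightarrow> null_coeffs (\<lambda>x. \<Sum>i\<in>I. f i x)"
  by (induction I rule: finite_induct) (auto intro!: null_coeffs_add, simp add: null_coeffs_def)

text \<open>The field \<open>g\<close> is arbitrary in the induction: for a product, one factor is
  first absorbed into \<open>g\<close> and the other induction hypothesis is applied to the
  result.\<close>

lemma null_coeffs_polynomial:
  fixes p :: "complex^3 \<Rightarrow> real"
  assumes "real_polynomial_function p" "null_coeffs g"
  shows "null_coeffs (\<lambda>x. g x * of_real (p (torus_embedding x)))"
  using assms
proof (induction p arbitrary: g rule: real_polynomial_function.induct)
  case (linear p)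
  interpret p: bounded_linear p by fact
  have "null_coeffs (\<lambda>x. g x * of_real (torus_embedding x \<bullet> b))" if "b \<in> Basis" for b :: "complex^3"
  proof -
    note b_Basis = that
    obtain j c where b: "b = axis j c" using b_Basis by (auto simp: Basis_vec_def)
    \<comment> \<open>The real inner product of \<open>z\<close> and \<open>c\<close> is
      \<open>(z * cnj c + cnj z * c) / 2\<close>, and the conjugate of an exponential is the
      exponential of the opposite frequency.\<close>
    have "g x * of_real (torus_embedding x \<bullet> b) =
      g x * fexp (axis j 1) x * (cnj c / 2) + g x * fexp (- axis j 1) x * (c / 2)" for x
      unfolding b inner_axis torus_embedding_nth
      by (simp add: fexp_minus complex_eq_iff inner_complex_def field_simps)
    thus ?thesis using linear.prems
      by (simp only: null_coeffs_add null_coeffs_cmult null_coeffs_fexp)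
  qed
  hence "null_coeffs (\<lambda>x. \<Sum>b\<in>Basis. g x * of_real (torus_embedding x \<bullet> b) * of_real (p b))"
    by (intro null_coeffs_sum null_coeffs_cmult) auto
  also have "(\<lambda>x. \<Sum>b\<in>Basis. g x * of_real (torus_embedding x \<bullet> b) * of_real (p b)) =
    (\<lambda>x. g x * of_real (p (torus_embedding x)))"
  proof
    fix x
    have "p (torus_embedding x) = p (\<Sum>b\<in>Basis. (torus_embedding x \<bullet> b) *\<^sub>R b)"
      by (simp add: euclidean_representation)
    also have "\<dots> = (\<Sum>b\<in>Basis. (torus_embedding x \<bullet> b) * p b)"
      by (simp add: p.sum p.scaleR)
    finally show "(\<Sum>b\<in>Basis. g x * of_real (torus_embedding x \<bullet> b) * of_real (p b)) =
      g x * of_real (p (torus_embedding x))"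
      by (simp add: sum_distrib_left mult.assoc)
  qed
  finally show ?case .
next
  case (const c)
  thus ?case by (rule null_coeffs_cmult)
next
  case (add p q)
  thus ?case by (auto simp: distrib_left intro!: null_coeffs_add)
next
  case (mult p q)
  thus ?case by (auto simp: mult.assoc[symmetric])
qed

lemma null_coeffs_continuous:
  fixes h :: "complex^3 \<Rightarrow> real"
  assumes h: "continuous_on UNIV h" and g: "null_coeffs g"
  shows "(\<integral>x. g x * of_real (h (torus_embedding x)) \<partial>T3) = 0"
proof -
  let ?S = "torus_embedding ` cbox 0 1"
  have S: "compact ?S" by (intro compact_continuous_image continuous_intros compact_cbox)
  have [measurable]: "h \<in> borel_measurable borel" "g \<in> borel_measurable borel"
    using h g by (auto intro: borel_measurable_continuous_onI simp: null_coeffs_def)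
  have ig: "integrable T3 g" using g by (simp add: null_coeffs_def)
  obtain C where C: "\<And>z. z \<in> ?S \<Longrightarrow> \<bar>h z\<bar> \<le> C"
    using compact_imp_bounded[OF compact_continuous_image[OF continuous_on_subset[OF h] S]]
    by (auto simp: bounded_iff)
  have igh: "integrable T3 (\<lambda>x. g x * of_real (h (torus_embedding x)))"
    by (intro integrable_mult_bounded[where C = C] ig) (auto intro!: C)
  define I where "I = (\<integral>x. norm (g x) \<partial>T3)"
  have "norm (\<integral>x. g x * of_real (h (torus_embedding x)) \<partial>T3) \<le> e * I" if "e > 0" for e
  proof -
    obtain p where p: "real_polynomial_function p" "\<And>z. z \<in> ?S \<Longrightarrow> \<bar>h z - p z\<bar> < e"
      using Stone_Weierstrass_real_polynomial_function[OF S continuous_on_subset[OF h] \<open>e > 0\<close>] by blast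
    have nc: "null_coeffs (\<lambda>x. g x * of_real (p (torus_embedding x)))"
      by (rule null_coeffs_polynomial[OF p(1) g])
    hence "(\<integral>x. g x * of_real (p (torus_embedding x)) * fexp 0 x \<partial>T3) = 0"
      unfolding null_coeffs_def by blast
    hence *: "(\<integral>x. g x * of_real (p (torus_embedding x)) \<partial>T3) = 0" by simp
    have ip: "integrable T3 (\<lambda>x. g x * of_real (p (torus_embedding x)))"
      using nc by (simp add: null_coeffs_def)
    have "(\<integral>x. g x * of_real (h (torus_embedding x)) \<partial>T3) =
      (\<integral>x. g x * of_real (h (torus_embedding x)) - g x * of_real (p (torus_embedding x)) \<partial>T3)"
      using * by (simp add: Bochner_Integration.integral_diff[OF igh ip])
    also have "norm \<dots> \<le> (\<integral>x. e * norm (g x) \<partial>T3)"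
    proof (rule order_trans[OF integral_norm_bound integral_mono])
      show "integrable T3 (\<lambda>x. e * norm (g x))" using ig by auto
      show "norm (g x * of_real (h (torus_embedding x)) - g x * of_real (p (torus_embedding x))) \<le> e * norm (g x)"
        if "x \<in> space T3" for x
      proof -
        have "\<bar>h (torus_embedding x) - p (torus_embedding x)\<bar> \<le> e"
          using that p(2)[of "torus_embedding x"] by (simp add: less_imp_le)
        thus ?thesis
          by (subst mult.commute[of e]) (simp add: norm_mult mult_left_mono flip: right_diff_distrib of_real_diff)
      qed
    qed (use igh ip in auto)
    finally show ?thesis by (simp add: I_def)
  qed
  note bnd = this
  have "norm (\<integral>x. g x * of_real (h (torus_embedding x)) \<partial>T3) \<le> 0 + e" if "e > 0" for e
  proof -
    have "I \<ge> 0" by (simp add: I_def)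
    \<comment> \<open>\<open>I\<close> may be 0, so \<open>e\<close> is divided by
      \<open>I + 1\<close>.\<close>
    have "norm (\<integral>x. g x * of_real (h (torus_embedding x)) \<partial>T3) \<le> e / (I + 1) * I"
      using \<open>I \<ge> 0\<close> \<open>e > 0\<close> by (intro bnd) auto
    also have "\<dots> \<le> e" using \<open>I \<ge> 0\<close> \<open>e > 0\<close> by (simp add: field_simps)
    finally show ?thesis by simp
  qed
  hence "norm (\<integral>x. g x * of_real (h (torus_embedding x)) \<partial>T3) \<le> 0"
    by (rule field_le_epsilon)
  thus ?thesis by simp
qed

text \<open>The embedding identifies opposite faces, so one of the two points has to be interior.
  For this reason indicators are approximated first for compact sets inside the open cube.\<close>

lemma torus_embedding_inj:
  assumes "torus_embedding x = torus_embedding y" "x \<in> cbox 0 1" "y \<in> box 0 1"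
  shows "x = y"
proof -
  have "x $ j = y $ j" for j
  proof -
    have "cis (2 * pi * x $ j) = cis (2 * pi * y $ j)"
      using assms(1) by (simp add: torus_embedding_def vec_eq_iff)
    hence "sin (2 * pi * x $ j) = sin (2 * pi * y $ j) \<and> cos (2 * pi * x $ j) = cos (2 * pi * y $ j)"
      by (simp add: complex_eq_iff)
    then obtain n :: int where "2 * pi * x $ j = 2 * pi * y $ j + 2 * pi * n"
      unfolding sin_cos_eq_iff by blast
    hence "2 * pi * x $ j = 2 * pi * (y $ j + n)" by (simp add: algebra_simps)
    hence n: "x $ j = y $ j + n" by simp
    moreover have "0 \<le> x $ j" "x $ j \<le> 1" "0 < y $ j" "y $ j < 1"
      using assms(2,3) by (auto simp: cbox01 box01)
    ultimately have "n = 0" by linarith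
    thus ?thesis using n by simp
  qed
  thus ?thesis by (simp add: vec_eq_iff)
qed

lemma null_coeffs_compact:
  assumes g: "null_coeffs g" and D: "compact D" "D \<subseteq> box 0 1"
  shows "(\<integral>x. g x * indicator D x \<partial>T3) = 0"
proof (cases "D = {}")
  case False
  have [measurable]: "g \<in> borel_measurable borel" using g by (simp add: null_coeffs_def)
  have ig: "integrable T3 g" using g by (simp add: null_coeffs_def)
  have [measurable]: "D \<in> sets borel" using D by (simp add: borel_compact)
  define K where "K = torus_embedding ` D"
  have K: "closed K" "K \<noteq> {}"
    using False unfolding K_def
    by (auto intro!: compact_imp_closed compact_continuous_image continuous_intros D)
  \<comment> \<open>Tent functions equal to 1 on \<open>K\<close> and, for positive
    \<open>n\<close>, 0 at distance \<open>1 / n\<close> or more; they converge pointwise to the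
    indicator because \<open>K\<close> is closed.\<close>
  define h where "h n z = max 0 (1 - real n * infdist z K)" for n z
  have h_cont: "continuous_on UNIV (h n)" for n
    unfolding h_def by (intro continuous_intros)
  have h_01: "0 \<le> h n z" "h n z \<le> 1" for n z
    by (auto simp: h_def infdist_nonneg)
  have [measurable]: "h n \<in> borel_measurable borel" for n
    using h_cont by (intro borel_measurable_continuous_onI)
  have lim: "(\<lambda>n. h n z) \<longlonglongrightarrow> indicator K z" for z
  proof (cases "z \<in> K")
    case True thus ?thesis by (simp add: h_def infdist_zero)
  next
    case False
    hence pos: "infdist z K > 0" using K in_closed_iff_infdist_zero[of K z] infdist_nonneg[of z K] by fastforce
    obtain N :: nat where N: "1 / infdist z K < N" using reals_Archimedean2 by blast
    have "h n z = 0" if "n \<ge> N" for n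
    proof -
      have "1 / infdist z K \<le> real n" using N that by linarith
      thus ?thesis using pos by (simp add: h_def field_simps)
    qed
    hence "eventually (\<lambda>n. h n z = 0) sequentially" by (auto simp: eventually_at_top_linorder)
    thus ?thesis using False by (simp add: tendsto_eventually)
  qed
  have "(\<lambda>n. \<integral>x. g x * of_real (h n (torus_embedding x)) \<partial>T3) \<longlonglongrightarrow> (\<integral>x. g x * indicator D x \<partial>T3)"
  proof (rule integral_dominated_convergence[where w = "\<lambda>x. norm (g x)"])
    show "AE x in T3. (\<lambda>n. g x * of_real (h n (torus_embedding x))) \<longlonglongrightarrow> g x * indicator D x"
    proof (rule AE_I2)
      fix x assume x: "x \<in> space T3"
      have "torus_embedding x \<in> K \<longleftrightarrow> x \<in> D"
        using torus_embedding_inj[of x] x D by (force simp: K_def)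
      hence "(indicator D x :: complex) = of_real (indicator K (torus_embedding x))"
        by (simp add: indicator_def)
      thus "(\<lambda>n. g x * of_real (h n (torus_embedding x))) \<longlonglongrightarrow> g x * indicator D x"
        using tendsto_mult[OF tendsto_const tendsto_of_real[OF lim]] by simp
    qed
    show "AE x in T3. norm (g x * of_real (h n (torus_embedding x))) \<le> norm (g x)" for n
      using h_01 by (intro AE_I2) (simp add: norm_mult mult_left_le)
  qed (use ig in auto)
  moreover have "(\<integral>x. g x * of_real (h n (torus_embedding x)) \<partial>T3) = 0" for n
    by (rule null_coeffs_continuous[OF h_cont g])
  ultimately show ?thesis by (simp add: LIMSEQ_const_iff)
qed simp

text \<open>The compact boxes \<open>Q n\<close> exhaust the open cube and the faces are null, so
  dominated convergence passes from \<open>D \<inter> Q n\<close> to \<open>D\<close>.\<close>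

lemma null_coeffs_closed:
  assumes g: "null_coeffs g" and D: "closed D"
  shows "(\<integral>x. g x * indicator D x \<partial>T3) = 0"
proof -
  have [measurable]: "g \<in> borel_measurable borel" using g by (simp add: null_coeffs_def)
  have ig: "integrable T3 g" using g by (simp add: null_coeffs_def)
  have [measurable]: "D \<in> sets borel" using D by simp
  define Q :: "nat \<Rightarrow> (real^3) set" where "Q n = cbox (\<chi> j. 1 / (n + 2)) (\<chi> j. 1 - 1 / (n + 2))" for n
  have Q: "Q n \<subseteq> box 0 1" for n
  proof -
    have "1 / (real n + 2) > 0" by simp
    moreover have "1 / (real n + 2) \<le> x $ j \<and> x $ j \<le> 1 - 1 / (real n + 2)" if "x \<in> Q n" for x j
      using that by (simp add: Q_def mem_box_cart)
    ultimately have "0 < x $ j \<and> x $ j < 1" if "x \<in> Q n" for x j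
      using that by (metis diff_gt_0_iff_gt le_less_trans less_le_trans diff_less_eq less_add_same_cancel1)
    thus ?thesis by (auto simp: box01)
  qed
  have Qlim: "eventually (\<lambda>n. x \<in> Q n) sequentially" if "x \<in> box 0 1" for x
  proof -
    have "eventually (\<lambda>n::nat. 1 / (real n + 2) < x $ j \<and> 1 / (real n + 2) < 1 - x $ j) sequentially" for j
    proof -
      have "(\<lambda>n::nat. 1 / (real n + 2)) \<longlonglongrightarrow> 0" using LIMSEQ_ignore_initial_segment[OF lim_1_over_n[where 'a = real], of 2] by (simp add: add.commute)
      hence "eventually (\<lambda>n::nat. 1 / (real n + 2) < min (x $ j) (1 - x $ j)) sequentially"
        using that by (intro order_tendstoD) (auto simp: box01)
      thus ?thesis by (rule eventually_mono) auto
    qed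
    hence "eventually (\<lambda>n::nat. \<forall>j. 1 / (real n + 2) < x $ j \<and> 1 / (real n + 2) < 1 - x $ j) sequentially"
      by (rule eventually_all_finite)
    thus ?thesis
      by (rule eventually_mono) (auto simp: Q_def mem_box_cart less_imp_le algebra_simps)
  qed
  have ae: "AE x in T3. x \<in> box 0 1"
    using AE_cbox_imp_box unfolding T3_def by (subst AE_restrict_space_iff) auto
  have "(\<lambda>n. \<integral>x. g x * indicator (D \<inter> Q n) x \<partial>T3) \<longlonglongrightarrow> (\<integral>x. g x * indicator D x \<partial>T3)"
  proof (rule integral_dominated_convergence[where w = "\<lambda>x. norm (g x)"])
    have [measurable]: "Q n \<in> sets borel" for n by (simp add: Q_def)
    show "(\<lambda>x. g x * indicator (D \<inter> Q n) x) \<in> borel_measurable T3" for n by measurable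
    show "AE x in T3. (\<lambda>n. g x * indicator (D \<inter> Q n) x) \<longlonglongrightarrow> g x * indicator D x"
      using ae
    proof eventually_elim
      case (elim x)
      have "eventually (\<lambda>n. g x * indicator (D \<inter> Q n) x = g x * indicator D x) sequentially"
        using Qlim[OF elim] by eventually_elim (auto simp: indicator_def)
      thus ?case by (rule tendsto_eventually)
    qed
    show "AE x in T3. norm (g x * indicator (D \<inter> Q n) x) \<le> norm (g x)" for n
      by (intro AE_I2) (simp add: norm_mult indicator_def)
  qed (use ig in auto)
  moreover have "(\<integral>x. g x * indicator (D \<inter> Q n) x \<partial>T3) = 0" for n
    by (rule null_coeffs_compact[OF g]) (use D Q[of n] in \<open>auto simp: Q_def closed_Int_compact\<close>)
  ultimately show ?thesis by (simp add: LIMSEQ_const_iff)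
qed

text \<open>Closed sets are stable under intersection and generate the Borel sets, so by Dynkin's
  theorem only complements and countable disjoint unions remain. Complements use that the whole
  space is closed.\<close>

lemma null_coeffs_borel:
  assumes g: "null_coeffs g" and A: "A \<in> sets borel"
  shows "(\<integral>x. g x * indicator A x \<partial>T3) = 0"
proof -
  have gm [measurable]: "g \<in> borel_measurable borel" using g by (simp add: null_coeffs_def)
  have ig: "integrable T3 g" using g by (simp add: null_coeffs_def)
  have igA: "integrable T3 (\<lambda>x. g x * indicator A x)" if [measurable]: "A \<in> sets borel" for A
    by (intro integrable_mult_bounded[where C = 1] ig) (auto simp: indicator_def)
  have S: "sigma_sets UNIV (Collect closed) = sets (borel :: (real^3) measure)"
    by (metis borel_eq_closed Pow_UNIV sets_measure_of top_greatest)
  have stable: "Int_stable (Collect (closed :: (real^3) set \<Rightarrow> bool))" by (auto simp: Int_stable_def)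
  have "A \<in> sigma_sets UNIV (Collect closed)"
    using A S by simp
  from stable subset_UNIV[of "Collect closed", folded Pow_UNIV] this show ?thesis
  proof (induction rule: sigma_sets_induct_disjoint)
    case (basic A) thus ?case using null_coeffs_closed[OF g] by auto
  next
    case empty thus ?case by simp
  next
    case (compl A)
    hence [measurable]: "A \<in> sets borel" using S by blast
    have "(\<integral>x. g x * indicator (UNIV - A) x \<partial>T3) = (\<integral>x. g x - g x * indicator A x \<partial>T3)"
      by (intro Bochner_Integration.integral_cong) (auto simp: indicator_def)
    also have "\<dots> = (\<integral>x. g x * indicator UNIV x \<partial>T3) - (\<integral>x. g x * indicator A x \<partial>T3)"
      using ig igA by simp
    also have "\<dots> = 0" using compl null_coeffs_closed[OF g, of UNIV] by simp
    finally show ?case .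
  next
    case (union A)
    hence [measurable]: "A i \<in> sets borel" for i using S by blast
    have "(\<lambda>n. \<integral>x. g x * (\<Sum>i<n. indicator (A i) x) \<partial>T3) \<longlonglongrightarrow> (\<integral>x. g x * indicator (\<Union>i. A i) x \<partial>T3)"
    proof (rule integral_dominated_convergence[where w = "\<lambda>x. norm (g x)"])
      have *: "(\<Sum>i<n. indicator (A i) x) = (indicator (\<Union>i<n. A i) x :: complex)" for n x
        using union(1) by (subst indicator_UN_disjoint[of "{..<n}"]) (auto simp: disjoint_family_on_def)
      show "AE x in T3. (\<lambda>n. g x * (\<Sum>i<n. indicator (A i) x)) \<longlonglongrightarrow> g x * indicator (\<Union>i. A i) x"
        unfolding * by (intro AE_I2 tendsto_intros LIMSEQ_indicator_UN)
      show "AE x in T3. norm (g x * (\<Sum>i<n. indicator (A i) x)) \<le> norm (g x)" for n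
        unfolding * by (intro AE_I2) (simp add: norm_mult indicator_def)
    qed (use ig in auto)
    moreover have "(\<integral>x. g x * (\<Sum>i<n. indicator (A i) x) \<partial>T3) = 0" for n
      unfolding sum_distrib_left
      by (subst Bochner_Integration.integral_sum) (simp_all only: igA union(3) \<open>\<And>i. A i \<in> sets borel\<close> sum.neutral_const)
    ultimately show ?case by (simp add: LIMSEQ_const_iff)
  qed
qed

text \<open>The integrals of \<open>r\<close> over the sets where it is positive and where it is
  negative both vanish, and on each of them the integrand has one sign.\<close>

lemma fourier_unique_real:
  fixes r :: "real^3 \<Rightarrow> real"
  assumes [measurable]: "r \<in> borel_measurable borel" and r: "integrable T3 r"
    and coeffs: "\<And>k. (\<integral>x. of_real (r x) * fexp k x \<partial>T3) = 0"
  shows "AE x in T3. r x = 0"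
proof -
  have nc: "null_coeffs (\<lambda>x. of_real (r x))" using assms by (auto simp: null_coeffs_def)
  have int0: "(\<integral>x. r x * indicator A x \<partial>T3) = 0" if [measurable]: "A \<in> sets borel" for A
  proof -
    have "of_real (\<integral>x. r x * indicator A x \<partial>T3) = (\<integral>x. of_real (r x) * indicator A x \<partial>T3 :: complex)"
      by (subst integral_complex_of_real[symmetric]) (auto intro!: Bochner_Integration.integral_cong simp: indicator_def)
    also have "\<dots> = 0" by (rule null_coeffs_borel[OF nc that])
    finally show ?thesis by simp
  qed
  define P where "P = {x. r x > 0}"
  define N where "N = {x. r x < 0}"
  have [measurable]: "P \<in> sets borel" "N \<in> sets borel" unfolding P_def N_def by measurable
  have ir: "integrable T3 (\<lambda>x. r x * indicator A x)" if [measurable]: "A \<in> sets borel" for A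
    by (rule Bochner_Integration.integrable_bound[OF r]) (auto simp: indicator_def)
  have "AE x in T3. r x * indicator P x = 0"
  proof (subst integral_nonneg_eq_0_iff_AE[symmetric])
    show "AE x in T3. 0 \<le> r x * indicator P x" by (auto simp: P_def indicator_def)
  qed (use int0[of P] ir[of P] in simp_all)
  moreover have "AE x in T3. - (r x * indicator N x) = 0"
  proof (subst integral_nonneg_eq_0_iff_AE[symmetric])
    show "AE x in T3. 0 \<le> - (r x * indicator N x)" by (auto simp: N_def indicator_def)
  qed (use int0[of N] ir[of N] in simp_all)
  ultimately show ?thesis
    by eventually_elim (auto simp: P_def N_def indicator_def split: if_splits)
qed

section \<open>Fourier coefficients of square-integrable fields\<close>

lemma fourier_T_nth: "fourier_T f k $ j = (\<integral>x. of_real (f x $ j) * fexp (- k) x \<partial>T3)"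
proof -
  have "exp (- 2 * pi * \<i> * complex_of_real (lat k \<bullet> x)) = fexp (- k) x" for x
    by (simp add: fexp_def cis_conv_exp mult_ac)
  thus ?thesis by (simp add: fourier_T_def)
qed

text \<open>Fields are real-valued, which ties the coefficients at \<open>k\<close> and
  \<open>- k\<close> together. This is why finite frequency sets are taken symmetric from here
  on.\<close>

lemma fourier_T_uminus_nth: "fourier_T f (- k) $ j = cnj (fourier_T f k $ j)"
  unfolding fourier_T_nth Bochner_Integration.integral_cnj[symmetric] by (simp add: fexp_minus)

lemma L2_T_measurable [measurable_dest]: "L2_T f \<Longrightarrow> f \<in> borel_measurable borel"
  by (simp add: L2_T_def)

lemma nth_measurable [measurable (raw)]:
  "f \<in> borel_measurable M \<Longrightarrow> (\<lambda>x. (f x :: real^3) $ j) \<in> borel_measurable M"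
  by (rule borel_measurable_continuous_on[of "\<lambda>x. x $ j", rotated]) (auto intro: continuous_intros)

lemma L2_T_inner_integrable:
  assumes f: "L2_T f" and g: "L2_T g"
  shows "integrable T3 (\<lambda>x. f x \<bullet> g x)"
proof (rule Bochner_Integration.integrable_bound)
  show "integrable T3 (\<lambda>x. (norm (f x))\<^sup>2 + (norm (g x))\<^sup>2)"
    using assms by (auto simp: L2_T_def)
  show "(\<lambda>x. f x \<bullet> g x) \<in> borel_measurable T3"
    using f g by measurable
  show "AE x in T3. norm (f x \<bullet> g x) \<le> norm ((norm (f x))\<^sup>2 + (norm (g x))\<^sup>2)"
  proof (rule AE_I2)
    fix x
    have "\<bar>f x \<bullet> g x\<bar> \<le> norm (f x) * norm (g x)" by (rule Cauchy_Schwarz_ineq2)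
    also have "\<dots> \<le> (norm (f x))\<^sup>2 + (norm (g x))\<^sup>2"
    proof -
      have "0 \<le> norm (f x) * norm (g x)" by simp
      thus ?thesis using sum_squares_bound[of "norm (f x)" "norm (g x)"] by linarith
    qed
    finally show "norm (f x \<bullet> g x) \<le> norm ((norm (f x))\<^sup>2 + (norm (g x))\<^sup>2)" by simp
  qed
qed

lemma L2_T_bounded:
  assumes "f \<in> borel_measurable borel" "periodic f" "\<And>x. norm (f x) \<le> C"
  shows "L2_T f"
  unfolding L2_T_def
proof (intro conjI integrable_T3_bounded[where C = "C\<^sup>2"])
  show "norm ((norm (f x))\<^sup>2) \<le> C\<^sup>2" for x using assms(3)[of x] by (simp add: power_mono)
qed (use assms in auto)

lemma L2_T_const: "L2_T (\<lambda>x. c)"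
  by (rule L2_T_bounded[where C = "norm c"]) (auto simp: periodic_def)

lemma L2_T_add:
  assumes f: "L2_T f" and g: "L2_T g"
  shows "L2_T (\<lambda>x. f x + g x)"
  unfolding L2_T_def
proof (intro conjI)
  show "periodic (\<lambda>x. f x + g x)" using assms by (auto simp: L2_T_def periodic_def)
  show "(\<lambda>x. f x + g x) \<in> borel_measurable borel" using f g by measurable
  have "(norm (f x + g x))\<^sup>2 = (norm (f x))\<^sup>2 + 2 * (f x \<bullet> g x) + (norm (g x))\<^sup>2" for x
    by (simp add: power2_norm_eq_inner inner_add inner_commute)
  thus "integrable T3 (\<lambda>x. (norm (f x + g x))\<^sup>2)"
    using L2_T_inner_integrable[OF f g] f g by (auto simp: L2_T_def)
qed

lemma L2_T_scaleR: "L2_T f \<Longrightarrow> L2_T (\<lambda>x. c *\<^sub>R f x)"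
  unfolding L2_T_def by (auto simp: periodic_def power_mult_distrib)

lemma L2_T_diff: "L2_T f \<Longrightarrow> L2_T g \<Longrightarrow> L2_T (\<lambda>x. f x - g x)"
  using L2_T_add[OF _ L2_T_scaleR[of g "-1"], of f] by simp

lemma L2_T_nth_integrable: "L2_T f \<Longrightarrow> integrable T3 (\<lambda>x. f x $ j)"
  using L2_T_inner_integrable[OF _ L2_T_const[of "axis j 1"], of f] by (simp add: inner_axis)

lemma L2_T_fexp_integrable:
  assumes "L2_T f"
  shows "integrable T3 (\<lambda>x. of_real (f x $ j) * fexp k x)"
  by (rule integrable_mult_bounded[where C = 1]) (use L2_T_nth_integrable[OF assms] in auto)

lemma fourier_T_add:
  "L2_T f \<Longrightarrow> L2_T g \<Longrightarrow> fourier_T (\<lambda>x. f x + g x) k = fourier_T f k + fourier_T g k"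
  by (simp add: vec_eq_iff fourier_T_nth distrib_right L2_T_fexp_integrable)

lemma fourier_T_diff:
  "L2_T f \<Longrightarrow> L2_T g \<Longrightarrow> fourier_T (\<lambda>x. f x - g x) k = fourier_T f k - fourier_T g k"
  by (simp add: vec_eq_iff fourier_T_nth left_diff_distrib L2_T_fexp_integrable)

lemma fourier_T_scaleR: "fourier_T (\<lambda>x. c *\<^sub>R f x) k = c *\<^sub>R fourier_T f k"
  by (simp add: vec_eq_iff fourier_T_nth mult.assoc scaleR_conv_of_real[where 'a = complex])

lemma L2_T_sum: "finite I \<Longrightarrow> (\<And>i. i \<in> I \<Longrightarrow> L2_T (f i)) \<Longrightarrow> L2_T (\<lambda>x. \<Sum>i\<in>I. f i x)"
  by (induction I rule: finite_induct) (auto intro: L2_T_const L2_T_add)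

lemma fourier_T_sum:
  "finite I \<Longrightarrow> (\<And>i. i \<in> I \<Longrightarrow> L2_T (f i)) \<Longrightarrow> fourier_T (\<lambda>x. \<Sum>i\<in>I. f i x) k = (\<Sum>i\<in>I. fourier_T (f i) k)"
proof (induction I rule: finite_induct)
  case empty
  show ?case by (simp add: vec_eq_iff fourier_T_nth)
qed (auto simp: fourier_T_add L2_T_sum)

lemma fourier_T_cong_AE:
  assumes [measurable]: "f \<in> borel_measurable borel" "g \<in> borel_measurable borel"
    and "AE x in T3. f x = g x"
  shows "fourier_T f k = fourier_T g k"
  unfolding vec_eq_iff fourier_T_nth
  by (intro allI integral_cong_AE) (use assms(3) in auto)

lemma fourier_T_eq_AE:
  assumes f: "L2_T f" and g: "L2_T g" and eq: "\<And>k. fourier_T f k = fourier_T g k"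
  shows "AE x in T3. f x = g x"
proof -
  have "AE x in T3. f x $ j - g x $ j = 0" for j
  proof (rule fourier_unique_real)
    fix k
    have "fourier_T (\<lambda>x. f x - g x) (- k) $ j = 0"
      by (simp add: fourier_T_diff f g eq)
    thus "(\<integral>x. of_real (f x $ j - g x $ j) * fexp k x \<partial>T3) = 0"
      by (simp add: fourier_T_nth)
  next
    show "(\<lambda>x. f x $ j - g x $ j) \<in> borel_measurable borel" using f g by measurable
    show "integrable T3 (\<lambda>x. f x $ j - g x $ j)"
      using L2_T_nth_integrable[OF f] L2_T_nth_integrable[OF g] by simp
  qed
  hence "AE x in T3. \<forall>j. f x $ j - g x $ j = 0" by (simp add: AE_all_countable)
  thus ?thesis by eventually_elim (simp add: vec_eq_iff)
qed

section \<open>Trigonometric polynomials and Parseval's identity\<close>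

text \<open>Real parts make this a real field for any coefficients. For Hermitian ones on a
  symmetric set the imaginary parts cancel in pairs, and it is the usual complex trigonometric
  sum.\<close>

definition trig_field :: "(int^3) set \<Rightarrow> (int^3 \<Rightarrow> complex^3) \<Rightarrow> vfield"
  where "trig_field F a x = (\<Sum>k\<in>F. \<chi> j. Re (a k $ j * fexp k x))"

definition hermitian_on :: "(int^3) set \<Rightarrow> (int^3 \<Rightarrow> complex^3) \<Rightarrow> bool"
  where "hermitian_on F a \<longleftrightarrow> (\<forall>k\<in>F. - k \<in> F \<and> (\<forall>j. a (- k) $ j = cnj (a k $ j)))"

lemma hermitian_on_fourier_T: "(\<And>k. k \<in> F \<Longrightarrow> - k \<in> F) \<Longrightarrow> hermitian_on F (fourier_T f)"
  by (simp add: hermitian_on_def fourier_T_uminus_nth)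

lemma trig_field_nth:
  assumes "hermitian_on F a"
  shows "of_real (trig_field F a x $ j) = (\<Sum>k\<in>F. a k $ j * fexp k x)"
proof -
  have "cnj (\<Sum>k\<in>F. a k $ j * fexp k x) = (\<Sum>k\<in>F. cnj (a k $ j) * fexp (- k) x)"
    by (simp add: fexp_minus)
  also have "\<dots> = (\<Sum>k\<in>F. a k $ j * fexp k x)"
    by (rule sum.reindex_bij_witness[of _ uminus uminus]) (use assms in \<open>auto simp: hermitian_on_def\<close>)
  finally have "(\<Sum>k\<in>F. a k $ j * fexp k x) \<in> \<real>"
    by (simp only: Reals_cnj_iff)
  hence "of_real (Re (\<Sum>k\<in>F. a k $ j * fexp k x)) = (\<Sum>k\<in>F. a k $ j * fexp k x)"
    by (rule of_real_Re)
  thus ?thesis by (simp add: trig_field_def)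
qed

lemma norm_trig_field_le: "norm (trig_field F a x) \<le> (\<Sum>k\<in>F. norm (a k))"
  unfolding trig_field_def
proof (rule sum_norm_le)
  fix k
  have "\<bar>Re (a k $ j * fexp k x)\<bar> \<le> norm (a k $ j)" for j
    using abs_Re_le_cmod[of "a k $ j * fexp k x"] by (simp add: norm_mult)
  thus "norm (\<chi> j. Re (a k $ j * fexp k x)) \<le> norm (a k)"
    unfolding norm_vec_def by (intro L2_set_mono) auto
qed

lemma continuous_trig_field: "continuous_on S (trig_field F a)"
  unfolding trig_field_def by (intro continuous_intros)

lemma periodic_trig_field: "periodic (trig_field F a)"
  by (simp add: periodic_def trig_field_def)

lemma L2_T_trig_field: "L2_T (trig_field F a)"
  by (rule L2_T_bounded[OF _ periodic_trig_field norm_trig_field_le])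
    (intro borel_measurable_continuous_onI continuous_trig_field)

lemma fourier_T_trig_field:
  assumes "finite F" and h: "hermitian_on F a"
  shows "fourier_T (trig_field F a) l = (if l \<in> F then a l else 0)"
proof -
  have "fourier_T (trig_field F a) l $ j = (if l \<in> F then a l $ j else 0)" for j
  proof -
    have "fourier_T (trig_field F a) l $ j = (\<integral>x. (\<Sum>k\<in>F. a k $ j * fexp (k - l) x) \<partial>T3)"
      unfolding fourier_T_nth trig_field_nth[OF h]
      by (simp add: sum_distrib_right mult.assoc flip: fexp_add)
    also have "\<dots> = (\<Sum>k\<in>F. \<integral>x. a k $ j * fexp (k - l) x \<partial>T3)"
      by (intro Bochner_Integration.integral_sum integrable_T3_bounded[where C = "norm (a _ $ j)"])
        (auto simp: norm_mult)
    also have "\<dots> = (\<Sum>k\<in>F. if k = l then a k $ j else 0)"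
      by (intro sum.cong) (auto simp: integral_fexp)
    finally show ?thesis using \<open>finite F\<close> by simp
  qed
  thus ?thesis by (simp add: vec_eq_iff)
qed

section \<open>Inner product and norm on the torus\<close>

lemma inner_T_cong_AE:
  assumes [measurable]: "f \<in> borel_measurable borel" "g \<in> borel_measurable borel" "h \<in> borel_measurable borel"
    and "AE x in T3. g x = h x"
  shows "inner_T f g = inner_T f h"
  unfolding inner_T_def by (intro integral_cong_AE) (use assms(4) in auto)

lemma norm_T_eq_sqrt: "norm_T f = sqrt (inner_T f f)"
  by (simp add: norm_T_def inner_T_def power2_norm_eq_inner)

lemma inner_T_self_nonneg: "inner_T f f \<ge> 0"
  by (simp add: inner_T_def)

lemma norm_T_nonneg [simp]: "norm_T f \<ge> 0"
  by (simp add: norm_T_eq_sqrt inner_T_self_nonneg)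

lemma norm_T_sq: "(norm_T f)\<^sup>2 = inner_T f f"
  by (simp add: norm_T_eq_sqrt inner_T_self_nonneg)

lemma norm_T_scaleR: "norm_T (\<lambda>x. c *\<^sub>R f x) = \<bar>c\<bar> * norm_T f"
  by (simp add: norm_T_def power_mult_distrib real_sqrt_mult)

lemma norm_T_cong_AE:
  assumes [measurable]: "f \<in> borel_measurable borel" "g \<in> borel_measurable borel"
    and "AE x in T3. f x = g x"
  shows "norm_T f = norm_T g"
  unfolding norm_T_def
  by (intro arg_cong[of _ _ sqrt] integral_cong_AE) (use assms(3) in auto)

lemma inner_T_diff_scaleR_self:
  assumes f: "L2_T f" and g: "L2_T g"
  shows "inner_T (\<lambda>x. f x - c *\<^sub>R g x) (\<lambda>x. f x - c *\<^sub>R g x) =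
    inner_T f f - 2 * c * inner_T f g + c\<^sup>2 * inner_T g g"
proof -
  have "inner_T (\<lambda>x. f x - c *\<^sub>R g x) (\<lambda>x. f x - c *\<^sub>R g x) =
    (\<integral>x. f x \<bullet> f x - 2 * c * (f x \<bullet> g x) + c\<^sup>2 * (g x \<bullet> g x) \<partial>T3)"
    unfolding inner_T_def
    by (intro Bochner_Integration.integral_cong)
      (auto simp: inner_diff inner_commute power2_eq_square algebra_simps)
  also have "\<dots> = inner_T f f - 2 * c * inner_T f g + c\<^sup>2 * inner_T g g"
    using L2_T_inner_integrable[OF f f] L2_T_inner_integrable[OF f g] L2_T_inner_integrable[OF g g]
    by (simp add: inner_T_def)
  finally show ?thesis .
qed

lemma inner_T_Cauchy_Schwarz:
  assumes f: "L2_T f" and g: "L2_T g"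
  shows "\<bar>inner_T f g\<bar> \<le> norm_T f * norm_T g"
proof -
  let ?A = "inner_T f f" and ?B = "inner_T f g" and ?C = "inner_T g g"
  have q: "0 \<le> ?A - 2 * c * ?B + c\<^sup>2 * ?C" for c
    using inner_T_self_nonneg[of "\<lambda>x. f x - c *\<^sub>R g x"]
    unfolding inner_T_diff_scaleR_self[OF f g] .
  have "?B\<^sup>2 \<le> ?A * ?C"
  proof (cases "?C = 0")
    case True
    have "?B = 0"
    proof (rule ccontr)
      assume "?B \<noteq> 0"
      \<comment> \<open>Without the quadratic term the expression is affine in \<open>c\<close>;
        this \<open>c\<close> gives it the value -1.\<close>
      thus False using q[of "(?A + 1) / (2 * ?B)"] True by (simp add: field_simps)
    qed
    thus ?thesis using True by simp
  next
    case False
    hence "?C > 0" using inner_T_self_nonneg[of g] by simp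
    thus ?thesis using q[of "?B / ?C"] by (simp add: field_simps power2_eq_square)
  qed
  hence "sqrt (?B\<^sup>2) \<le> sqrt (?A * ?C)" by (rule real_sqrt_le_mono)
  thus ?thesis by (simp add: norm_T_eq_sqrt real_sqrt_mult)
qed

lemma norm_T_triangle_diff:
  assumes f: "L2_T f" and g: "L2_T g"
  shows "\<bar>norm_T f - norm_T g\<bar> \<le> norm_T (\<lambda>x. f x - g x)"
proof (rule power2_le_imp_le)
  have "\<bar>norm_T f - norm_T g\<bar>\<^sup>2 = (norm_T f)\<^sup>2 + (norm_T g)\<^sup>2 - 2 * (norm_T f * norm_T g)"
    by (simp add: power2_diff)
  also have "\<dots> \<le> inner_T f f + inner_T g g - 2 * inner_T f g"
    using inner_T_Cauchy_Schwarz[OF f g] by (simp add: norm_T_sq)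
  also have "\<dots> = (norm_T (\<lambda>x. f x - g x))\<^sup>2"
    using inner_T_diff_scaleR_self[OF f g, of 1] by (simp add: norm_T_sq)
  finally show "\<bar>norm_T f - norm_T g\<bar>\<^sup>2 \<le> (norm_T (\<lambda>x. f x - g x))\<^sup>2" .
qed simp

text \<open>The inner product on \<open>complex^3\<close> is the real one, that is, the real part of
  the Hermitian pairing, so each frequency contributes a real number.\<close>

lemma inner_T_trig_field:
  assumes f: "L2_T f" and F: "finite F" and h: "hermitian_on F a"
  shows "inner_T f (trig_field F a) = (\<Sum>k\<in>F. fourier_T f k \<bullet> a k)"
proof -
  have int: "integrable T3 (\<lambda>x. Re (a k $ j * (of_real (f x $ j) * fexp k x)))" for k j
    by (intro integrable_Re integrable_mult_right L2_T_fexp_integrable f)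
  have "inner_T f (trig_field F a) =
    (\<integral>x. (\<Sum>k\<in>F. \<Sum>j\<in>UNIV. Re (a k $ j * (of_real (f x $ j) * fexp k x))) \<partial>T3)"
    unfolding inner_T_def trig_field_def inner_sum_right
    by (simp add: inner_vec_def algebra_simps)
  also have "\<dots> = (\<Sum>k\<in>F. \<Sum>j\<in>UNIV. \<integral>x. Re (a k $ j * (of_real (f x $ j) * fexp k x)) \<partial>T3)"
    by (subst Bochner_Integration.integral_sum, intro Bochner_Integration.integrable_sum int)
      (intro sum.cong refl Bochner_Integration.integral_sum int)
  also have "\<dots> = (\<Sum>k\<in>F. \<Sum>j\<in>UNIV. fourier_T f k $ j \<bullet> a k $ j)"
  proof (intro sum.cong refl)
    fix k j
    have "(\<integral>x. Re (a k $ j * (of_real (f x $ j) * fexp k x)) \<partial>T3) =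
      Re (a k $ j * (\<integral>x. of_real (f x $ j) * fexp k x \<partial>T3))"
      using L2_T_fexp_integrable[OF f] by (subst integral_Re) auto
    also have "(\<integral>x. of_real (f x $ j) * fexp k x \<partial>T3) = cnj (fourier_T f k $ j)"
      unfolding fourier_T_nth Bochner_Integration.integral_cnj[symmetric] by (simp add: fexp_minus)
    finally show "(\<integral>x. Re (a k $ j * (of_real (f x $ j) * fexp k x)) \<partial>T3) = fourier_T f k $ j \<bullet> a k $ j"
      by (simp add: inner_complex_def algebra_simps)
  qed
  finally show ?thesis by (simp add: inner_vec_def)
qed

lemma trig_field_fourier_T_AE:
  assumes g: "L2_T g" and F: "finite F" "\<And>k. k \<in> F \<Longrightarrow> - k \<in> F" "\<And>k. k \<notin> F \<Longrightarrow> fourier_T g k = 0"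
  shows "AE x in T3. g x = trig_field F (fourier_T g) x"
  by (rule fourier_T_eq_AE[OF g L2_T_trig_field])
    (use F in \<open>auto simp: fourier_T_trig_field hermitian_on_fourier_T\<close>)

text \<open>Only \<open>g\<close> has finitely many frequencies; it may be replaced by its
  trigonometric polynomial, and \<open>f\<close> stays arbitrary.\<close>

lemma inner_T_Parseval:
  assumes f: "L2_T f" and g: "L2_T g"
    and F: "finite F" "\<And>k. k \<in> F \<Longrightarrow> - k \<in> F" "\<And>k. k \<notin> F \<Longrightarrow> fourier_T g k = 0"
  shows "inner_T f g = (\<Sum>k\<in>F. fourier_T f k \<bullet> fourier_T g k)"
proof -
  have "inner_T f g = inner_T f (trig_field F (fourier_T g))"
    by (rule inner_T_cong_AE) (use f g L2_T_trig_field trig_field_fourier_T_AE[OF g F] in \<open>auto simp: L2_T_def\<close>)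
  thus ?thesis
    using inner_T_trig_field[OF f F(1) hermitian_on_fourier_T[OF F(2)]] by simp
qed

text \<open>With \<open>g\<close> the projection of \<open>f\<close> to the frequencies in
  \<open>F\<close>, both \<open>inner_T f g\<close> and \<open>inner_T g g\<close> equal the sum,
  and the squared norm of \<open>f - g\<close> is nonnegative.\<close>

lemma fourier_T_Bessel:
  assumes f: "L2_T f" and F: "finite F" "\<And>k. k \<in> F \<Longrightarrow> - k \<in> F"
  shows "(\<Sum>k\<in>F. (norm (fourier_T f k))\<^sup>2) \<le> (norm_T f)\<^sup>2"
proof -
  have h: "hermitian_on F (fourier_T f)" using F(2) by (rule hermitian_on_fourier_T)
  define g where "g = trig_field F (fourier_T f)"
  let ?S = "\<Sum>k\<in>F. (norm (fourier_T f k))\<^sup>2"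
  have g: "L2_T g" unfolding g_def by (rule L2_T_trig_field)
  have 1: "inner_T f g = ?S"
    unfolding g_def by (subst inner_T_trig_field[OF f F(1) h]) (auto simp: power2_norm_eq_inner)
  have 2: "inner_T g g = ?S"
    using inner_T_trig_field[OF g F(1) h] unfolding g_def
    by (simp add: fourier_T_trig_field[OF F(1) h] power2_norm_eq_inner)
  have "0 \<le> inner_T f f - 2 * ?S + ?S"
    using inner_T_self_nonneg[of "\<lambda>x. f x - 1 *\<^sub>R g x"]
    unfolding inner_T_diff_scaleR_self[OF f g] 1 2 by simp
  thus ?thesis by (simp add: norm_T_sq)
qed

lemma norm_fourier_T_le:
  assumes "L2_T f"
  shows "norm (fourier_T f k) \<le> norm_T f"
proof (rule power2_le_imp_le)
  have "(norm (fourier_T f k))\<^sup>2 \<le> (\<Sum>k\<in>{k, - k}. (norm (fourier_T f k))\<^sup>2)"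
    by (rule member_le_sum) auto
  also have "\<dots> \<le> (norm_T f)\<^sup>2" by (rule fourier_T_Bessel[OF assms]) auto
  finally show "(norm (fourier_T f k))\<^sup>2 \<le> (norm_T f)\<^sup>2" .
qed simp

section \<open>Multiplier images and test fields\<close>

lemma is_multiplier_image_multiplier:
  "is_multiplier_image \<sigma> f g \<Longrightarrow> is_multiplier_image \<sigma> f (multiplier \<sigma> f)"
  unfolding multiplier_def by (rule someI[of "is_multiplier_image \<sigma> f"])

text \<open>Existence of the image for finitely many frequencies: an even real symbol keeps the
  coefficients Hermitian. This covers the frequency parts and the heat flow of the initial
  datum.\<close>

lemma is_multiplier_image_trig_field:
  assumes "finite F" "\<And>k. \<sigma> (- k) = \<sigma> k" "\<And>k. k \<in> F \<Longrightarrow> - k \<in> F"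
    "\<And>k. k \<notin> F \<Longrightarrow> \<sigma> k *\<^sub>R fourier_T f k = 0"
  shows "is_multiplier_image \<sigma> f (trig_field F (\<lambda>k. \<sigma> k *\<^sub>R fourier_T f k))"
proof -
  have "hermitian_on F (\<lambda>k. \<sigma> k *\<^sub>R fourier_T f k)"
    using assms by (auto simp: hermitian_on_def fourier_T_uminus_nth)
  thus ?thesis using assms
    by (auto simp: is_multiplier_image_def L2_T_trig_field fourier_T_trig_field)
qed

lemma norm_T_Parseval:
  assumes g: "L2_T g"
    and F: "finite F" "\<And>k. k \<in> F \<Longrightarrow> - k \<in> F" "\<And>k. k \<notin> F \<Longrightarrow> fourier_T g k = 0"
  shows "(norm_T g)\<^sup>2 = (\<Sum>k\<in>F. (norm (fourier_T g k))\<^sup>2)"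
  unfolding norm_T_sq using inner_T_Parseval[OF g g F] by (simp add: power2_norm_eq_inner)

text \<open>The conjugate coefficient at \<open>- k\<close> makes the field real. Letting
  \<open>b\<close> run through all complex vectors recovers the full complex coefficient at
  \<open>k\<close> from real pairings.\<close>

definition test_field :: "int^3 \<Rightarrow> complex^3 \<Rightarrow> vfield"
  where "test_field k b = trig_field {k, - k} (\<lambda>l. if l = k then b else (\<chi> j. cnj (b $ j)))"

lemma L2_T_test_field: "L2_T (test_field k b)"
  by (simp add: test_field_def L2_T_trig_field)

text \<open>The frequencies \<open>k\<close> and \<open>- k\<close> contribute equally, whence the
  factor 2. They have to be distinct, so \<open>k = 0\<close> is excluded.\<close>

lemma inner_T_test_field:
  assumes f: "L2_T f" and "k \<noteq> 0"
  shows "inner_T f (test_field k b) = 2 * (fourier_T f k \<bullet> b)"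
proof -
  have "- k \<noteq> k"
  proof
    assume "- k = k"
    hence "- (k $ j) = k $ j" for j by (metis vector_uminus_component)
    hence "k = 0" by (simp add: vec_eq_iff)
    with \<open>k \<noteq> 0\<close> show False by simp
  qed
  moreover from this have "hermitian_on {k, - k} (\<lambda>l. if l = k then b else (\<chi> j. cnj (b $ j)))"
    by (auto simp: hermitian_on_def)
  moreover have "fourier_T f (- k) \<bullet> (\<chi> j. cnj (b $ j)) = fourier_T f k \<bullet> b"
    by (simp add: inner_vec_def fourier_T_uminus_nth inner_complex_def)
  ultimately show ?thesis
    using inner_T_trig_field[OF f, of "{k, - k}"] by (simp add: test_field_def)
qed

text \<open>A nonempty open set is not null. A lattice translation brings a point of difference into
  the cube, possibly onto a face; as it lies in the closure of the open cube, the open set of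
  differences meets the interior.\<close>

lemma continuous_periodic_AE_imp_eq:
  fixes f g :: vfield
  assumes f: "continuous_on UNIV f" "periodic f" and g: "continuous_on UNIV g" "periodic g"
    and ae: "AE x in T3. f x = g x"
  shows "f = g"
proof (rule ccontr)
  assume "f \<noteq> g"
  then obtain x0 where "f x0 \<noteq> g x0" by auto
  moreover obtain l where l: "x0 - lat l \<in> unit_cube" using unit_cube_translate by blast
  ultimately have x1: "f (x0 - lat l) \<noteq> g (x0 - lat l)"
    using f(2) g(2) unfolding periodic_def by (metis diff_add_cancel)
  define S where "S = {x. f x \<noteq> g x} \<inter> box 0 1"
  have op: "open {x. f x \<noteq> g x}" using f(1) g(1) by (rule open_Collect_neq)
  hence S: "open S" unfolding S_def by (intro open_Int open_box)
  have "x0 - lat l \<in> closure (box 0 1)"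
    using l unit_cube_subset by (subst closure_box) (auto simp: box_ne_empty box_eq_empty inner_axis Basis_vec_def)
  hence "S \<noteq> {}"
    unfolding S_def using op x1 by (subst (asm) closure_iff_nhds_not_empty) blast
  have "AE x in lborel. x \<notin> S"
    using AE_T3[OF ae] by eventually_elim (auto simp: S_def dest: box_subset_cbox[THEN subsetD])
  hence "S \<in> null_sets lborel"
    using S by (subst (asm) AE_iff_null_sets[symmetric]) auto
  hence "emeasure lborel S = 0" by auto
  moreover have "emeasure lborel S > 0"
  proof -
    have "\<not> negligible S" using S \<open>S \<noteq> {}\<close> open_not_negligible by blast
    thus ?thesis using S
      by (auto simp: negligible_iff_null_sets null_sets_completion_iff null_sets_def zero_less_iff_neq_zero)
  qed
  ultimately show False by simp
qed

section \<open>Periodization\<close>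

text \<open>The subtracted term lets the induction close: \<open>2 / (N + 2)\<^sup>2\<close> is at
  most the telescoping difference \<open>2 / (N + 1) - 2 / (N + 2)\<close>.\<close>

lemma sum_inverse_square_le:
  "(\<Sum>j\<in>{- int N..int N}. 1 / (1 + real_of_int \<bar>j\<bar>)\<^sup>2) \<le> 4 - 2 / (real N + 1)"
proof (induction N)
  case (Suc N)
  have "{- int (Suc N)..int (Suc N)} = insert (- int (Suc N)) (insert (int (Suc N)) {- int N..int N})"
    by auto
  hence "(\<Sum>j\<in>{- int (Suc N)..int (Suc N)}. 1 / (1 + real_of_int \<bar>j\<bar>)\<^sup>2) =
    2 / (real N + 2)\<^sup>2 + (\<Sum>j\<in>{- int N..int N}. 1 / (1 + real_of_int \<bar>j\<bar>)\<^sup>2)"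
    by (simp add: add_ac)
  also have "\<dots> \<le> 2 / (real N + 2)\<^sup>2 + (4 - 2 / (real N + 1))"
    using Suc.IH by simp
  also have "\<dots> \<le> 4 - 2 / (real (Suc N) + 1)"
    by (simp add: divide_simps power2_eq_square) (simp add: algebra_simps)
  finally show ?case .
qed simp

text \<open>The exponent 6 is twice the dimension, so the weight is at most a product of inverse
  squares, one per coordinate. The same exponent appears in \<open>rapidly_decaying\<close> and in
  the growth bound for the wavelets.\<close>

definition lat_decay :: "int^3 \<Rightarrow> real"
  where "lat_decay l = 1 / (1 + norm (lat l)) ^ 6"

lemma lat_decay_nonneg: "lat_decay l \<ge> 0"
  by (simp add: lat_decay_def)

lemma lat_decay_summable: "lat_decay summable_on UNIV"
proof (rule nonneg_bdd_above_summable_on)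
  show "bdd_above (sum lat_decay ` {F. F \<subseteq> UNIV \<and> finite F})"
  proof (rule bdd_aboveI2)
    fix F :: "(int^3) set" assume "F \<in> {F. F \<subseteq> UNIV \<and> finite F}"
    hence F: "finite F" by simp
    define a where "a j = 1 / (1 + real_of_int \<bar>j\<bar>)\<^sup>2" for j :: int
    \<comment> \<open>\<open>N\<close> bounds all coordinates of all points of \<open>F\<close>, so
      \<open>F\<close> lies in a cube, over which the sum of products factors.\<close>
    define N where "N = (\<Sum>l\<in>F. \<Sum>j\<in>UNIV. nat \<bar>l $ j\<bar>)"
    have N: "\<bar>l $ j\<bar> \<le> int N" if "l \<in> F" for l j
    proof -
      have "nat \<bar>l $ j\<bar> \<le> (\<Sum>j\<in>UNIV. nat \<bar>l $ j\<bar>)" by (rule member_le_sum) auto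
      also have "\<dots> \<le> N" unfolding N_def using F that by (intro member_le_sum) auto
      finally show ?thesis by linarith
    qed
    have decay_le: "lat_decay l \<le> (\<Prod>j\<in>UNIV. a (l $ j))" for l
    proof -
      have "1 + real_of_int \<bar>l $ j\<bar> \<le> 1 + norm (lat l)" for j
        using component_le_norm_cart[of "lat l" j] by simp
      hence "(\<Prod>j\<in>UNIV. (1 + real_of_int \<bar>l $ j\<bar>)\<^sup>2) \<le> (\<Prod>j\<in>(UNIV::3 set). (1 + norm (lat l))\<^sup>2)"
        by (intro prod_mono conjI power_mono) auto
      also have "\<dots> = (1 + norm (lat l)) ^ 6" by (simp flip: power_mult)
      finally have "(\<Prod>j\<in>UNIV. (1 + real_of_int \<bar>l $ j\<bar>)\<^sup>2) \<le> (1 + norm (lat l)) ^ 6" .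
      moreover have "(\<Prod>j\<in>UNIV. (1 + real_of_int \<bar>l $ j\<bar>)\<^sup>2) > 0"
        by (intro prod_pos) (auto intro!: zero_less_power add_pos_nonneg)
      ultimately have "1 / (1 + norm (lat l)) ^ 6 \<le> 1 / (\<Prod>j\<in>UNIV. (1 + real_of_int \<bar>l $ j\<bar>)\<^sup>2)"
        by (intro divide_left_mono mult_pos_pos) (auto intro!: zero_less_power add_pos_nonneg)
      thus ?thesis by (simp add: lat_decay_def a_def prod_dividef)
    qed
    have "sum lat_decay F \<le> (\<Sum>l\<in>F. \<Prod>j\<in>UNIV. a (l $ j))"
      by (intro sum_mono decay_le)
    also have "\<dots> = (\<Sum>g\<in>vec_nth ` F. \<Prod>j\<in>UNIV. a (g j))"
      by (subst sum.reindex) (auto simp: inj_on_def vec_nth_inject)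
    also have "\<dots> \<le> (\<Sum>g\<in>PiE (UNIV :: 3 set) (\<lambda>_. {- int N..int N}). \<Prod>j\<in>UNIV. a (g j))"
    proof (rule sum_mono2)
      show "vec_nth ` F \<subseteq> PiE (UNIV :: 3 set) (\<lambda>_. {- int N..int N})"
        using N by (auto simp: abs_le_iff minus_le_iff)
    qed (auto intro!: finite_PiE prod_nonneg simp: a_def)
    also have "\<dots> = (\<Prod>j\<in>(UNIV :: 3 set). \<Sum>k\<in>{- int N..int N}. a k)"
      by (subst prod_sum_PiE) auto
    also have "\<dots> \<le> (\<Prod>j\<in>(UNIV :: 3 set). 4)"
    proof (intro prod_mono conjI)
      have "(\<Sum>k\<in>{- int N..int N}. a k) \<le> 4 - 2 / (real N + 1)"
        unfolding a_def by (rule sum_inverse_square_le)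
      also have "\<dots> \<le> 4" by simp
      finally show "(\<Sum>k\<in>{- int N..int N}. a k) \<le> 4" .
    qed (auto simp: a_def intro!: sum_nonneg)
    finally show "sum lat_decay F \<le> 64" by simp
  qed
qed (simp add: lat_decay_nonneg)

section \<open>Lattice sums of rapidly decaying fields\<close>

definition rapidly_decaying :: "vfield \<Rightarrow> bool"
  where "rapidly_decaying g \<longleftrightarrow> continuous_on UNIV g \<and> (\<exists>C. \<forall>x. norm (g x) * (1 + norm x) ^ 6 \<le> C)"

definition periodize :: "vfield \<Rightarrow> vfield"
  where "periodize g x = (\<Sum>\<^sub>\<infinity>l. g (x + lat l))"

lemma schwartz_imp_rapidly_decaying:
  assumes "schwartz f"
  shows "rapidly_decaying f"
proof -
  have "dpartial [] f differentiable (at x)" for x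
    using assms unfolding schwartz_def smooth_def by blast
  hence "continuous_on UNIV f"
    by (auto simp: continuous_on_eq_continuous_at intro: differentiable_imp_continuous_within)
  moreover have "bounded (range (\<lambda>x. (1 + norm x) ^ 6 *\<^sub>R dpartial [] f x))"
    using assms unfolding schwartz_def by blast
  then obtain C where "\<And>x. norm ((1 + norm x) ^ 6 *\<^sub>R f x) \<le> C"
    by (auto simp: bounded_iff)
  hence "norm (f x) * (1 + norm x) ^ 6 \<le> C" for x
    by (simp add: mult.commute)
  ultimately show ?thesis by (auto simp: rapidly_decaying_def)
qed

lemma rapidly_decaying_scaled:
  assumes f: "rapidly_decaying f" and "s > 0"
  shows "rapidly_decaying (\<lambda>x. c *\<^sub>R f (s *\<^sub>R x))"
proof -
  obtain C where C: "\<And>x. norm (f x) * (1 + norm x) ^ 6 \<le> C" and cont: "continuous_on UNIV f"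
    using f by (auto simp: rapidly_decaying_def)
  \<comment> \<open>Chosen so that \<open>1 + norm x \<le> r * (1 + norm (s *\<^sub>R x))\<close>,
    whether \<open>s\<close> shrinks or stretches.\<close>
  define r where "r = max 1 (1 / s)"
  have "norm (c *\<^sub>R f (s *\<^sub>R x)) * (1 + norm x) ^ 6 \<le> \<bar>c\<bar> * r ^ 6 * C" for x
  proof -
    have "1 \<le> r" "1 \<le> r * s" using \<open>s > 0\<close> by (auto simp: r_def max_def field_simps)
    hence "1 + norm x \<le> r + (r * s) * norm x"
      using mult_right_mono[of 1 "r * s" "norm x"] by simp
    hence "1 + norm x \<le> r * (1 + norm (s *\<^sub>R x))"
      using \<open>s > 0\<close> by (simp add: algebra_simps)
    hence "(1 + norm x) ^ 6 \<le> (r * (1 + norm (s *\<^sub>R x))) ^ 6"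
      by (rule power_mono) simp
    hence "norm (c *\<^sub>R f (s *\<^sub>R x)) * (1 + norm x) ^ 6 \<le>
      norm (c *\<^sub>R f (s *\<^sub>R x)) * (r * (1 + norm (s *\<^sub>R x))) ^ 6"
      by (rule mult_left_mono) simp
    also have "\<dots> = \<bar>c\<bar> * r ^ 6 * (norm (f (s *\<^sub>R x)) * (1 + norm (s *\<^sub>R x)) ^ 6)"
      by (simp add: power_mult_distrib)
    also have "\<dots> \<le> \<bar>c\<bar> * r ^ 6 * C"
      using \<open>1 \<le> r\<close> by (intro mult_left_mono C) auto
    finally show ?thesis .
  qed
  moreover have "continuous_on UNIV (\<lambda>x. c *\<^sub>R f (s *\<^sub>R x))"
    by (intro continuous_intros continuous_on_compose2[OF cont]) auto
  ultimately show ?thesis by (auto simp: rapidly_decaying_def)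
qed

text \<open>For \<open>norm x \<le> R\<close> one has
  \<open>1 + norm (lat l) \<le> (1 + R) * (1 + norm (x + lat l))\<close>. A bound that is uniform
  over the ball gives locally uniform convergence of the lattice sum.\<close>

lemma rapidly_decaying_translates:
  assumes "rapidly_decaying g"
  shows "\<exists>C\<ge>0. \<forall>R\<ge>0. \<forall>x l. norm x \<le> R \<longrightarrow> norm (g (x + lat l)) \<le> C * (1 + R) ^ 6 * lat_decay l"
proof -
  obtain C where C: "\<And>x. norm (g x) * (1 + norm x) ^ 6 \<le> C"
    using assms by (auto simp: rapidly_decaying_def)
  have "C \<ge> 0" using order_trans[OF norm_ge_zero[of "g 0"]] C[of 0] by simp
  moreover have "norm (g (x + lat l)) \<le> C * (1 + R) ^ 6 * lat_decay l" if "R \<ge> 0" "norm x \<le> R" for R x l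
  proof -
    have "norm (lat l) \<le> norm (x + lat l) + R"
      using norm_triangle_ineq4[of "x + lat l" x] that by simp
    also have "\<dots> \<le> norm (x + lat l) + R + R * norm (x + lat l)" using that by simp
    finally have "1 + norm (lat l) \<le> (1 + R) * (1 + norm (x + lat l))" by (simp add: algebra_simps)
    hence "(1 + norm (lat l)) ^ 6 \<le> ((1 + R) * (1 + norm (x + lat l))) ^ 6" by (rule power_mono) simp
    hence "norm (g (x + lat l)) * (1 + norm (lat l)) ^ 6 \<le> norm (g (x + lat l)) * ((1 + R) * (1 + norm (x + lat l))) ^ 6"
      by (rule mult_left_mono) simp
    also have "\<dots> = (1 + R) ^ 6 * (norm (g (x + lat l)) * (1 + norm (x + lat l)) ^ 6)"
      by (simp add: power_mult_distrib)
    also have "\<dots> \<le> (1 + R) ^ 6 * C" using that by (intro mult_left_mono C) auto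
    finally have "norm (g (x + lat l)) * (1 + norm (lat l)) ^ 6 \<le> C * (1 + R) ^ 6"
      by (simp only: mult.commute)
    moreover have "(1 + norm (lat l)) ^ 6 > 0" by (intro zero_less_power add_pos_nonneg) auto
    ultimately show ?thesis
      by (simp add: lat_decay_def pos_le_divide_eq del: zero_less_power_eq_numeral)
  qed
  ultimately show ?thesis by blast
qed

lemma abs_summable_periodize:
  assumes "rapidly_decaying g"
  shows "(\<lambda>l. norm (g (x + lat l))) summable_on UNIV"
proof -
  obtain C where "C \<ge> 0" and C: "\<And>R x l. R \<ge> 0 \<Longrightarrow> norm x \<le> R \<Longrightarrow> norm (g (x + lat l)) \<le> C * (1 + R) ^ 6 * lat_decay l"
    using rapidly_decaying_translates[OF assms] by metis
  have "(\<lambda>l. C * (1 + norm x) ^ 6 * lat_decay l) summable_on UNIV"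
    by (intro summable_on_cmult_right lat_decay_summable)
  thus ?thesis
    by (rule summable_on_comparison_test) (use C[of "norm x" x] in auto)
qed

lemma summable_periodize: "rapidly_decaying g \<Longrightarrow> (\<lambda>l. g (x + lat l)) summable_on UNIV"
  by (rule abs_summable_summable[OF abs_summable_periodize])

text \<open>The majorant grows with the radius, so the Weierstrass test gives uniform convergence on
  balls only; these are open and cover the space.\<close>

lemma continuous_periodize:
  assumes g: "rapidly_decaying g"
  shows "continuous_on UNIV (periodize g)"
proof -
  obtain C where "C \<ge> 0" and C: "\<And>R x l. R \<ge> 0 \<Longrightarrow> norm x \<le> R \<Longrightarrow> norm (g (x + lat l)) \<le> C * (1 + R) ^ 6 * lat_decay l"
    using rapidly_decaying_translates[OF g] by metis
  have "continuous_on (ball 0 R) (periodize g)" if "R > 0" for R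
  proof (rule uniform_limit_theorem)
    show "uniform_limit (ball 0 R) (\<lambda>F x. \<Sum>l\<in>F. g (x + lat l)) (periodize g) (finite_subsets_at_top UNIV)"
      unfolding periodize_def[abs_def]
    proof (rule Weierstrass_m_test_general)
      show "(\<lambda>l. C * (1 + R) ^ 6 * lat_decay l) summable_on UNIV"
        by (intro summable_on_cmult_right lat_decay_summable)
    qed (use C[of R] that in auto)
    show "\<forall>\<^sub>F F in finite_subsets_at_top UNIV. continuous_on (ball 0 R) (\<lambda>x. \<Sum>l\<in>F. g (x + lat l))"
    proof (intro always_eventually allI continuous_on_sum)
      fix l
      have "continuous_on UNIV g" using g by (simp add: rapidly_decaying_def)
      thus "continuous_on (ball 0 R) (\<lambda>x. g (x + lat l))"
        by (rule continuous_on_compose2) (auto intro: continuous_intros)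
    qed
  qed auto
  hence "continuous_on (\<Union>R\<in>{0<..}. ball 0 R) (periodize g)"
    by (intro continuous_on_open_UN) auto
  moreover have "(\<Union>R\<in>{0<..}. ball (0 :: real^3) R) = UNIV"
  proof -
    have "x \<in> ball 0 (norm x + 1)" "norm x + 1 > 0" for x :: "real^3"
      by (auto simp: add_nonneg_pos)
    thus ?thesis by blast
  qed
  ultimately show ?thesis by simp
qed

lemma periodic_periodize: "periodic (periodize g)"
  unfolding periodic_def periodize_def
proof safe
  fix x k
  have "bij (\<lambda>l :: int^3. k + l)" by (rule bij_betwI[of _ _ _ "\<lambda>l. l - k"]) auto
  from infsum_reindex_bij_betw[OF this, of "\<lambda>l. g (x + lat l)"]
  show "(\<Sum>\<^sub>\<infinity>l. g (x + lat k + lat l)) = (\<Sum>\<^sub>\<infinity>l. g (x + lat l))"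
    by (simp add: add.assoc)
qed

lemma L2_T_continuous_periodic:
  assumes "continuous_on UNIV f" "periodic f"
  shows "L2_T f"
proof -
  have "compact (f ` cbox 0 1)"
    by (intro compact_continuous_image compact_cbox continuous_on_subset[OF assms(1)]) auto
  then obtain C where "\<forall>y\<in>f ` cbox 0 1. norm y \<le> C"
    using compact_imp_bounded[of "f ` cbox 0 1"] unfolding bounded_iff by metis
  hence C: "norm (f x) \<le> C" if "x \<in> cbox 0 1" for x
    using that by blast
  have "norm (f x) \<le> C" for x
  proof -
    obtain l where "x - lat l \<in> unit_cube" using unit_cube_translate by blast
    moreover have "f x = f (x - lat l)" using assms(2) unfolding periodic_def by (metis diff_add_cancel)
    ultimately show ?thesis using C[of "x - lat l"] unit_cube_subset by auto
  qed
  thus ?thesis using assms by (intro L2_T_bounded) (auto intro: borel_measurable_continuous_onI)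
qed

lemma L2_T_periodize: "rapidly_decaying g \<Longrightarrow> L2_T (periodize g)"
  by (intro L2_T_continuous_periodic continuous_periodize periodic_periodize)

lemma fourier_R_nth: "fourier_R f (lat k) $ j = (\<integral>x. of_real (f x $ j) * fexp (- k) x \<partial>lborel)"
proof -
  have "exp (- 2 * pi * \<i> * complex_of_real (lat k \<bullet> x)) = fexp (- k) x" for x
    by (simp add: fexp_def cis_conv_exp mult_ac)
  thus ?thesis by (simp add: fourier_R_def)
qed

text \<open>Poisson summation at the level of coefficients: \<open>fexp (- k)\<close> is periodic,
  so it moves into the lattice sum, and the integral over the cube unfolds to one over the whole
  space.\<close>

lemma fourier_T_periodize:
  assumes g: "rapidly_decaying g"
  shows "fourier_T (periodize g) k = fourier_R g (lat k)"
proof -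
  obtain C where "C \<ge> 0" and C: "\<And>R x l. R \<ge> 0 \<Longrightarrow> norm x \<le> R \<Longrightarrow> norm (g (x + lat l)) \<le> C * (1 + R) ^ 6 * lat_decay l"
    using rapidly_decaying_translates[OF g] by metis
  have [measurable]: "g \<in> borel_measurable borel"
    using g by (auto simp: rapidly_decaying_def intro: borel_measurable_continuous_onI)
  obtain R where R: "R > 0" "\<And>x. x \<in> cbox (0::real^3) 1 \<Longrightarrow> norm x \<le> R"
    using compact_imp_bounded[OF compact_cbox] unfolding bounded_pos by blast
  have "fourier_T (periodize g) k $ j = fourier_R g (lat k) $ j" for j
  proof -
    let ?h = "\<lambda>x. of_real (g x $ j) * fexp (- k) x"
    have "(\<integral>x. ?h x \<partial>lborel) = (\<integral>x. (\<Sum>\<^sub>\<infinity>l. ?h (x + lat l)) \<partial>T3)"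
    proof (rule integral_lborel_tiling)
      show "(\<lambda>l. C * (1 + R) ^ 6 * lat_decay l) summable_on UNIV"
        by (intro summable_on_cmult_right lat_decay_summable)
      fix x l assume "x \<in> cbox (0::real^3) 1"
      hence "norm (g (x + lat l)) \<le> C * (1 + R) ^ 6 * lat_decay l" using R C[of R x l] by auto
      thus "norm (?h (x + lat l)) \<le> C * (1 + R) ^ 6 * lat_decay l"
        using component_le_norm_cart[of "g (x + lat l)" j] by (simp add: norm_mult)
    qed measurable
    also have "(\<lambda>x. \<Sum>\<^sub>\<infinity>l. ?h (x + lat l)) = (\<lambda>x. of_real (periodize g x $ j) * fexp (- k) x)"
    proof
      fix x
      have "bounded_linear (\<lambda>v :: real^3. of_real (v $ j) * fexp (- k) x)"
        by (intro bounded_linear_compose[OF bounded_linear_mult_left]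
            bounded_linear_compose[OF bounded_linear_of_real] bounded_linear_vec_nth)
      from infsumI[OF has_sum_bounded_linear[OF this has_sum_infsum[OF summable_periodize[OF g]]]]
      show "(\<Sum>\<^sub>\<infinity>l. ?h (x + lat l)) = of_real (periodize g x $ j) * fexp (- k) x"
        by (simp add: periodize_def)
    qed
    finally show ?thesis by (simp add: fourier_R_nth fourier_T_nth)
  qed
  thus ?thesis by (simp add: vec_eq_iff)
qed

lemma fourier_R_scaled:
  assumes [measurable]: "f \<in> borel_measurable borel" and s: "s > 0"
  shows "fourier_R (\<lambda>x. c *\<^sub>R f (s *\<^sub>R x)) \<xi> = (c / s ^ 3) *\<^sub>R fourier_R f (\<xi> /\<^sub>R s)"
proof -
  let ?h = "\<lambda>j y. complex_of_real (f y $ j) * exp (- 2 * pi * \<i> * complex_of_real ((\<xi> /\<^sub>R s) \<bullet> y))"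
  have "(\<integral>y. ?h j y \<partial>lborel) = s ^ 3 * (\<integral>x. ?h j (s *\<^sub>R x) \<partial>lborel)" for j
  proof -
    have "(\<integral>y. ?h j y \<partial>lborel) =
      (\<integral>y. ?h j y \<partial>density (distr lborel borel (\<lambda>x :: real^3. 0 + s *\<^sub>R x)) (\<lambda>_. ennreal (\<bar>s\<bar> ^ DIM(real^3))))"
      using s by (subst lborel_affine[of s 0]) auto
    also have "\<dots> = s ^ 3 * (\<integral>x. ?h j (s *\<^sub>R x) \<partial>lborel)"
      using s by (subst integral_density) (auto simp: integral_distr scaleR_conv_of_real[where 'a = complex] mult.left_commute)
    finally show ?thesis .
  qed
  hence "(\<integral>x. ?h j (s *\<^sub>R x) \<partial>lborel) = (\<integral>y. ?h j y \<partial>lborel) / s ^ 3" for j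
    using s by (simp add: field_simps)
  moreover have "(\<xi> /\<^sub>R s) \<bullet> (s *\<^sub>R x) = \<xi> \<bullet> x" for x
    using s by simp
  ultimately have "(\<integral>x. of_real (f (s *\<^sub>R x) $ j) * exp (- 2 * pi * \<i> * complex_of_real (\<xi> \<bullet> x)) \<partial>lborel) =
      (\<integral>y. ?h j y \<partial>lborel) / s ^ 3" for j
    by (simp only:)
  thus ?thesis
    by (simp add: fourier_R_def vec_eq_iff mult.assoc scaleR_conv_of_real[where 'a = complex])
qed

text \<open>Only the term \<open>l = 0\<close> survives: every other argument has norm of order at
  least \<open>s * norm (lat l)\<close>, and together these terms contribute at most a multiple of
  \<open>1 / s ^ 6\<close>.\<close>

lemma periodize_scaled_tendsto:
  assumes f: "rapidly_decaying f"
  shows "((\<lambda>s. \<Sum>\<^sub>\<infinity>l. f (y + s *\<^sub>R lat l)) \<longlongrightarrow> f y) at_top"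
proof -
  obtain C where C: "\<And>x. norm (f x) * (1 + norm x) ^ 6 \<le> C"
    using f by (auto simp: rapidly_decaying_def)
  have "C \<ge> 0" using order_trans[OF norm_ge_zero[of "f 0"]] C[of 0] by simp
  define L where "L = (\<Sum>\<^sub>\<infinity>l. lat_decay l)"
  \<comment> \<open>Beyond this threshold \<open>norm y\<close> is less than half of
    \<open>s\<close>, hence dominated by \<open>norm (y + s *\<^sub>R lat l)\<close>. The comparison
    \<open>s * (1 + norm (lat l)) \<le> 4 * (1 + norm (y + s *\<^sub>R lat l))\<close> explains
    \<open>4 ^ 6\<close>.\<close>
  have bound: "norm (f (y + s *\<^sub>R lat l)) \<le> 4 ^ 6 * C / s ^ 6 * lat_decay l"
    if s: "s \<ge> 2 * (1 + norm y)" and l: "l \<noteq> 0" for s l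
  proof -
    have "s > 0" by (rule less_le_trans[OF _ s]) (simp add: add_pos_nonneg)
    obtain j where "l $ j \<noteq> 0" using l by (auto simp: vec_eq_iff)
    hence "1 \<le> \<bar>real_of_int (l $ j)\<bar>" by linarith
    also have "\<dots> \<le> norm (lat l)" using component_le_norm_cart[of "lat l" j] by simp
    finally have l1: "1 \<le> norm (lat l)" .
    have "s * norm (lat l) \<le> norm (y + s *\<^sub>R lat l) + norm y"
      using norm_triangle_ineq4[of "y + s *\<^sub>R lat l" y] \<open>s > 0\<close> by simp
    moreover have "s \<le> s * norm (lat l)" using l1 \<open>s > 0\<close> by simp
    ultimately have "s * (1 + norm (lat l)) \<le> 4 * (1 + norm (y + s *\<^sub>R lat l))"
      using s by (simp add: distrib_left)
    hence "(s * (1 + norm (lat l))) ^ 6 \<le> (4 * (1 + norm (y + s *\<^sub>R lat l))) ^ 6"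
      using \<open>s > 0\<close> by (intro power_mono) auto
    hence "norm (f (y + s *\<^sub>R lat l)) * (s * (1 + norm (lat l))) ^ 6 \<le>
      norm (f (y + s *\<^sub>R lat l)) * (4 * (1 + norm (y + s *\<^sub>R lat l))) ^ 6"
      by (rule mult_left_mono) simp
    also have "\<dots> \<le> 4 ^ 6 * C"
      using mult_left_mono[OF C[of "y + s *\<^sub>R lat l"], of "4 ^ 6"]
      by (simp only: power_mult_distrib mult_ac) simp
    finally have *: "norm (f (y + s *\<^sub>R lat l)) * (s * (1 + norm (lat l))) ^ 6 \<le> 4 ^ 6 * C" .
    have "(s * (1 + norm (lat l))) ^ 6 > 0" using \<open>s > 0\<close> by (intro zero_less_power mult_pos_pos add_pos_nonneg) auto
    hence "norm (f (y + s *\<^sub>R lat l)) \<le> 4 ^ 6 * C / (s * (1 + norm (lat l))) ^ 6"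
      using * by (simp add: le_divide_eq)
    thus ?thesis by (simp add: lat_decay_def power_mult_distrib)
  qed
  have "norm ((\<Sum>\<^sub>\<infinity>l. f (y + s *\<^sub>R lat l)) - f y) \<le> 4 ^ 6 * C * L / s ^ 6" if s: "s \<ge> 2 * (1 + norm y)" for s
  proof -
    have "s > 0" by (rule less_le_trans[OF _ s]) (simp add: add_pos_nonneg)
    have sm: "(\<lambda>l. 4 ^ 6 * C / s ^ 6 * lat_decay l) summable_on (UNIV - {0})"
      by (intro summable_on_cmult_right summable_on_subset_banach[OF lat_decay_summable]) auto
    have abs: "(\<lambda>l. norm (f (y + s *\<^sub>R lat l))) summable_on (UNIV - {0})"
      by (rule summable_on_comparison_test[OF sm]) (use bound[OF s] in auto)
    have sum: "(\<lambda>l. f (y + s *\<^sub>R lat l)) summable_on (UNIV - {0})"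
      by (rule abs_summable_summable[OF abs])
    have "(\<Sum>\<^sub>\<infinity>l. f (y + s *\<^sub>R lat l)) = (\<Sum>\<^sub>\<infinity>l\<in>{0} \<union> (UNIV - {0}). f (y + s *\<^sub>R lat l))"
      by simp
    also have "\<dots> = f y + (\<Sum>\<^sub>\<infinity>l\<in>UNIV - {0}. f (y + s *\<^sub>R lat l))"
      by (subst infsum_Un_disjoint[OF _ sum]) auto
    finally have "norm ((\<Sum>\<^sub>\<infinity>l. f (y + s *\<^sub>R lat l)) - f y) = norm (\<Sum>\<^sub>\<infinity>l\<in>UNIV - {0}. f (y + s *\<^sub>R lat l))"
      by simp
    also have "\<dots> \<le> (\<Sum>\<^sub>\<infinity>l\<in>UNIV - {0}. norm (f (y + s *\<^sub>R lat l)))"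
      by (rule norm_infsum_bound[OF abs])
    also have "\<dots> \<le> (\<Sum>\<^sub>\<infinity>l\<in>UNIV - {0}. 4 ^ 6 * C / s ^ 6 * lat_decay l)"
      by (rule infsum_mono[OF abs sm]) (use bound[OF s] in auto)
    also have "\<dots> \<le> (\<Sum>\<^sub>\<infinity>l. 4 ^ 6 * C / s ^ 6 * lat_decay l)"
      using \<open>C \<ge> 0\<close> \<open>s > 0\<close>
      by (intro infsum_mono_neutral sm summable_on_cmult_right lat_decay_summable) (auto simp: lat_decay_nonneg)
    also have "\<dots> = 4 ^ 6 * C * L / s ^ 6"
      unfolding L_def by (subst infsum_cmult_right) (auto simp: lat_decay_summable)
    finally show ?thesis .
  qed
  hence ev: "eventually (\<lambda>s. norm ((\<Sum>\<^sub>\<infinity>l. f (y + s *\<^sub>R lat l)) - f y) \<le> 4 ^ 6 * C * L / s ^ 6) at_top"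
    unfolding eventually_at_top_linorder by blast
  have "((\<lambda>s :: real. 4 ^ 6 * C * L / s ^ 6) \<longlongrightarrow> 0) at_top"
    by (intro tendsto_divide_0[OF tendsto_const] filterlim_at_top_imp_at_infinity filterlim_pow_at_top filterlim_ident) simp
  hence "((\<lambda>s. (\<Sum>\<^sub>\<infinity>l. f (y + s *\<^sub>R lat l)) - f y) \<longlongrightarrow> 0) at_top"
    by (rule Lim_null_comparison[OF ev])
  thus ?thesis by (rule Lim_null[THEN iffD2])
qed

section \<open>Frequency supports of the periodized wavelets\<close>

locale cascade_wavelets =
  fixes \<epsilon>0 :: real and m :: nat and B :: "nat \<Rightarrow> (real ^ 3) set" and \<psi> :: "nat \<Rightarrow> vfield"
  assumes eps: "0 < \<epsilon>0" "\<epsilon>0 < 1"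
    and annulus: "\<And>i. i \<in> {1..m} \<Longrightarrow> B i \<subseteq> {\<xi>. 1 < norm \<xi> \<and> norm \<xi> < 1 + \<epsilon>0 / 2}"
    and disj: "disjoint_family_on (\<lambda>(i, \<sigma>::real). (\<lambda>\<xi>. \<sigma> *\<^sub>R \<xi>) ` B i) ({1..m} \<times> {1, -1})"
    and psi_schwartz: "\<And>i. i \<in> {1..m} \<Longrightarrow> schwartz (\<psi> i)"
    and psi_supp: "\<And>i \<xi>. i \<in> {1..m} \<Longrightarrow> \<xi> \<notin> B i \<union> uminus ` B i \<Longrightarrow> fourier_R (\<psi> i) \<xi> = 0"
    and psi_norm: "\<And>i. i \<in> {1..m} \<Longrightarrow> sqrt (LINT x|lborel. (norm (\<psi> i x))\<^sup>2) = 1"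
begin

section \<open>Lattice points of the dilated frequency sets\<close>

definition dil :: "int \<Rightarrow> real"
  where "dil n = (1 + \<epsilon>0) powr (real_of_int n)"

definition freqs :: "nat \<Rightarrow> int \<Rightarrow> (int^3) set"
  where "freqs i n = {k. lat k \<in> freq_set \<epsilon>0 B i n}"

abbreviation wavelet :: "nat \<Rightarrow> int \<Rightarrow> vfield"
  where "wavelet \<equiv> psi_tilde \<epsilon>0 \<psi>"

lemma dil_pos [simp]: "dil n > 0"
  using eps by (simp add: dil_def)

lemma dil_nonneg [simp]: "dil n \<ge> 0" and dil_nonzero [simp]: "dil n \<noteq> 0"
  using dil_pos[of n] by linarith+

lemma dil_add: "dil (n + k) = dil n * dil k"
  by (simp add: dil_def powr_add)

lemma dil_0 [simp]: "dil 0 = 1"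
  using eps by (simp add: dil_def)

lemma dil_1: "dil 1 = 1 + \<epsilon>0"
  using eps by (simp add: dil_def)

lemma dil_mono: "n \<le> k \<Longrightarrow> dil n \<le> dil k"
  using eps by (simp add: dil_def)

lemma dil_ge_1: "n \<ge> 0 \<Longrightarrow> dil n \<ge> 1"
  using dil_mono[of 0 n] by simp

lemma freqs_iff: "k \<in> freqs i n \<longleftrightarrow> lat k /\<^sub>R dil n \<in> B i \<union> uminus ` B i"
proof -
  have "dil n \<noteq> 0" using dil_pos[of n] by linarith
  hence "lat k = dil n *\<^sub>R \<xi> \<longleftrightarrow> \<xi> = lat k /\<^sub>R dil n" for \<xi>
    by auto
  thus ?thesis
    unfolding freqs_def freq_set_def dil_def[symmetric] by (auto simp: image_iff)
qed

lemma freqs_bounds: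
  assumes "i \<in> {1..m}" "k \<in> freqs i n"
  shows "dil n < norm (lat k)" "norm (lat k) < dil n * (1 + \<epsilon>0 / 2)"
proof -
  define z where "z = lat k /\<^sub>R dil n"
  have "z \<in> B i \<union> uminus ` B i"
    using assms(2) by (simp add: freqs_iff z_def)
  hence "1 < norm z \<and> norm z < 1 + \<epsilon>0 / 2"
    using annulus[OF assms(1)] by auto
  thus "dil n < norm (lat k)" "norm (lat k) < dil n * (1 + \<epsilon>0 / 2)"
    unfolding z_def using dil_pos[of n] by (auto simp: field_simps)
qed

lemma finite_freqs: "i \<in> {1..m} \<Longrightarrow> finite (freqs i n)"
  by (rule finite_subset[OF _ finite_lat_ball[of "dil n * (1 + \<epsilon>0 / 2)"]])
    (use freqs_bounds(2)[of i _ n] in \<open>auto intro: less_imp_le\<close>)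

lemma freqs_uminus: "k \<in> freqs i n \<Longrightarrow> - k \<in> freqs i n"
  unfolding freqs_iff by force

lemma freqs_nonzero: "i \<in> {1..m} \<Longrightarrow> k \<in> freqs i n \<Longrightarrow> k \<noteq> 0"
  using less_trans[OF dil_pos freqs_bounds(1)[of i k n]] by auto

text \<open>A nonzero lattice point has norm at least 1, whereas at a negative scale the annulus
  lies in the ball of radius \<open>dil (n + 1) \<le> 1\<close>. Wavelets of negative scale vanish,
  so sums over scales are one-sided.\<close>

lemma freqs_neg:
  assumes "i \<in> {1..m}" "n < 0"
  shows "freqs i n = {}"
proof (rule ccontr)
  assume "freqs i n \<noteq> {}"
  then obtain k where k: "k \<in> freqs i n" by blast
  then obtain j where "k $ j \<noteq> 0" using freqs_nonzero[OF assms(1)] by (auto simp: vec_eq_iff)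
  hence "1 \<le> \<bar>real_of_int (k $ j)\<bar>" by linarith
  also have "\<dots> \<le> norm (lat k)" using component_le_norm_cart[of "lat k" j] by simp
  also have "\<dots> < dil n * (1 + \<epsilon>0 / 2)" by (rule freqs_bounds(2)[OF assms(1) k])
  also have "\<dots> \<le> dil n * dil 1" using eps dil_pos[of n] by (simp add: dil_1)
  also have "\<dots> = dil (n + 1)" by (simp add: dil_add)
  finally show False using dil_mono[of "n + 1" 0] assms(2) by simp
qed

text \<open>The outer radius \<open>1 + \<epsilon>0 / 2\<close> is below the dilation factor, so
  annuli of different scales are disjoint; at equal scale the signed balls are disjoint.\<close>

lemma freqs_unique:
  assumes "i \<in> {1..m}" "j \<in> {1..m}" and k: "k \<in> freqs i n" "k \<in> freqs j l"
  shows "i = j \<and> n = l"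
proof -
  have *: "\<not> n < l" if "i \<in> {1..m}" "j \<in> {1..m}" "k \<in> freqs i n" "k \<in> freqs j l" for i j n l
  proof
    assume "n < l"
    have "norm (lat k) < dil n * (1 + \<epsilon>0 / 2)" by (rule freqs_bounds(2)[OF that(1,3)])
    also have "\<dots> \<le> dil n * dil 1" using eps dil_pos[of n] by (simp add: dil_1)
    also have "\<dots> = dil (n + 1)" by (simp add: dil_add)
    also have "\<dots> \<le> dil l" using \<open>n < l\<close> by (intro dil_mono) simp
    finally show False using freqs_bounds(1)[OF that(2,4)] by simp
  qed
  have nl: "n = l" using *[OF assms(1,2) k] *[OF assms(2,1) k(2,1)] by linarith
  have "\<exists>\<sigma>\<in>{1, -1::real}. lat k /\<^sub>R dil n \<in> (\<lambda>\<xi>. \<sigma> *\<^sub>R \<xi>) ` B i" if "k \<in> freqs i n" for i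
    using that unfolding freqs_iff by (auto simp: image_iff)
  from this[OF k(1)] this[of j] k(2) nl obtain \<sigma> \<tau> where
    st: "\<sigma> \<in> {1, -1::real}" "\<tau> \<in> {1, -1::real}"
    "lat k /\<^sub>R dil n \<in> (\<lambda>\<xi>. \<sigma> *\<^sub>R \<xi>) ` B i" "lat k /\<^sub>R dil n \<in> (\<lambda>\<xi>. \<tau> *\<^sub>R \<xi>) ` B j"
    by blast
  have "i = j"
  proof (rule ccontr)
    assume "i \<noteq> j"
    hence "(\<lambda>\<xi>. \<sigma> *\<^sub>R \<xi>) ` B i \<inter> (\<lambda>\<xi>. \<tau> *\<^sub>R \<xi>) ` B j = {}"
      using disjoint_family_onD[OF disj, of "(i, \<sigma>)" "(j, \<tau>)"] assms(1,2) st(1,2) by auto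
    thus False using st(3,4) by blast
  qed
  thus ?thesis using nl by simp
qed

section \<open>The periodized wavelets\<close>

lemma psi_rapidly_decaying: "i \<in> {1..m} \<Longrightarrow> rapidly_decaying (\<psi> i)"
  by (intro schwartz_imp_rapidly_decaying psi_schwartz)

lemma psi_scaled_eq:
  "psi_scaled \<epsilon>0 \<psi> i n = (\<lambda>x. ((1 + \<epsilon>0) powr (3 * real_of_int n / 2)) *\<^sub>R \<psi> i (dil n *\<^sub>R x))"
  by (simp add: fun_eq_iff psi_scaled_def dil_def)

lemma psi_per_eq: "psi_per \<epsilon>0 \<psi> i n = periodize (psi_scaled \<epsilon>0 \<psi> i n)"
  by (simp add: fun_eq_iff psi_per_def periodize_def)

lemma psi_scaled_rapidly_decaying:
  "i \<in> {1..m} \<Longrightarrow> rapidly_decaying (psi_scaled \<epsilon>0 \<psi> i n)"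
  unfolding psi_scaled_eq by (intro rapidly_decaying_scaled psi_rapidly_decaying) auto

lemma L2_T_psi_per: "i \<in> {1..m} \<Longrightarrow> L2_T (psi_per \<epsilon>0 \<psi> i n)"
  unfolding psi_per_eq by (intro L2_T_periodize psi_scaled_rapidly_decaying)

lemma continuous_psi_per: "i \<in> {1..m} \<Longrightarrow> continuous_on UNIV (psi_per \<epsilon>0 \<psi> i n)"
  unfolding psi_per_eq by (intro continuous_periodize psi_scaled_rapidly_decaying)

text \<open>The coefficient is a multiple of the Fourier transform of \<open>\<psi> i\<close> at
  \<open>lat k /\<^sub>R dil n\<close>, a point outside the support.\<close>

lemma fourier_T_psi_per:
  assumes i: "i \<in> {1..m}" and "k \<notin> freqs i n"
  shows "fourier_T (psi_per \<epsilon>0 \<psi> i n) k = 0"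
proof -
  have "continuous_on UNIV (\<psi> i)" using psi_rapidly_decaying[OF i] by (simp add: rapidly_decaying_def)
  hence [measurable]: "\<psi> i \<in> borel_measurable borel" by (rule borel_measurable_continuous_onI)
  have "fourier_T (psi_per \<epsilon>0 \<psi> i n) k = fourier_R (psi_scaled \<epsilon>0 \<psi> i n) (lat k)"
    unfolding psi_per_eq by (intro fourier_T_periodize psi_scaled_rapidly_decaying i)
  also have "\<dots> = 0"
    unfolding psi_scaled_eq using assms psi_supp[OF i, of "lat k /\<^sub>R dil n"]
    by (subst fourier_R_scaled) (auto simp: freqs_iff)
  finally show ?thesis .
qed

lemma wavelet_eq: "wavelet i n = (\<lambda>x. inverse (norm_T (psi_per \<epsilon>0 \<psi> i n)) *\<^sub>R psi_per \<epsilon>0 \<psi> i n x)"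
  by (simp add: fun_eq_iff psi_tilde_def)

lemma L2_T_wavelet: "i \<in> {1..m} \<Longrightarrow> L2_T (wavelet i n)"
  unfolding wavelet_eq by (intro L2_T_scaleR L2_T_psi_per)

lemma fourier_T_wavelet: "i \<in> {1..m} \<Longrightarrow> k \<notin> freqs i n \<Longrightarrow> fourier_T (wavelet i n) k = 0"
  unfolding wavelet_eq fourier_T_scaleR by (simp add: fourier_T_psi_per)

lemma norm_T_wavelet_nonzero:
  "norm_T (psi_per \<epsilon>0 \<psi> i n) \<noteq> 0 \<Longrightarrow> norm_T (wavelet i n) = 1"
  unfolding wavelet_eq norm_T_scaleR by simp

text \<open>The norm is 1 unless the periodization has norm 0; the inequality is what holds at every
  scale.\<close>

lemma norm_T_wavelet_le: "norm_T (wavelet i n) \<le> 1"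
  unfolding wavelet_eq norm_T_scaleR by (cases "norm_T (psi_per \<epsilon>0 \<psi> i n) = 0") auto

lemma inner_T_wavelet:
  assumes "L2_T f" "i \<in> {1..m}"
  shows "inner_T f (wavelet i n) = (\<Sum>k\<in>freqs i n. fourier_T f k \<bullet> fourier_T (wavelet i n) k)"
  using assms by (intro inner_T_Parseval L2_T_wavelet finite_freqs freqs_uminus fourier_T_wavelet)

lemma sum_fourier_wavelet:
  "i \<in> {1..m} \<Longrightarrow> (\<Sum>k\<in>freqs i n. (norm (fourier_T (wavelet i n) k))\<^sup>2) = (norm_T (wavelet i n))\<^sup>2"
  by (intro norm_T_Parseval[symmetric] L2_T_wavelet finite_freqs freqs_uminus fourier_T_wavelet)

text \<open>Equality has to hold everywhere, not just almost everywhere: the cascade operator is a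
  pointwise sum of wavelets and is rewritten as a function.\<close>

lemma wavelet_eq_trig_field:
  assumes i: "i \<in> {1..m}"
  shows "wavelet i n = trig_field (freqs i n) (fourier_T (wavelet i n))"
proof (rule continuous_periodic_AE_imp_eq)
  show "continuous_on UNIV (wavelet i n)"
    unfolding wavelet_eq using i by (intro continuous_intros continuous_psi_per)
  show "AE x in T3. wavelet i n x = trig_field (freqs i n) (fourier_T (wavelet i n)) x"
    using i by (intro trig_field_fourier_T_AE L2_T_wavelet finite_freqs freqs_uminus fourier_T_wavelet)
qed (use L2_T_wavelet[OF i] in \<open>auto simp: L2_T_def continuous_trig_field periodic_trig_field\<close>)

text \<open>This sum bounds the supremum norm. Each coefficient is at most 1, and for
  \<open>n \<ge> 0\<close> the frequencies satisfy \<open>1 + norm (lat k) \<le> 3 * dil n\<close>,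
  so the summable weights \<open>lat_decay\<close> replace a count of lattice points.\<close>

lemma sum_norm_fourier_wavelet_le:
  "\<exists>D\<ge>0. \<forall>i\<in>{1..m}. \<forall>n. (\<Sum>k\<in>freqs i n. norm (fourier_T (wavelet i n) k)) \<le> D * dil n ^ 6"
proof (intro exI[of _ "3 ^ 6 * (\<Sum>\<^sub>\<infinity>l. lat_decay l)"] conjI ballI allI)
  have L: "(\<Sum>\<^sub>\<infinity>l. lat_decay l) \<ge> 0" by (intro infsum_nonneg lat_decay_nonneg)
  thus "3 ^ 6 * (\<Sum>\<^sub>\<infinity>l. lat_decay l) \<ge> 0" by simp
  fix i n assume i: "i \<in> {1..m}"
  show "(\<Sum>k\<in>freqs i n. norm (fourier_T (wavelet i n) k)) \<le> 3 ^ 6 * (\<Sum>\<^sub>\<infinity>l. lat_decay l) * dil n ^ 6"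
  proof (cases "n < 0")
    case True
    thus ?thesis using freqs_neg[OF i True] L by simp
  next
    case False
    have "(\<Sum>k\<in>freqs i n. norm (fourier_T (wavelet i n) k)) \<le> (\<Sum>k\<in>freqs i n. (3 * dil n) ^ 6 * lat_decay k)"
    proof (rule sum_mono)
      fix k assume k: "k \<in> freqs i n"
      have "norm (fourier_T (wavelet i n) k) \<le> 1"
        using norm_fourier_T_le[OF L2_T_wavelet[OF i], of n k] norm_T_wavelet_le[of i n] by linarith
      also have "1 \<le> (3 * dil n) ^ 6 * lat_decay k"
      proof -
        have "norm (lat k) < dil n * (1 + \<epsilon>0 / 2)" by (rule freqs_bounds(2)[OF i k])
        also have "\<dots> \<le> dil n * 2" using eps dil_pos[of n] by (intro mult_left_mono) auto
        finally have "1 + norm (lat k) \<le> 3 * dil n" using dil_ge_1[of n] False by simp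
        hence "(1 + norm (lat k)) ^ 6 \<le> (3 * dil n) ^ 6" by (intro power_mono) auto
        moreover have "(1 + norm (lat k)) ^ 6 > 0" by (intro zero_less_power add_pos_nonneg) auto
        ultimately show ?thesis by (simp add: lat_decay_def pos_le_divide_eq del: zero_less_power_eq_numeral)
      qed
      finally show "norm (fourier_T (wavelet i n) k) \<le> (3 * dil n) ^ 6 * lat_decay k" .
    qed
    also have "\<dots> = (3 * dil n) ^ 6 * (\<Sum>k\<in>freqs i n. lat_decay k)"
      by (simp add: sum_distrib_left)
    also have "\<dots> \<le> (3 * dil n) ^ 6 * (\<Sum>\<^sub>\<infinity>l. lat_decay l)"
      using finite_freqs[OF i]
      by (intro mult_left_mono finite_sum_le_infsum lat_decay_summable) (auto simp: lat_decay_nonneg )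
    finally show ?thesis by (simp add: power_mult_distrib mult_ac)
  qed
qed

text \<open>At small scales the translates in the periodization separate, so the periodized
  wavelet looks like the wavelet itself and cannot vanish.\<close>

lemma psi_per_nonzero:
  assumes i: "i \<in> {1..m}"
  shows "eventually (\<lambda>n::nat. norm_T (psi_per \<epsilon>0 \<psi> i (int n)) \<noteq> 0) sequentially"
proof -
  have "\<exists>y. \<psi> i y \<noteq> 0"
  proof (rule ccontr)
    assume "\<not> (\<exists>y. \<psi> i y \<noteq> 0)"
    thus False using psi_norm[OF i] by simp
  qed
  then obtain y where y: "\<psi> i y \<noteq> 0" by blast
  have "filterlim (\<lambda>n::nat. dil (int n)) at_top sequentially"
  proof -
    have "dil (int n) = (1 + \<epsilon>0) ^ n" for n
      using eps by (simp add: dil_def powr_realpow)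
    moreover have "filterlim (\<lambda>n::nat. (1 + \<epsilon>0) ^ n) at_top sequentially"
      using eps
      by (intro filterlim_at_infinity_imp_filterlim_at_top filterlim_realpow_sequentially_gt1) auto
    ultimately show ?thesis by simp
  qed
  from filterlim_compose[OF periodize_scaled_tendsto[OF psi_rapidly_decaying[OF i]] this, of y]
  have "eventually (\<lambda>n::nat. (\<Sum>\<^sub>\<infinity>l. \<psi> i (y + dil (int n) *\<^sub>R lat l)) \<noteq> 0) sequentially"
    by (rule tendsto_imp_eventually_ne) (use y in auto)
  thus ?thesis
  proof eventually_elim
    case (elim n)
    let ?f = "psi_per \<epsilon>0 \<psi> i (int n)"
    \<comment> \<open>At this point the periodization becomes a multiple of the sum of
      \<open>\<psi> i\<close> over the dilated lattice around \<open>y\<close>, which was just seen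
      to be nonzero.\<close>
    have "?f (y /\<^sub>R dil (int n)) =
      (1 + \<epsilon>0) powr (3 * real n / 2) *\<^sub>R (\<Sum>\<^sub>\<infinity>l. \<psi> i (y + dil (int n) *\<^sub>R lat l))"
      unfolding psi_per_eq periodize_def psi_scaled_eq
      by (subst infsum_scaleR_right) (simp add: scaleR_add_right)
    hence ne: "?f (y /\<^sub>R dil (int n)) \<noteq> 0" using elim eps by simp
    show ?case
    proof
      assume 0: "norm_T ?f = 0"
      have L2: "L2_T ?f" by (rule L2_T_psi_per[OF i])
      have "fourier_T ?f k = 0" for k
        using norm_fourier_T_le[OF L2, of k] 0 by simp
      \<comment> \<open>With all coefficients zero the field is the empty trigonometric sum almost
        everywhere; continuity carries this to the chosen point.\<close>
      hence "AE x in T3. ?f x = trig_field {} (fourier_T ?f) x"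
        by (intro trig_field_fourier_T_AE L2) auto
      hence "?f = trig_field {} (fourier_T ?f)"
        by (intro continuous_periodic_AE_imp_eq continuous_psi_per i continuous_trig_field periodic_trig_field)
          (use L2 in \<open>auto simp: L2_T_def\<close>)
      hence "?f (y /\<^sub>R dil (int n)) = 0" by (simp add: trig_field_def fun_eq_iff)
      thus False using ne by simp
    qed
  qed
qed

lemma norm_T_wavelet_eventually: "\<exists>N::nat. \<forall>n\<ge>int N. \<forall>i\<in>{1..m}. norm_T (wavelet i n) = 1"
proof -
  have "eventually (\<lambda>n::nat. \<forall>i\<in>{1..m}. norm_T (psi_per \<epsilon>0 \<psi> i (int n)) \<noteq> 0) sequentially"
    by (intro eventually_ball_finite ballI psi_per_nonzero) auto
  then obtain N :: nat where N: "\<And>n i. n \<ge> N \<Longrightarrow> i \<in> {1..m} \<Longrightarrow> norm_T (psi_per \<epsilon>0 \<psi> i (int n)) \<noteq> 0"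
    unfolding eventually_at_top_linorder by blast
  have "norm_T (wavelet i n) = 1" if "n \<ge> int N" "i \<in> {1..m}" for n i
    using N[of "nat n" i] that by (intro norm_T_wavelet_nonzero) auto
  thus ?thesis by blast
qed

end

section \<open>Fourier coefficients of the cascade operator\<close>

text \<open>Summable supremum bounds make the limit bounded and allow termwise integration against
  each exponential.\<close>

lemma
  fixes g :: "nat \<Rightarrow> vfield"
  assumes L2: "\<And>n. L2_T (g n)" and bound: "\<And>n x. norm (g n x) \<le> b n" and b: "summable b"
  shows L2_T_suminf: "L2_T (\<lambda>x. \<Sum>n. g n x)"
    and fourier_T_suminf: "fourier_T (\<lambda>x. \<Sum>n. g n x) k = (\<Sum>n. fourier_T (g n) k)"
proof -
  have [measurable]: "g n \<in> borel_measurable borel" for n using L2 by (simp add: L2_T_def)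
  have nsum: "summable (\<lambda>n. norm (g n x))" for x
    by (rule summable_comparison_test'[OF b]) (use bound in auto)
  have sm: "summable (\<lambda>n. g n x)" for x
    by (rule summable_norm_cancel[OF nsum])
  have le: "norm (\<Sum>n. g n x) \<le> suminf b" for x
    using summable_norm[OF nsum, of x] suminf_le[OF bound nsum b, of x] by linarith
  show "L2_T (\<lambda>x. \<Sum>n. g n x)"
  proof (rule L2_T_bounded[OF _ _ le])
    show "periodic (\<lambda>x. \<Sum>n. g n x)" using L2 by (simp add: L2_T_def periodic_def)
  qed measurable
  have comp: "(\<lambda>n. fourier_T (g n) k $ j) sums (fourier_T (\<lambda>x. \<Sum>n. g n x) k $ j)" for j
  proof -
    let ?f = "\<lambda>n x. of_real (g n x $ j) * fexp (- k) x"
    have fle: "norm (?f n x) \<le> b n" for n x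
      using order_trans[OF component_le_norm_cart bound] by (simp add: norm_mult)
    have 1: "integrable T3 (?f n)" for n by (rule L2_T_fexp_integrable[OF L2])
    have 2: "AE x in T3. summable (\<lambda>n. norm (?f n x))"
      by (intro AE_I2, rule summable_comparison_test'[OF b]) (use fle in simp)
    have 3: "summable (\<lambda>n. \<integral>x. norm (?f n x) \<partial>T3)"
    proof (rule summable_comparison_test'[OF b])
      fix n
      have "(\<integral>x. norm (?f n x) \<partial>T3) \<le> (\<integral>x. b n \<partial>T3)"
        by (rule integral_mono) (use 1 fle in \<open>auto simp del: of_real_mult\<close>)
      thus "norm (\<integral>x. norm (?f n x) \<partial>T3) \<le> b n" by simp
    qed
    have "(\<lambda>n. \<integral>x. ?f n x \<partial>T3) sums (\<integral>x. (\<Sum>n. ?f n x) \<partial>T3)"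
      by (rule sums_integral[OF 1 2 3])
    moreover have "(\<Sum>n. ?f n x) = of_real ((\<Sum>n. g n x) $ j) * fexp (- k) x" for x
    proof -
      have "bounded_linear (\<lambda>v :: real^3. of_real (v $ j) * fexp (- k) x)"
        by (intro bounded_linear_compose[OF bounded_linear_mult_left]
            bounded_linear_compose[OF bounded_linear_of_real] bounded_linear_vec_nth)
      from bounded_linear.suminf[OF this sm] show ?thesis by simp
    qed
    ultimately show ?thesis by (simp add: fourier_T_nth)
  qed
  have "(\<lambda>n. fourier_T (g n) k) sums fourier_T (\<lambda>x. \<Sum>n. g n x) k"
    unfolding sums_def by (rule vec_tendstoI) (use comp in \<open>simp add: sums_def\<close>)
  thus "fourier_T (\<lambda>x. \<Sum>n. g n x) k = (\<Sum>n. fourier_T (g n) k)"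
    by (simp add: sums_iff)
qed

text \<open>The series starts at -1 rather than 0: through the shift \<open>(0,0,1)\<close> the term
  of index -1 contains wavelets of scale 0.\<close>

lemma infsum_int_eq_suminf:
  fixes f :: "int \<Rightarrow> 'a :: banach"
  assumes "\<And>n. n < -1 \<Longrightarrow> f n = 0" and "summable (\<lambda>n::nat. norm (f (int n - 1)))"
  shows "(\<Sum>\<^sub>\<infinity>n. f n) = (\<Sum>n. f (int n - 1))"
proof -
  have "(\<Sum>\<^sub>\<infinity>n. f n) = (\<Sum>\<^sub>\<infinity>n\<in>range (\<lambda>n::nat. int n - 1). f n)"
  proof (rule infsum_cong_neutral)
    fix n :: int assume n: "n \<in> UNIV - range (\<lambda>n::nat. int n - 1)"
    have "n < -1"
    proof (rule ccontr)
      assume "\<not> n < -1"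
      hence "n = int (nat (n + 1)) - 1" by simp
      thus False using n by blast
    qed
    thus "f n = 0" by (rule assms(1))
  qed auto
  also have "\<dots> = (\<Sum>\<^sub>\<infinity>n::nat. f (int n - 1))"
    by (subst infsum_reindex) (auto simp: inj_on_def o_def)
  also have "\<dots> = (\<Sum>n. f (int n - 1))"
    using norm_summable_imp_has_sum[OF assms(2) summable_sums[OF summable_norm_cancel[OF assms(2)]]]
    by (rule infsumI)
  finally show ?thesis .
qed

lemma finite_shift_set [simp]: "finite shift_set"
  by (simp add: shift_set_def)

context cascade_wavelets
begin

section \<open>The cascade series filtered term by term\<close>

definition filtered_wavelet :: "(int^3 \<Rightarrow> real) \<Rightarrow> nat \<Rightarrow> int \<Rightarrow> vfield"
  where "filtered_wavelet \<sigma> i n = trig_field (freqs i n) (\<lambda>k. \<sigma> k *\<^sub>R fourier_T (wavelet i n) k)"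

definition cascade_term ::
    "structure_constants \<Rightarrow> (nat \<Rightarrow> int \<Rightarrow> real) \<Rightarrow> (int^3 \<Rightarrow> real) \<Rightarrow> int \<Rightarrow> vfield"
  where "cascade_term \<alpha> X \<sigma> n x =
    (\<Sum>i1\<in>{1..m}. \<Sum>i2\<in>{1..m}. \<Sum>i3\<in>{1..m}. \<Sum>(\<mu>1,\<mu>2,\<mu>3)\<in>shift_set.
      (\<alpha> i1 i2 i3 \<mu>1 \<mu>2 \<mu>3 * (1 + \<epsilon>0) powr (5 * real_of_int n / 2) * X i1 (n + \<mu>1) * X i2 (n + \<mu>2))
        *\<^sub>R filtered_wavelet \<sigma> i3 (n + \<mu>3) x)"

text \<open>With \<open>\<sigma>\<close> constantly 1 and the modes of \<open>v\<close> this is the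
  cascade operator at \<open>(v, v)\<close>. With the heat symbol it is an explicit field having the
  coefficients that \<open>heat\<close> prescribes. The solution enters only through the decay of
  its modes \<open>X\<close>.\<close>

definition filtered_cascade ::
    "structure_constants \<Rightarrow> (nat \<Rightarrow> int \<Rightarrow> real) \<Rightarrow> (int^3 \<Rightarrow> real) \<Rightarrow> vfield"
  where "filtered_cascade \<alpha> X \<sigma> x = (\<Sum>\<^sub>\<infinity>n. cascade_term \<alpha> X \<sigma> n x)"

lemma filtered_wavelet_one: "i \<in> {1..m} \<Longrightarrow> filtered_wavelet (\<lambda>_. 1) i n = wavelet i n"
  unfolding filtered_wavelet_def using wavelet_eq_trig_field[of i n] by simp

lemma cascade_op_eq:
  "cascade_op \<epsilon>0 m \<alpha> \<psi> v v = filtered_cascade \<alpha> (\<lambda>i n. inner_T v (wavelet i n)) (\<lambda>_. 1)"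
  unfolding cascade_op_def filtered_cascade_def cascade_term_def fun_eq_iff
  by (intro allI infsum_cong sum.cong refl) (auto simp: filtered_wavelet_one)

lemma L2_T_filtered_wavelet: "L2_T (filtered_wavelet \<sigma> i n)"
  unfolding filtered_wavelet_def by (rule L2_T_trig_field)

lemma fourier_T_filtered_wavelet:
  assumes i: "i \<in> {1..m}" and \<sigma>: "\<And>k. \<sigma> (- k) = \<sigma> k"
  shows "fourier_T (filtered_wavelet \<sigma> i n) k = \<sigma> k *\<^sub>R fourier_T (wavelet i n) k"
proof -
  have "hermitian_on (freqs i n) (\<lambda>k. \<sigma> k *\<^sub>R fourier_T (wavelet i n) k)"
    using \<sigma> freqs_uminus by (auto simp: hermitian_on_def fourier_T_uminus_nth)
  thus ?thesis
    unfolding filtered_wavelet_def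
    by (subst fourier_T_trig_field) (use i in \<open>auto simp: finite_freqs fourier_T_wavelet\<close>)
qed

lemma filtered_wavelet_neg: "i \<in> {1..m} \<Longrightarrow> n < 0 \<Longrightarrow> filtered_wavelet \<sigma> i n x = 0"
  by (simp add: filtered_wavelet_def freqs_neg trig_field_def)

lemma cascade_term_neg: "n < -1 \<Longrightarrow> cascade_term \<alpha> X \<sigma> n x = 0"
  unfolding cascade_term_def
  by (intro sum.neutral ballI) (auto simp: shift_set_def filtered_wavelet_neg)

lemma L2_T_cascade_term: "L2_T (cascade_term \<alpha> X \<sigma> n)"
  unfolding cascade_term_def[abs_def] case_prod_beta
  by (intro L2_T_sum L2_T_scaleR L2_T_filtered_wavelet) auto

lemma fourier_T_cascade_term:
  assumes \<sigma>: "\<And>k. \<sigma> (- k) = \<sigma> k"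
  shows "fourier_T (cascade_term \<alpha> X \<sigma> n) k =
    (\<Sum>i1\<in>{1..m}. \<Sum>i2\<in>{1..m}. \<Sum>i3\<in>{1..m}. \<Sum>(\<mu>1,\<mu>2,\<mu>3)\<in>shift_set.
      (\<alpha> i1 i2 i3 \<mu>1 \<mu>2 \<mu>3 * (1 + \<epsilon>0) powr (5 * real_of_int n / 2) * X i1 (n + \<mu>1) * X i2 (n + \<mu>2))
        *\<^sub>R \<sigma> k *\<^sub>R fourier_T (wavelet i3 (n + \<mu>3)) k)"
  unfolding cascade_term_def[abs_def] case_prod_beta
  by (subst fourier_T_sum, simp, intro L2_T_sum L2_T_scaleR L2_T_filtered_wavelet; simp?; intro sum.cong refl)+
    (auto simp: fourier_T_scaleR fourier_T_filtered_wavelet \<sigma>)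

text \<open>The \<open>H\<^sup>1\<^sup>0\<close> decay of the two coefficients contributes \<open>-20\<close> to the exponent of the scale, which
  beats \<open>5/2\<close> from the operator and \<open>6\<close> from the supremum norm of the wavelet; \<open>23\<close> absorbs the shifts.\<close>

lemma cascade_term_bound:
  assumes X: "\<And>i n. i \<in> {1..m} \<Longrightarrow> \<bar>X i n\<bar> \<le> H * (1 + \<epsilon>0) powr (- 10 * real_of_int n)"
    and \<sigma>1: "\<And>k. \<bar>\<sigma> k\<bar> \<le> 1"
  shows "\<exists>K. \<forall>n\<ge>-1. \<forall>x. norm (cascade_term \<alpha> X \<sigma> n x) \<le> K * (1 + \<epsilon>0) powr (- real_of_int n)"
proof -
  let ?p = "\<lambda>a. (1 + \<epsilon>0) powr a"
  obtain D where D: "D \<ge> 0"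
    "\<And>i n. i \<in> {1..m} \<Longrightarrow> (\<Sum>k\<in>freqs i n. norm (fourier_T (wavelet i n) k)) \<le> D * dil n ^ 6"
    using sum_norm_fourier_wavelet_le by blast
  define K where "K = (\<Sum>i1\<in>{1..m}. \<Sum>i2\<in>{1..m}. \<Sum>i3\<in>{1..m}. \<Sum>(\<mu>1,\<mu>2,\<mu>3)\<in>shift_set.
    \<bar>\<alpha> i1 i2 i3 \<mu>1 \<mu>2 \<mu>3\<bar> * H\<^sup>2 * D * ?p 23)"
  have W: "norm (filtered_wavelet \<sigma> i n x) \<le> D * ?p (6 * real_of_int n)" if "i \<in> {1..m}" for i n x
  proof -
    have "norm (filtered_wavelet \<sigma> i n x) \<le> (\<Sum>k\<in>freqs i n. norm (\<sigma> k *\<^sub>R fourier_T (wavelet i n) k))"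
      unfolding filtered_wavelet_def by (rule norm_trig_field_le)
    also have "\<dots> \<le> (\<Sum>k\<in>freqs i n. norm (fourier_T (wavelet i n) k))"
      using \<sigma>1 by (intro sum_mono) (simp add: mult_left_le_one_le)
    also have "\<dots> \<le> D * dil n ^ 6" by (rule D(2)[OF that])
    also have "dil n ^ 6 = ?p (6 * real_of_int n)"
      using eps by (simp add: dil_def powr_power mult.commute)
    finally show ?thesis .
  qed
  have "norm (cascade_term \<alpha> X \<sigma> n x) \<le> K * ?p (- real_of_int n)" if n: "n \<ge> -1" for n x
  proof -
    have "norm (cascade_term \<alpha> X \<sigma> n x) \<le> (\<Sum>i1\<in>{1..m}. \<Sum>i2\<in>{1..m}. \<Sum>i3\<in>{1..m}. \<Sum>(\<mu>1,\<mu>2,\<mu>3)\<in>shift_set.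
      \<bar>\<alpha> i1 i2 i3 \<mu>1 \<mu>2 \<mu>3\<bar> * H\<^sup>2 * D * ?p 23 * ?p (- real_of_int n))"
      unfolding cascade_term_def
    proof (intro sum_norm_le)
      fix i1 i2 i3 \<mu> assume i: "i1 \<in> {1..m}" "i2 \<in> {1..m}" "i3 \<in> {1..m}" and "\<mu> \<in> shift_set"
      obtain \<mu>1 \<mu>2 \<mu>3 where \<mu>: "\<mu> = (\<mu>1, \<mu>2, \<mu>3)" by (metis prod_cases3)
      \<comment> \<open>\<open>H\<close> bounds a mode of scale 0. This is derived inside the sum,
        where an index \<open>i1\<close> is at hand, since \<open>m\<close> may be 0 here.\<close>
      have H: "H \<ge> 0" using X[OF i(1), of 0] eps by simp
      have \<mu>01: "0 \<le> \<mu>1" "0 \<le> \<mu>2" "\<mu>3 \<le> 1" using \<open>\<mu> \<in> shift_set\<close> by (auto simp: \<mu> shift_set_def)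
      have "norm ((\<alpha> i1 i2 i3 \<mu>1 \<mu>2 \<mu>3 * ?p (5 * real_of_int n / 2) * X i1 (n + \<mu>1) * X i2 (n + \<mu>2))
        *\<^sub>R filtered_wavelet \<sigma> i3 (n + \<mu>3) x) = \<bar>\<alpha> i1 i2 i3 \<mu>1 \<mu>2 \<mu>3\<bar> * (?p (5 * real_of_int n / 2) *
          (\<bar>X i1 (n + \<mu>1)\<bar> * (\<bar>X i2 (n + \<mu>2)\<bar> * norm (filtered_wavelet \<sigma> i3 (n + \<mu>3) x))))"
        by (simp add: abs_mult mult_ac)
      also have "\<dots> \<le> \<bar>\<alpha> i1 i2 i3 \<mu>1 \<mu>2 \<mu>3\<bar> * (?p (5 * real_of_int n / 2) *
          ((H * ?p (- 10 * real_of_int (n + \<mu>1))) * ((H * ?p (- 10 * real_of_int (n + \<mu>2))) *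
            (D * ?p (6 * real_of_int (n + \<mu>3))))))"
        by (intro mult_left_mono mult_mono X W i mult_nonneg_nonneg) (auto simp: H)
      also have "\<dots> = \<bar>\<alpha> i1 i2 i3 \<mu>1 \<mu>2 \<mu>3\<bar> * H\<^sup>2 * D *
          ?p (5 * real_of_int n / 2 - 10 * real_of_int (n + \<mu>1) - 10 * real_of_int (n + \<mu>2) + 6 * real_of_int (n + \<mu>3))"
      proof -
        have "?p (5 * real_of_int n / 2 - 10 * real_of_int (n + \<mu>1) - 10 * real_of_int (n + \<mu>2) + 6 * real_of_int (n + \<mu>3)) =
          ?p (5 * real_of_int n / 2) * ?p (- 10 * real_of_int (n + \<mu>1)) * ?p (- 10 * real_of_int (n + \<mu>2)) *
          ?p (6 * real_of_int (n + \<mu>3))"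
          unfolding powr_add[symmetric] by simp
        thus ?thesis by (simp only: power2_eq_square mult_ac)
      qed
      also have "\<dots> \<le> \<bar>\<alpha> i1 i2 i3 \<mu>1 \<mu>2 \<mu>3\<bar> * H\<^sup>2 * D * ?p (23 - real_of_int n)"
      proof (intro mult_left_mono powr_mono)
        \<comment> \<open>The exponent is at most \<open>- 23 * n / 2 + 6\<close>; for
          \<open>n \<ge> -1\<close> it exceeds \<open>- n\<close> by at most 33/2.\<close>
        have "real_of_int n \<ge> -1" "real_of_int \<mu>1 \<ge> 0" "real_of_int \<mu>2 \<ge> 0" "real_of_int \<mu>3 \<le> 1"
          using n \<mu>01 by linarith+
        thus "5 * real_of_int n / 2 - 10 * real_of_int (n + \<mu>1) - 10 * real_of_int (n + \<mu>2) + 6 * real_of_int (n + \<mu>3)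
          \<le> 23 - real_of_int n" by simp
      qed (use eps D in auto)
      also have "?p (23 - real_of_int n) = ?p 23 * ?p (- real_of_int n)"
        by (simp flip: powr_add)
      finally show "norm (case \<mu> of (\<mu>1, \<mu>2, \<mu>3) \<Rightarrow> (\<alpha> i1 i2 i3 \<mu>1 \<mu>2 \<mu>3 * ?p (5 * real_of_int n / 2)
          * X i1 (n + \<mu>1) * X i2 (n + \<mu>2)) *\<^sub>R filtered_wavelet \<sigma> i3 (n + \<mu>3) x) \<le>
        (case \<mu> of (\<mu>1, \<mu>2, \<mu>3) \<Rightarrow> \<bar>\<alpha> i1 i2 i3 \<mu>1 \<mu>2 \<mu>3\<bar> * H\<^sup>2 * D * ?p 23 * ?p (- real_of_int n))"
        by (simp add: \<mu> mult_ac)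
    qed
    also have "\<dots> = K * ?p (- real_of_int n)"
      unfolding K_def sum_distrib_right by (intro sum.cong refl) (auto simp: case_prod_beta)
    finally show ?thesis .
  qed
  thus ?thesis by blast
qed

lemma
  assumes X: "\<And>i n. i \<in> {1..m} \<Longrightarrow> \<bar>X i n\<bar> \<le> H * (1 + \<epsilon>0) powr (- 10 * real_of_int n)"
    and \<sigma>1: "\<And>k. \<bar>\<sigma> k\<bar> \<le> 1"
  shows L2_T_filtered_cascade: "L2_T (filtered_cascade \<alpha> X \<sigma>)"
    and fourier_T_filtered_cascade: "fourier_T (filtered_cascade \<alpha> X \<sigma>) k =
      (\<Sum>n. fourier_T (cascade_term \<alpha> X \<sigma> (int n - 1)) k)"
proof -
  obtain K where K: "\<And>n x. n \<ge> -1 \<Longrightarrow> norm (cascade_term \<alpha> X \<sigma> n x) \<le> K * (1 + \<epsilon>0) powr (- real_of_int n)"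
    using cascade_term_bound[of X H \<sigma> \<alpha>, OF X \<sigma>1] by metis
  \<comment> \<open>Index \<open>n\<close> of the series stands for scale \<open>n - 1\<close>; the
    bounds are geometric with ratio \<open>1 / (1 + \<epsilon>0)\<close>.\<close>
  define b where "b n = K * (1 + \<epsilon>0) powr (- real_of_int (int n - 1))" for n
  have b_eq: "b n = K * (1 + \<epsilon>0) * (1 / (1 + \<epsilon>0)) ^ n" for n
  proof -
    have "(1 + \<epsilon>0) powr (- real_of_int (int n - 1)) = (1 + \<epsilon>0) powr (1 - real n)" by simp
    also have "\<dots> = (1 + \<epsilon>0) / (1 + \<epsilon>0) ^ n"
      using eps by (simp add: powr_diff powr_realpow)
    finally show ?thesis by (simp add: b_def power_divide)
  qed
  have b: "summable b"
    unfolding b_eq[abs_def] using eps by (intro summable_mult summable_geometric) auto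
  have bound: "norm (cascade_term \<alpha> X \<sigma> (int n - 1) x) \<le> b n" for n x
    unfolding b_def by (rule K) simp
  have eq: "filtered_cascade \<alpha> X \<sigma> = (\<lambda>x. \<Sum>n. cascade_term \<alpha> X \<sigma> (int n - 1) x)"
    unfolding filtered_cascade_def fun_eq_iff
    by (intro allI infsum_int_eq_suminf cascade_term_neg, assumption, rule summable_comparison_test'[OF b])
      (use bound in auto)
  show "L2_T (filtered_cascade \<alpha> X \<sigma>)"
    unfolding eq by (rule L2_T_suminf[OF L2_T_cascade_term bound b])
  show "fourier_T (filtered_cascade \<alpha> X \<sigma>) k = (\<Sum>n. fourier_T (cascade_term \<alpha> X \<sigma> (int n - 1)) k)"
    unfolding eq by (rule fourier_T_suminf[OF L2_T_cascade_term bound b])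
qed

text \<open>The frequency \<open>k\<close> belongs to a single wavelet, so only terms with output
  index \<open>i\<close> and \<open>l + \<mu>3 = n\<close> survive. Writing
  \<open>l = n - \<mu>3\<close> gives \<open>cascade_rhs\<close>, whose time argument is a dummy
  here.\<close>

lemma fourier_T_filtered_cascade_mode:
  assumes X: "\<And>i n. i \<in> {1..m} \<Longrightarrow> \<bar>X i n\<bar> \<le> H * (1 + \<epsilon>0) powr (- 10 * real_of_int n)"
    and \<sigma>1: "\<And>k. \<bar>\<sigma> k\<bar> \<le> 1" and \<sigma>: "\<And>k. \<sigma> (- k) = \<sigma> k"
    and i: "i \<in> {1..m}" and k: "k \<in> freqs i n"
  shows "fourier_T (filtered_cascade \<alpha> X \<sigma>) k =
    \<sigma> k *\<^sub>R cascade_rhs \<epsilon>0 m \<alpha> (\<lambda>i n _. X i n) i n t *\<^sub>R fourier_T (wavelet i n) k"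
proof -
  have n0: "n \<ge> 0" using k freqs_neg[OF i, of n] by force
  define P where "P = \<sigma> k *\<^sub>R fourier_T (wavelet i n) k"
  have sel: "\<sigma> k *\<^sub>R fourier_T (wavelet j l) k = (if j = i then if l = n then P else 0 else 0)" if "j \<in> {1..m}" for j l
  proof (cases "k \<in> freqs j l")
    case True
    with freqs_unique[OF that i True k] show ?thesis by (simp add: P_def)
  next
    case False
    with fourier_T_wavelet[OF that False] k show ?thesis by auto
  qed
  let ?c = "\<lambda>l i1 i2 \<mu>1 \<mu>2 \<mu>3. \<alpha> i1 i2 i \<mu>1 \<mu>2 \<mu>3 * (1 + \<epsilon>0) powr (5 * real_of_int l / 2) * X i1 (l + \<mu>1) * X i2 (l + \<mu>2)"
  have ft: "fourier_T (cascade_term \<alpha> X \<sigma> l) k =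
      (\<Sum>i1\<in>{1..m}. \<Sum>i2\<in>{1..m}. \<Sum>(\<mu>1,\<mu>2,\<mu>3)\<in>shift_set. if l + \<mu>3 = n then ?c l i1 i2 \<mu>1 \<mu>2 \<mu>3 *\<^sub>R P else 0)" for l
  proof -
    have "fourier_T (cascade_term \<alpha> X \<sigma> l) k = (\<Sum>i1\<in>{1..m}. \<Sum>i2\<in>{1..m}. \<Sum>i3\<in>{1..m}.
      if i3 = i then (\<Sum>(\<mu>1,\<mu>2,\<mu>3)\<in>shift_set. if l + \<mu>3 = n then ?c l i1 i2 \<mu>1 \<mu>2 \<mu>3 *\<^sub>R P else 0) else 0)"
      unfolding fourier_T_cascade_term[of \<sigma>, OF \<sigma>]
      by (intro sum.cong refl) (auto simp: sel intro!: sum.cong sum.neutral)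
    thus ?thesis using i by (simp add: sum.delta)
  qed
  have "fourier_T (filtered_cascade \<alpha> X \<sigma>) k = (\<Sum>l. fourier_T (cascade_term \<alpha> X \<sigma> (int l - 1)) k)"
    by (rule fourier_T_filtered_cascade[OF X \<sigma>1])
  \<comment> \<open>As \<open>\<mu>3\<close> is 0 or 1, the surviving scales are \<open>n\<close>
    and \<open>n - 1\<close>; because of the offset they sit at the indices
    \<open>nat (n + 1)\<close> and \<open>nat n\<close>.\<close>
  also have "\<dots> = (\<Sum>l\<in>{nat n, nat (n + 1)}. fourier_T (cascade_term \<alpha> X \<sigma> (int l - 1)) k)"
  proof (rule suminf_finite)
    fix l assume "l \<notin> {nat n, nat (n + 1)}"
    hence "int l - 1 \<noteq> n - 1" "int l - 1 \<noteq> n" using n0 by auto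
    thus "fourier_T (cascade_term \<alpha> X \<sigma> (int l - 1)) k = 0"
      unfolding ft by (intro sum.neutral ballI) (auto simp: shift_set_def)
  qed auto
  also have "\<dots> = fourier_T (cascade_term \<alpha> X \<sigma> (n - 1)) k + fourier_T (cascade_term \<alpha> X \<sigma> n) k"
    using n0 by (subst sum.insert) (auto simp: nat_eq_iff)
  also have "\<dots> = (\<Sum>i1\<in>{1..m}. \<Sum>i2\<in>{1..m}. \<Sum>(\<mu>1,\<mu>2,\<mu>3)\<in>shift_set. ?c (n - \<mu>3) i1 i2 \<mu>1 \<mu>2 \<mu>3 *\<^sub>R P)"
    unfolding ft sum.distrib[symmetric]
    by (intro sum.cong refl) (auto simp: shift_set_def)
  also have "\<dots> = cascade_rhs \<epsilon>0 m \<alpha> (\<lambda>i n _. X i n) i n t *\<^sub>R P"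
    unfolding cascade_rhs_def scaleR_sum_left
    by (intro sum.cong refl) (auto simp: case_prod_beta scaleR_sum_left)
  finally show ?thesis by (simp add: P_def)
qed

lemma fourier_T_filtered_cascade_other:
  assumes X: "\<And>i n. i \<in> {1..m} \<Longrightarrow> \<bar>X i n\<bar> \<le> H * (1 + \<epsilon>0) powr (- 10 * real_of_int n)"
    and \<sigma>1: "\<And>k. \<bar>\<sigma> k\<bar> \<le> 1" and \<sigma>: "\<And>k. \<sigma> (- k) = \<sigma> k"
    and k: "\<And>i n. i \<in> {1..m} \<Longrightarrow> k \<notin> freqs i n"
  shows "fourier_T (filtered_cascade \<alpha> X \<sigma>) k = 0"
proof -
  have "fourier_T (cascade_term \<alpha> X \<sigma> l) k = 0" for l
    unfolding fourier_T_cascade_term[of \<sigma>, OF \<sigma>]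
    by (intro sum.neutral ballI) (auto simp: fourier_T_wavelet k)
  thus ?thesis using fourier_T_filtered_cascade[of X H \<sigma>, OF X \<sigma>1] by simp
qed

text \<open>A frequency either belongs to a wavelet, where the symbol factors out of the mode
  formula, or to none, where both sides vanish.\<close>

lemma is_multiplier_image_filtered_cascade:
  assumes X: "\<And>i n. i \<in> {1..m} \<Longrightarrow> \<bar>X i n\<bar> \<le> H * (1 + \<epsilon>0) powr (- 10 * real_of_int n)"
    and \<sigma>1: "\<And>k. \<bar>\<sigma> k\<bar> \<le> 1" and \<sigma>: "\<And>k. \<sigma> (- k) = \<sigma> k"
  shows "is_multiplier_image \<sigma> (filtered_cascade \<alpha> X (\<lambda>_. 1)) (filtered_cascade \<alpha> X \<sigma>)"
  unfolding is_multiplier_image_def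
proof (intro conjI allI)
  show "L2_T (filtered_cascade \<alpha> X \<sigma>)" by (rule L2_T_filtered_cascade[OF X \<sigma>1])
  fix k
  show "fourier_T (filtered_cascade \<alpha> X \<sigma>) k = \<sigma> k *\<^sub>R fourier_T (filtered_cascade \<alpha> X (\<lambda>_. 1)) k"
  proof (cases "\<exists>i\<in>{1..m}. \<exists>n. k \<in> freqs i n")
    case True
    then obtain i n where i: "i \<in> {1..m}" "k \<in> freqs i n" by blast
    have "fourier_T (filtered_cascade \<alpha> X (\<lambda>_. 1)) k =
      1 *\<^sub>R cascade_rhs \<epsilon>0 m \<alpha> (\<lambda>i n _. X i n) i n 0 *\<^sub>R fourier_T (wavelet i n) k"
      by (rule fourier_T_filtered_cascade_mode[OF X _ _ i]) auto
    thus ?thesis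
      using fourier_T_filtered_cascade_mode[of X H \<sigma> i k n \<alpha> 0, OF X \<sigma>1 \<sigma> i] by simp
  next
    case False
    have "fourier_T (filtered_cascade \<alpha> X \<sigma>) k = 0"
      by (rule fourier_T_filtered_cascade_other[of X H \<sigma>, OF X \<sigma>1 \<sigma>]) (use False in auto)
    moreover have "fourier_T (filtered_cascade \<alpha> X (\<lambda>_. 1)) k = 0"
      by (rule fourier_T_filtered_cascade_other[of X H, OF X]) (use False in auto)
    ultimately show ?thesis by simp
  qed
qed

end

section \<open>Evolution of the Fourier coefficients\<close>

text \<open>The fundamental theorem of calculus is applied on a compact interval; ending it at
  \<open>t + 1\<close> leaves room to the right of \<open>t\<close>.\<close>

lemma at_within_atLeast: "(t::real) \<ge> 0 \<Longrightarrow> at t within {0..t + 1} = at t within {0..}"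
  by (rule at_within_nhd[of _ "{..<t + 1}"]) auto

text \<open>At 0 only a one-sided derivative is available; it enters through continuity, and the
  sign is used in the interior.\<close>

lemma nonpos_derivative_le_initial:
  fixes f :: "real \<Rightarrow> real"
  assumes "t \<ge> 0"
    and D: "\<And>s. 0 \<le> s \<Longrightarrow> s \<le> t \<Longrightarrow> \<exists>D. (f has_real_derivative D) (at s within {0..}) \<and> D \<le> 0"
  shows "f t \<le> f 0"
proof (cases "t = 0")
  case False
  show ?thesis
  proof (rule DERIV_nonpos_imp_decreasing_open[OF \<open>t \<ge> 0\<close>])
    fix s assume s: "0 < s" "s < t"
    have "at s within {0..} = at s"
      using s by (intro at_within_interior) (simp add: interior_real_atLeast)
    thus "\<exists>y. DERIV f s :> y \<and> y \<le> 0" using D[of s] s by auto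
  next
    show "continuous_on {0..t} f"
      unfolding continuous_on_eq_continuous_within
    proof
      fix s assume "s \<in> {0..t}"
      then obtain D where "(f has_real_derivative D) (at s within {0..})" using D[of s] by auto
      hence "continuous (at s within {0..}) f" by (rule DERIV_continuous)
      thus "continuous (at s within {0..t}) f" by (rule continuous_within_subset) auto
    qed
  qed
qed simp

lemma in_Hs_imp_L2_T: "in_Hs s f \<Longrightarrow> L2_T f"
  by (simp add: in_Hs_def)

lemma in_Hs_multiplier:
  "in_Hs s f \<Longrightarrow> is_multiplier_image (bessel_symbol s) f (multiplier (bessel_symbol s) f)"
  unfolding in_Hs_def by (auto intro: is_multiplier_image_multiplier)

lemma is_multiplier_image_diff:
  assumes "L2_T f" "L2_T f'" "is_multiplier_image \<sigma> f g" "is_multiplier_image \<sigma> f' g'"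
  shows "is_multiplier_image \<sigma> (\<lambda>x. f x - f' x) (\<lambda>x. g x - g' x)"
  using assms by (auto simp: is_multiplier_image_def L2_T_diff fourier_T_diff scaleR_diff_right)

lemma in_Hs_diff: "in_Hs s f \<Longrightarrow> in_Hs s g \<Longrightarrow> in_Hs s (\<lambda>x. f x - g x)"
  using is_multiplier_image_diff L2_T_diff unfolding in_Hs_def by meson

lemma is_multiplier_image_norm_T_unique:
  assumes "is_multiplier_image \<sigma> f g" "is_multiplier_image \<sigma> f h"
  shows "norm_T g = norm_T h"
proof (rule norm_T_cong_AE)
  show "AE x in T3. g x = h x"
    using assms by (intro fourier_T_eq_AE) (auto simp: is_multiplier_image_def)
qed (use assms in \<open>auto simp: is_multiplier_image_def L2_T_def\<close>)

text \<open>The field chosen for a difference agrees with the difference of the chosen fields only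
  almost everywhere, which suffices for norms. The estimate makes \<open>H\<close> continuous in
  time, hence bounded on compact intervals.\<close>

lemma Hs_norm_diff_le:
  assumes f: "in_Hs s f" and g: "in_Hs s g"
  shows "\<bar>Hs_norm s f - Hs_norm s g\<bar> \<le> Hs_norm s (\<lambda>x. f x - g x)"
proof -
  note L = in_Hs_imp_L2_T[OF f] in_Hs_imp_L2_T[OF g]
  note M = in_Hs_multiplier[OF f] in_Hs_multiplier[OF g]
  have "Hs_norm s (\<lambda>x. f x - g x) =
    norm_T (\<lambda>x. multiplier (bessel_symbol s) f x - multiplier (bessel_symbol s) g x)"
    unfolding Hs_norm_def
    by (rule is_multiplier_image_norm_T_unique[OF in_Hs_multiplier[OF in_Hs_diff[OF f g]]
          is_multiplier_image_diff[OF L M]])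
  thus ?thesis
    unfolding Hs_norm_def using M by (simp add: norm_T_triangle_diff is_multiplier_image_def)
qed

lemma bessel_symbol_ge_1: "s \<ge> 0 \<Longrightarrow> bessel_symbol s k \<ge> 1"
  unfolding bessel_symbol_def by (rule ge_one_powr_ge_zero) auto

lemma Hs_norm_Bessel:
  assumes f: "in_Hs s f" and F: "finite F" "\<And>k. k \<in> F \<Longrightarrow> - k \<in> F"
  shows "(\<Sum>k\<in>F. (bessel_symbol s k * norm (fourier_T f k))\<^sup>2) \<le> (Hs_norm s f)\<^sup>2"
proof -
  note M = in_Hs_multiplier[OF f]
  have "L2_T (multiplier (bessel_symbol s) f)" using M by (simp add: is_multiplier_image_def)
  from fourier_T_Bessel[OF this F]
  show ?thesis using M by (simp add: is_multiplier_image_def Hs_norm_def power_mult_distrib)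
qed

lemma norm_fourier_T_le_Hs_norm:
  assumes f: "in_Hs s f" and "s \<ge> 0"
  shows "norm (fourier_T f k) \<le> Hs_norm s f"
proof (rule power2_le_imp_le)
  have "1 * norm (fourier_T f k) \<le> bessel_symbol s k * norm (fourier_T f k)"
    using bessel_symbol_ge_1[OF \<open>s \<ge> 0\<close>] by (intro mult_right_mono) auto
  hence "(norm (fourier_T f k))\<^sup>2 \<le> (bessel_symbol s k * norm (fourier_T f k))\<^sup>2"
    by (intro power_mono) auto
  also have "\<dots> \<le> (\<Sum>k\<in>{k, - k}. (bessel_symbol s k * norm (fourier_T f k))\<^sup>2)"
    by (rule member_le_sum) auto
  also have "\<dots> \<le> (Hs_norm s f)\<^sup>2"
    by (rule Hs_norm_Bessel[OF f]) auto
  finally show "(norm (fourier_T f k))\<^sup>2 \<le> (Hs_norm s f)\<^sup>2" .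
qed (simp add: Hs_norm_def)

definition heat_rate :: "int^3 \<Rightarrow> real"
  where "heat_rate k = 4 * pi\<^sup>2 * (norm (lat k))\<^sup>2"

lemma heat_rate_nonneg: "heat_rate k \<ge> 0"
  by (simp add: heat_rate_def)

lemma heat_eq: "heat t = multiplier (\<lambda>k. exp (- heat_rate k * t))"
  by (simp add: heat_def heat_rate_def)

section \<open>Coefficients, modes and energies of a fixed solution\<close>

locale cascade_solution = cascade_wavelets +
  fixes \<alpha> :: structure_constants and n0 :: nat and u :: "real \<Rightarrow> vfield"
  assumes m: "1 \<le> m"
    and solution: "mild_solution (cascade_op \<epsilon>0 m \<alpha> \<psi>) (wavelet 1 (int n0)) u"
    and normalized: "\<And>i n. i \<in> {1..m} \<Longrightarrow> n \<ge> int n0 \<Longrightarrow> norm_T (wavelet i n) = 1"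
begin

definition X :: "nat \<Rightarrow> int \<Rightarrow> real \<Rightarrow> real" where "X = X_mode \<epsilon>0 \<psi> u"
definition E :: "nat \<Rightarrow> int \<Rightarrow> real \<Rightarrow> real" where "E = E_mode \<epsilon>0 B u"
definition U :: "int^3 \<Rightarrow> real \<Rightarrow> complex^3" where "U k t = fourier_T (u t) k"
definition W :: "nat \<Rightarrow> int \<Rightarrow> int^3 \<Rightarrow> complex^3" where "W i n = fourier_T (wavelet i n)"
definition rhs :: "nat \<Rightarrow> int \<Rightarrow> real \<Rightarrow> real" where "rhs = cascade_rhs \<epsilon>0 m \<alpha> X"
definition H :: "real \<Rightarrow> real" where "H t = Hs_norm 10 (u t)"

lemma one_in: "1 \<in> {1..m}" using m by simp

lemma u_Hs: "t \<ge> 0 \<Longrightarrow> in_Hs 10 (u t)"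
  using solution by (simp add: mild_solution_def H10_df_def)

lemma u_L2: "t \<ge> 0 \<Longrightarrow> L2_T (u t)"
  by (rule in_Hs_imp_L2_T[OF u_Hs])

lemma u_tendsto: "t \<ge> 0 \<Longrightarrow> ((\<lambda>s. Hs_norm 10 (\<lambda>x. u s x - u t x)) \<longlongrightarrow> 0) (at t within {0..})"
  using solution by (simp add: mild_solution_def)

lemma U_continuous: "continuous_on {0..} (U k)"
  unfolding continuous_on_def
proof
  fix t :: real assume "t \<in> {0..}"
  hence t: "t \<ge> 0" by simp
  have "eventually (\<lambda>s. norm (U k s - U k t) \<le> Hs_norm 10 (\<lambda>x. u s x - u t x)) (at t within {0..})"
    unfolding eventually_at_topological
  proof (intro exI[of _ UNIV] conjI ballI impI)
    fix s :: real assume "s \<in> {0..}"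
    hence s: "s \<ge> 0" by simp
    have "U k s - U k t = fourier_T (\<lambda>x. u s x - u t x) k"
      by (simp add: U_def fourier_T_diff u_L2 s t)
    thus "norm (U k s - U k t) \<le> Hs_norm 10 (\<lambda>x. u s x - u t x)"
      using norm_fourier_T_le_Hs_norm[OF in_Hs_diff[OF u_Hs[OF s] u_Hs[OF t]]] by simp
  qed auto
  hence "((\<lambda>s. U k s - U k t) \<longlongrightarrow> 0) (at t within {0..})"
    by (rule Lim_null_comparison[OF _ u_tendsto[OF t]])
  thus "(U k \<longlongrightarrow> U k t) (at t within {0..})" by (rule Lim_null[THEN iffD2])
qed

lemma H_continuous: "continuous_on {0..} H"
  unfolding continuous_on_def
proof
  fix t :: real assume "t \<in> {0..}"
  hence t: "t \<ge> 0" by simp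
  have "eventually (\<lambda>s. norm (H s - H t) \<le> Hs_norm 10 (\<lambda>x. u s x - u t x)) (at t within {0..})"
    unfolding eventually_at_topological
  proof (intro exI[of _ UNIV] conjI ballI impI)
    fix s :: real assume "s \<in> {0..}"
    thus "norm (H s - H t) \<le> Hs_norm 10 (\<lambda>x. u s x - u t x)"
      using Hs_norm_diff_le[OF u_Hs[of s] u_Hs[OF t]] by (simp add: H_def)
  qed auto
  hence "((\<lambda>s. H s - H t) \<longlongrightarrow> 0) (at t within {0..})"
    by (rule Lim_null_comparison[OF _ u_tendsto[OF t]])
  thus "(H \<longlongrightarrow> H t) (at t within {0..})" by (rule Lim_null[THEN iffD2])
qed

lemma H_nonneg: "H t \<ge> 0"
  by (simp add: H_def Hs_norm_def)

lemma H_bounded: "\<exists>M\<ge>0. \<forall>t\<in>{0..T}. H t \<le> M"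
proof -
  have "compact (H ` {0..T})"
    by (intro compact_continuous_image continuous_on_subset[OF H_continuous]) auto
  hence "bounded (H ` {0..T})" by (rule compact_imp_bounded)
  then obtain M where "M > 0" "\<forall>y\<in>H ` {0..T}. norm y \<le> M" unfolding bounded_pos by blast
  thus ?thesis by (intro exI[of _ M]) auto
qed

lemma X_eq: "i \<in> {1..m} \<Longrightarrow> t \<ge> 0 \<Longrightarrow> X i n t = (\<Sum>k\<in>freqs i n. U k t \<bullet> W i n k)"
  by (simp add: X_def X_mode_def U_def W_def inner_T_wavelet u_L2)

text \<open>The indicator is even and meets finitely many lattice points, so a trigonometric
  polynomial realizes the frequency part, and Parseval's identity makes the energy a finite
  sum.\<close>

lemma E_eq:
  assumes i: "i \<in> {1..m}"
  shows "E i n t = (\<Sum>k\<in>freqs i n. (norm (U k t))\<^sup>2) / 2"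
proof -
  let ?\<sigma> = "\<lambda>k. indicator (freq_set \<epsilon>0 B i n) (lat k) :: real"
  have ind: "?\<sigma> k = indicator (freqs i n) k" for k by (simp add: freqs_def indicator_def)
  have "- k \<in> freqs i n \<longleftrightarrow> k \<in> freqs i n" for k
    using freqs_uminus[of k i n] freqs_uminus[of "- k" i n] by auto
  hence even: "?\<sigma> (- k) = ?\<sigma> k" for k unfolding ind by (simp only: indicator_def)
  have "is_multiplier_image ?\<sigma> (u t) (trig_field (freqs i n) (\<lambda>k. ?\<sigma> k *\<^sub>R fourier_T (u t) k))"
  proof (rule is_multiplier_image_trig_field)
    show "?\<sigma> (- k) = ?\<sigma> k" for k by (rule even)
    show "?\<sigma> k *\<^sub>R fourier_T (u t) k = 0" if "k \<notin> freqs i n" for k using that by (simp add: ind)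
  qed (use finite_freqs[OF i] freqs_uminus in auto)
  hence "is_multiplier_image ?\<sigma> (u t) (freq_part \<epsilon>0 B u i n t)"
    unfolding freq_part_def by (rule is_multiplier_image_multiplier)
  hence L: "L2_T (freq_part \<epsilon>0 B u i n t)"
    and F: "fourier_T (freq_part \<epsilon>0 B u i n t) k = indicator (freqs i n) k *\<^sub>R U k t" for k
    by (auto simp: is_multiplier_image_def ind U_def)
  have "(norm_T (freq_part \<epsilon>0 B u i n t))\<^sup>2 = (\<Sum>k\<in>freqs i n. (norm (fourier_T (freq_part \<epsilon>0 B u i n t) k))\<^sup>2)"
    by (rule norm_T_Parseval[OF L finite_freqs[OF i]]) (auto simp: F freqs_uminus)
  thus ?thesis by (simp add: E_def E_mode_def F)
qed

lemma E_nonneg: "i \<in> {1..m} \<Longrightarrow> E i n t \<ge> 0"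
  by (simp add: E_eq sum_nonneg)

lemma sum_W_le: "i \<in> {1..m} \<Longrightarrow> (\<Sum>k\<in>freqs i n. (norm (W i n k))\<^sup>2) \<le> 1"
  unfolding W_def using norm_T_wavelet_le[of i n] by (simp add: sum_fourier_wavelet power_le_one)

text \<open>Cauchy-Schwarz over the frequency set, the wavelet having norm at most 1. Weight 1
  bounds a mode by its energy; the heat rate as weight bounds the dissipation of a mode.\<close>

lemma weighted_inner_le:
  assumes i: "i \<in> {1..m}" and b: "\<And>k. k \<in> freqs i n \<Longrightarrow> \<bar>b k\<bar> \<le> A" and "A \<ge> 0"
  shows "\<bar>\<Sum>k\<in>freqs i n. b k * (U k t \<bullet> W i n k)\<bar> \<le> A * sqrt (2 * E i n t)"
proof -
  have "\<bar>\<Sum>k\<in>freqs i n. b k * (U k t \<bullet> W i n k)\<bar> \<le> (\<Sum>k\<in>freqs i n. A * (\<bar>norm (U k t)\<bar> * \<bar>norm (W i n k)\<bar>))"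
  proof (rule order_trans[OF sum_abs sum_mono])
    fix k assume "k \<in> freqs i n"
    thus "\<bar>b k * (U k t \<bullet> W i n k)\<bar> \<le> A * (\<bar>norm (U k t)\<bar> * \<bar>norm (W i n k)\<bar>)"
      unfolding abs_mult using b \<open>A \<ge> 0\<close> Cauchy_Schwarz_ineq2[of "U k t" "W i n k"] by (intro mult_mono) auto
  qed
  also have "\<dots> = A * (\<Sum>k\<in>freqs i n. \<bar>norm (U k t)\<bar> * \<bar>norm (W i n k)\<bar>)"
    by (simp add: sum_distrib_left)
  also have "\<dots> \<le> A * (L2_set (\<lambda>k. norm (U k t)) (freqs i n) * L2_set (\<lambda>k. norm (W i n k)) (freqs i n))"
    using \<open>A \<ge> 0\<close> by (intro mult_left_mono L2_set_mult_ineq)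
  also have "\<dots> \<le> A * (sqrt (2 * E i n t) * 1)"
    using sum_W_le[OF i, of n] \<open>A \<ge> 0\<close>
    by (intro mult_left_mono mult_mono) (auto simp: L2_set_def E_eq[OF i] sum_nonneg)
  finally show ?thesis by simp
qed

lemma X_le_sqrt_E: "i \<in> {1..m} \<Longrightarrow> t \<ge> 0 \<Longrightarrow> \<bar>X i n t\<bar> \<le> sqrt (2 * E i n t)"
  using weighted_inner_le[of i n "\<lambda>_. 1" 1 t] by (simp add: X_eq)

text \<open>On the frequency set the Bessel symbol of order 10 dominates both 1 and the tenth power
  of the scale; the maximum carries both bounds at once.\<close>

lemma E_decay:
  assumes i: "i \<in> {1..m}" and t: "t \<ge> 0"
  shows "max 1 ((1 + \<epsilon>0) powr (10 * real_of_int n)) * sqrt (2 * E i n t) \<le> H t"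
proof (rule power2_le_imp_le)
  let ?b = "max 1 ((1 + \<epsilon>0) powr (10 * real_of_int n))"
  have b: "?b \<le> bessel_symbol 10 k" if k: "k \<in> freqs i n" for k
  proof -
    have "(1 + \<epsilon>0) powr (10 * real_of_int n) = ((1 + \<epsilon>0) powr real_of_int n) powr 10"
      by (simp add: powr_powr mult.commute)
    also have "\<dots> = dil n powr 10" by (simp add: dil_def)
    also have "\<dots> \<le> norm (lat k) powr 10"
      using freqs_bounds(1)[OF i k] by (intro powr_mono2) auto
    also have "\<dots> = ((norm (lat k))\<^sup>2) powr 5"
      using less_trans[OF dil_pos freqs_bounds(1)[OF i k]]
      by (simp add: powr_powr flip: powr_numeral)
    also have "\<dots> \<le> (1 + 4 * pi\<^sup>2 * (norm (lat k))\<^sup>2) powr 5"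
    proof (intro powr_mono2)
      have "1 \<le> pi\<^sup>2" using pi_gt3 by (simp add: one_le_power)
      hence "1 * (norm (lat k))\<^sup>2 \<le> (4 * pi\<^sup>2) * (norm (lat k))\<^sup>2" by (intro mult_right_mono) auto
      thus "(norm (lat k))\<^sup>2 \<le> 1 + 4 * pi\<^sup>2 * (norm (lat k))\<^sup>2" by simp
    qed auto
    finally show ?thesis using bessel_symbol_ge_1[of 10 k] by (simp add: bessel_symbol_def)
  qed
  have "(sqrt (2 * E i n t))\<^sup>2 = (\<Sum>k\<in>freqs i n. (norm (U k t))\<^sup>2)"
    using E_nonneg[OF i, of n t] by (simp add: E_eq[OF i])
  hence "(?b * sqrt (2 * E i n t))\<^sup>2 = (\<Sum>k\<in>freqs i n. (?b * norm (U k t))\<^sup>2)"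
    by (simp only: power_mult_distrib sum_distrib_left)
  also have "\<dots> \<le> (\<Sum>k\<in>freqs i n. (bessel_symbol 10 k * norm (U k t))\<^sup>2)"
    by (intro sum_mono power_mono mult_right_mono b) auto
  also have "\<dots> \<le> (H t)\<^sup>2"
    unfolding U_def H_def by (intro Hs_norm_Bessel u_Hs t finite_freqs i freqs_uminus)
  finally show "(?b * sqrt (2 * E i n t))\<^sup>2 \<le> (H t)\<^sup>2" .
qed (rule H_nonneg)

lemma X_le_H:
  assumes i: "i \<in> {1..m}" and t: "t \<ge> 0"
  shows "\<bar>X i n t\<bar> \<le> H t" "\<bar>X i n t\<bar> \<le> H t * (1 + \<epsilon>0) powr (- 10 * real_of_int n)"
    "(1 + (1 + \<epsilon>0) powr (10 * real_of_int n)) * \<bar>X i n t\<bar> \<le> 2 * H t"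
    "(1 + (1 + \<epsilon>0) powr (10 * real_of_int n)) * \<bar>E i n t\<bar> \<le> (H t)\<^sup>2"
proof -
  let ?p = "(1 + \<epsilon>0) powr (10 * real_of_int n)"
  let ?r = "sqrt (2 * E i n t)"
  have r: "?r \<ge> 0" using E_nonneg[OF i] by simp
  have d: "max 1 ?p * ?r \<le> H t" by (rule E_decay[OF i t])
  have 1: "1 * ?r \<le> max 1 ?p * ?r" "?p * ?r \<le> max 1 ?p * ?r"
    using r by (intro mult_right_mono; simp)+
  have x: "\<bar>X i n t\<bar> \<le> ?r" by (rule X_le_sqrt_E[OF i t])
  show "\<bar>X i n t\<bar> \<le> H t" using x 1 d by linarith
  have "?p * \<bar>X i n t\<bar> \<le> ?p * ?r" using x by (intro mult_left_mono) auto
  hence 2: "?p * \<bar>X i n t\<bar> \<le> H t" using 1 d by linarith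
  show "(1 + ?p) * \<bar>X i n t\<bar> \<le> 2 * H t" using 2 x 1 d unfolding distrib_right by linarith
  show "\<bar>X i n t\<bar> \<le> H t * (1 + \<epsilon>0) powr (- 10 * real_of_int n)"
    using 2 eps by (simp add: powr_minus field_simps)
  \<comment> \<open>The energy is quadratic in \<open>?r\<close>, so the square of the weight is
    available and dominates \<open>1 + ?p\<close> up to a factor 2.\<close>
  have "1 \<le> max 1 ?p" "?p \<le> max 1 ?p" by auto
  hence "1 + ?p \<le> 2 * max 1 ?p" by linarith
  also have "\<dots> \<le> 2 * (max 1 ?p)\<^sup>2" using power_increasing[of 1 2 "max 1 ?p"] by simp
  finally have "(1 + ?p) * E i n t \<le> 2 * (max 1 ?p)\<^sup>2 * E i n t"
    using E_nonneg[OF i] by (rule mult_right_mono)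
  also have "\<dots> = (max 1 ?p * ?r)\<^sup>2" using E_nonneg[OF i] by (simp add: power_mult_distrib)
  also have "\<dots> \<le> (H t)\<^sup>2" using d r by (intro power_mono) auto
  finally show "(1 + ?p) * \<bar>E i n t\<bar> \<le> (H t)\<^sup>2" using E_nonneg[OF i] by simp
qed

lemma X_continuous:
  assumes i: "i \<in> {1..m}"
  shows "continuous_on {0..} (X i n)"
proof -
  have "continuous_on {0..} (\<lambda>t. \<Sum>k\<in>freqs i n. U k t \<bullet> W i n k)"
    by (intro continuous_intros U_continuous)
  thus ?thesis by (rule continuous_on_eq) (use X_eq[OF i] in auto)
qed

lemma E_continuous: "i \<in> {1..m} \<Longrightarrow> continuous_on {0..} (E i n)"
proof -
  assume "i \<in> {1..m}"
  hence "E i n = (\<lambda>t. (\<Sum>k\<in>freqs i n. (norm (U k t))\<^sup>2) / 2)" by (simp add: fun_eq_iff E_eq)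
  thus ?thesis by (auto intro!: continuous_intros U_continuous)
qed

lemma rhs_continuous: "continuous_on {0..} (rhs i n)"
  unfolding rhs_def cascade_rhs_def case_prod_beta by (intro continuous_intros X_continuous) auto

text \<open>The series filtered by the heat symbol witnesses the multiplier, so the coefficients of
  the chosen field are known; \<open>\<tau> \<ge> 0\<close> keeps the symbol at most 1.\<close>

lemma
  assumes t: "t \<ge> 0" and \<tau>: "\<tau> \<ge> 0"
  shows L2_T_heat_cascade: "L2_T (heat \<tau> (cascade_op \<epsilon>0 m \<alpha> \<psi> (u t) (u t)))"
    and fourier_T_heat_cascade: "i \<in> {1..m} \<Longrightarrow> k \<in> freqs i n \<Longrightarrow>
      fourier_T (heat \<tau> (cascade_op \<epsilon>0 m \<alpha> \<psi> (u t) (u t))) k = (exp (- heat_rate k * \<tau>) * rhs i n t) *\<^sub>R W i n k"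
proof -
  let ?\<sigma> = "\<lambda>k. exp (- heat_rate k * \<tau>)"
  let ?X = "\<lambda>i n. inner_T (u t) (wavelet i n)"
  have X: "\<bar>?X i n\<bar> \<le> H t * (1 + \<epsilon>0) powr (- 10 * real_of_int n)" if "i \<in> {1..m}" for i n
    using X_le_H(2)[OF that t] by (simp add: X_def X_mode_def)
  have \<sigma>1: "\<bar>?\<sigma> k\<bar> \<le> 1" and \<sigma>: "?\<sigma> (- k) = ?\<sigma> k" for k
    using \<tau> heat_rate_nonneg[of k] by (auto simp: heat_rate_def)
  have "is_multiplier_image ?\<sigma> (cascade_op \<epsilon>0 m \<alpha> \<psi> (u t) (u t)) (filtered_cascade \<alpha> ?X ?\<sigma>)"
    unfolding cascade_op_eq by (rule is_multiplier_image_filtered_cascade[of ?X "H t" ?\<sigma>, OF X \<sigma>1 \<sigma>])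
  hence im: "is_multiplier_image ?\<sigma> (cascade_op \<epsilon>0 m \<alpha> \<psi> (u t) (u t)) (heat \<tau> (cascade_op \<epsilon>0 m \<alpha> \<psi> (u t) (u t)))"
    unfolding heat_eq by (rule is_multiplier_image_multiplier)
  thus "L2_T (heat \<tau> (cascade_op \<epsilon>0 m \<alpha> \<psi> (u t) (u t)))" by (simp add: is_multiplier_image_def)
  assume i: "i \<in> {1..m}" "k \<in> freqs i n"
  have "fourier_T (cascade_op \<epsilon>0 m \<alpha> \<psi> (u t) (u t)) k =
      1 *\<^sub>R cascade_rhs \<epsilon>0 m \<alpha> (\<lambda>i n _. ?X i n) i n t *\<^sub>R fourier_T (wavelet i n) k"
    unfolding cascade_op_eq by (rule fourier_T_filtered_cascade_mode[of ?X "H t", OF X _ _ i]) auto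
  also have "cascade_rhs \<epsilon>0 m \<alpha> (\<lambda>i n _. ?X i n) i n t = rhs i n t"
    by (simp add: rhs_def cascade_rhs_def X_def X_mode_def)
  finally show "fourier_T (heat \<tau> (cascade_op \<epsilon>0 m \<alpha> \<psi> (u t) (u t))) k = (exp (- heat_rate k * \<tau>) * rhs i n t) *\<^sub>R W i n k"
    using im by (simp add: is_multiplier_image_def W_def)
qed

text \<open>The integral of the mild formulation is weak, so the coefficient of \<open>I\<close> is
  found by pairing with \<open>test_field k b\<close> for all \<open>b\<close>. The factor
  \<open>exp (- heat_rate k * t)\<close> is pulled out so that the remaining integrand does not
  depend on \<open>t\<close> and the formula can be differentiated.\<close>

lemma Duhamel:
  assumes t: "t \<ge> 0" and i: "i \<in> {1..m}" and k: "k \<in> freqs i n"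
  shows "U k t = exp (- heat_rate k * t) *\<^sub>R (W 1 (int n0) k +
    integral {0..t} (\<lambda>s. (exp (heat_rate k * s) * rhs i n s) *\<^sub>R W i n k))"
proof -
  let ?C = "\<lambda>s. cascade_op \<epsilon>0 m \<alpha> \<psi> (u s) (u s)"
  let ?u0 = "wavelet 1 (int n0)"
  let ?\<sigma> = "\<lambda>k. exp (- heat_rate k * t)"
  obtain I where I: "has_L2_integral (\<lambda>s. heat (t - s) (?C s)) I t" "AE x in T3. u t x = heat t ?u0 x + I x"
    using solution t unfolding mild_solution_def by blast
  have LI: "L2_T I" using I(1) by (simp add: has_L2_integral_def)
  have "is_multiplier_image ?\<sigma> ?u0 (trig_field (freqs 1 (int n0)) (\<lambda>k. ?\<sigma> k *\<^sub>R fourier_T ?u0 k))"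
    using one_in by (intro is_multiplier_image_trig_field finite_freqs)
      (auto simp: freqs_uminus fourier_T_wavelet heat_rate_def)
  hence h: "is_multiplier_image ?\<sigma> ?u0 (heat t ?u0)"
    unfolding heat_eq by (rule is_multiplier_image_multiplier)
  hence Lh: "L2_T (heat t ?u0)" by (simp add: is_multiplier_image_def)
  have "U k t = fourier_T (\<lambda>x. heat t ?u0 x + I x) k"
    unfolding U_def by (rule fourier_T_cong_AE) (use I(2) u_L2[OF t] L2_T_add[OF Lh LI] in \<open>auto simp: L2_T_def\<close>)
  also have "\<dots> = ?\<sigma> k *\<^sub>R W 1 (int n0) k + fourier_T I k"
    using h by (simp add: fourier_T_add Lh LI is_multiplier_image_def W_def)
  finally have U: "U k t = ?\<sigma> k *\<^sub>R W 1 (int n0) k + fourier_T I k" .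
  define f where "f s = (exp (- heat_rate k * (t - s)) * rhs i n s) *\<^sub>R W i n k" for s
  have "continuous_on {0..t} f"
    unfolding f_def by (intro continuous_intros continuous_on_subset[OF rhs_continuous]) auto
  hence f: "(f has_integral integral {0..t} f) {0..t}"
    by (intro integrable_integral integrable_continuous_real)
  have "fourier_T I k \<bullet> b = integral {0..t} f \<bullet> b" for b
  proof -
    have "((\<lambda>s. inner_T (heat (t - s) (?C s)) (test_field k b)) has_integral inner_T I (test_field k b)) {0..t}"
      using I(1) L2_T_test_field by (simp add: has_L2_integral_def)
    hence "((\<lambda>s. 2 * (f s \<bullet> b)) has_integral 2 * (fourier_T I k \<bullet> b)) {0..t}"
      unfolding inner_T_test_field[OF LI freqs_nonzero[OF i k]]
      by (rule has_integral_eq[rotated])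
        (simp add: inner_T_test_field L2_T_heat_cascade freqs_nonzero[OF i k] fourier_T_heat_cascade[OF _ _ i k] f_def)
    moreover have "((\<lambda>s. 2 * (f s \<bullet> b)) has_integral 2 * (integral {0..t} f \<bullet> b)) {0..t}"
      using has_integral_linear[OF f bounded_linear_inner_left[of b]]
      by (intro has_integral_mult_right) (simp add: o_def)
    ultimately have "2 * (fourier_T I k \<bullet> b) = 2 * (integral {0..t} f \<bullet> b)"
      by (rule has_integral_unique)
    thus ?thesis by simp
  qed
  hence "fourier_T I k = integral {0..t} f" using vector_eq_rdot by blast
  also have "f = (\<lambda>s. ?\<sigma> k *\<^sub>R ((exp (heat_rate k * s) * rhs i n s) *\<^sub>R W i n k))"
    by (simp add: f_def fun_eq_iff algebra_simps flip: exp_add)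
  also have "integral {0..t} \<dots> = ?\<sigma> k *\<^sub>R integral {0..t} (\<lambda>s. (exp (heat_rate k * s) * rhs i n s) *\<^sub>R W i n k)"
    by (rule integral_cmul)
  finally show ?thesis unfolding U by (simp add: scaleR_add_right)
qed

lemma U_derivative:
  assumes t: "t \<ge> 0" and i: "i \<in> {1..m}" and k: "k \<in> freqs i n"
  shows "(U k has_vector_derivative (rhs i n t *\<^sub>R W i n k - heat_rate k *\<^sub>R U k t)) (at t within {0..})"
proof -
  define g where "g s = (exp (heat_rate k * s) * rhs i n s) *\<^sub>R W i n k" for s
  define V where "V t = W 1 (int n0) k + integral {0..t} g" for t
  have "continuous_on {0..t + 1} g"
    unfolding g_def by (intro continuous_intros continuous_on_subset[OF rhs_continuous]) auto
  hence "((\<lambda>t. integral {0..t} g) has_vector_derivative g t) (at t within {0..t + 1})"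
    by (rule integral_has_vector_derivative) (use t in auto)
  hence V: "(V has_vector_derivative g t) (at t within {0..})"
    unfolding V_def[abs_def] at_within_atLeast[OF t] by (auto intro!: derivative_eq_intros)
  have e: "((\<lambda>t. exp (- heat_rate k * t)) has_vector_derivative - heat_rate k * exp (- heat_rate k * t)) (at t within {0..})"
    unfolding has_real_derivative_iff_has_vector_derivative[symmetric] by (auto intro!: derivative_eq_intros)
  have UV: "U k s = exp (- heat_rate k * s) *\<^sub>R V s" if "s \<ge> 0" for s
    using Duhamel[OF that i k] by (simp add: V_def g_def[abs_def])
  have "((\<lambda>s. exp (- heat_rate k * s) *\<^sub>R V s) has_vector_derivative
      (exp (- heat_rate k * t) *\<^sub>R g t + (- heat_rate k * exp (- heat_rate k * t)) *\<^sub>R V t)) (at t within {0..})"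
    by (rule has_vector_derivative_scaleR[OF _ V]) (use e in \<open>simp add: has_real_derivative_iff_has_vector_derivative\<close>)
  also have "exp (- heat_rate k * t) *\<^sub>R g t + (- heat_rate k * exp (- heat_rate k * t)) *\<^sub>R V t =
      rhs i n t *\<^sub>R W i n k - heat_rate k *\<^sub>R U k t"
    by (simp add: UV[OF t] g_def flip: exp_add mult.assoc)
  finally show ?thesis
    by (rule has_vector_derivative_transform[rotated 2]) (use t UV in auto)
qed

end

section \<open>Initial values, mode equations and energy estimates\<close>

context cascade_solution
begin

lemma U_0: "i \<in> {1..m} \<Longrightarrow> k \<in> freqs i n \<Longrightarrow> U k 0 = W 1 (int n0) k"
  using Duhamel[of 0 i k n] by simp

lemma W_other: "i \<in> {1..m} \<Longrightarrow> k \<in> freqs i n \<Longrightarrow> (i, n) \<noteq> (1, int n0) \<Longrightarrow> W 1 (int n0) k = 0"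
  unfolding W_def using freqs_unique[OF _ one_in, of i k n "int n0"] one_in
  by (intro fourier_T_wavelet) auto

lemma sum_W_first: "(\<Sum>k\<in>freqs 1 (int n0). (norm (W 1 (int n0) k))\<^sup>2) = 1"
  unfolding W_def using sum_fourier_wavelet[OF one_in] normalized[OF one_in] by simp

lemma X_0:
  assumes i: "i \<in> {1..m}"
  shows "X i n 0 = (if (i, n) = (1, int n0) then 1 else 0)"
proof (cases "(i, n) = (1, int n0)")
  case True
  have "X 1 (int n0) 0 = (\<Sum>k\<in>freqs 1 (int n0). (norm (W 1 (int n0) k))\<^sup>2)"
    unfolding X_eq[OF one_in order_refl]
    by (intro sum.cong refl) (simp add: U_0[OF one_in] power2_norm_eq_inner)
  thus ?thesis using True sum_W_first by simp
next
  case False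
  have "X i n 0 = 0"
    unfolding X_eq[OF i order_refl] by (intro sum.neutral ballI) (simp add: U_0[OF i] W_other[OF i _ False] del: One_nat_def)
  thus ?thesis using False by simp
qed

lemma E_0:
  assumes i: "i \<in> {1..m}"
  shows "E i n 0 = (X i n 0)\<^sup>2 / 2"
proof (cases "(i, n) = (1, int n0)")
  case True
  have "E 1 (int n0) 0 = (\<Sum>k\<in>freqs 1 (int n0). (norm (W 1 (int n0) k))\<^sup>2) / 2"
    unfolding E_eq[OF one_in]
    by (intro arg_cong2[of _ _ _ _ "(/)"] sum.cong refl) (simp add: U_0[OF one_in])
  thus ?thesis using True sum_W_first X_0[OF i, of n] by simp
next
  case False
  have "(\<Sum>k\<in>freqs i n. (norm (U k 0))\<^sup>2) = 0"
    by (intro sum.neutral ballI) (simp add: U_0[OF i] W_other[OF i _ False] del: One_nat_def)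
  thus ?thesis using X_0[OF i, of n] False by (simp add: E_eq[OF i] if_split)
qed

text \<open>Pairing with \<open>W i n\<close> leaves the squared norm of the wavelet as a factor, 0
  where the periodization vanishes.\<close>

lemma X_derivative:
  assumes i: "i \<in> {1..m}" and t: "t \<ge> 0"
  shows "(X i n has_real_derivative (rhs i n t * (norm_T (wavelet i n))\<^sup>2 - (\<Sum>k\<in>freqs i n. heat_rate k * (U k t \<bullet> W i n k))))
    (at t within {0..})"
proof -
  have "((\<lambda>t. \<Sum>k\<in>freqs i n. U k t \<bullet> W i n k) has_vector_derivative
      (\<Sum>k\<in>freqs i n. (rhs i n t *\<^sub>R W i n k - heat_rate k *\<^sub>R U k t) \<bullet> W i n k)) (at t within {0..})"
    by (intro has_vector_derivative_sum bounded_linear.has_vector_derivative[OF bounded_linear_inner_left]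
        U_derivative[OF t i])
  also have "(\<Sum>k\<in>freqs i n. (rhs i n t *\<^sub>R W i n k - heat_rate k *\<^sub>R U k t) \<bullet> W i n k) =
      rhs i n t * (norm_T (wavelet i n))\<^sup>2 - (\<Sum>k\<in>freqs i n. heat_rate k * (U k t \<bullet> W i n k))"
    unfolding sum_fourier_wavelet[OF i, symmetric] W_def
    by (simp add: inner_diff_left sum_subtractf sum_distrib_left power2_norm_eq_inner)
  finally show ?thesis
    unfolding has_real_derivative_iff_has_vector_derivative
    by (rule has_vector_derivative_transform[rotated 2]) (use t X_eq[OF i] in auto)
qed

text \<open>Pairing with \<open>U\<close> turns the forcing into \<open>rhs i n t\<close> times the
  mode exactly, without a norm of the wavelet.\<close>

lemma E_derivative:
  assumes i: "i \<in> {1..m}" and t: "t \<ge> 0"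
  shows "(E i n has_real_derivative (rhs i n t * X i n t - (\<Sum>k\<in>freqs i n. heat_rate k * (norm (U k t))\<^sup>2)))
    (at t within {0..})"
proof -
  let ?U' = "\<lambda>k. rhs i n t *\<^sub>R W i n k - heat_rate k *\<^sub>R U k t"
  have "((\<lambda>t. \<Sum>k\<in>freqs i n. U k t \<bullet> U k t) has_vector_derivative
      (\<Sum>k\<in>freqs i n. U k t \<bullet> ?U' k + ?U' k \<bullet> U k t)) (at t within {0..})"
    by (intro has_vector_derivative_sum bounded_bilinear.has_vector_derivative[OF bounded_bilinear_inner]
        U_derivative[OF t i])
  hence "((\<lambda>t. (\<Sum>k\<in>freqs i n. U k t \<bullet> U k t) / 2) has_real_derivative
      (\<Sum>k\<in>freqs i n. U k t \<bullet> ?U' k + ?U' k \<bullet> U k t) / 2) (at t within {0..})"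
    unfolding has_real_derivative_iff_has_vector_derivative[symmetric] by (rule DERIV_cdivide)
  also have "(\<lambda>t. (\<Sum>k\<in>freqs i n. U k t \<bullet> U k t) / 2) = E i n"
    by (simp add: fun_eq_iff E_eq[OF i] power2_norm_eq_inner)
  also have "(\<Sum>k\<in>freqs i n. U k t \<bullet> ?U' k + ?U' k \<bullet> U k t) = (\<Sum>k\<in>freqs i n. 2 * (?U' k \<bullet> U k t))"
    by (simp add: inner_commute)
  also have "\<dots> / 2 = (\<Sum>k\<in>freqs i n. ?U' k \<bullet> U k t)"
    by (simp flip: sum_distrib_left)
  also have "\<dots> = rhs i n t * X i n t - (\<Sum>k\<in>freqs i n. heat_rate k * (norm (U k t))\<^sup>2)"
    using i t
    by (simp add: X_eq inner_diff_left sum_subtractf sum_distrib_left power2_norm_eq_inner inner_commute[of "W i n _"])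
  finally show ?thesis .
qed

lemma heat_rate_le:
  assumes i: "i \<in> {1..m}" and k: "k \<in> freqs i n"
  shows "heat_rate k \<le> 9 * pi\<^sup>2 * (dil n)\<^sup>2"
proof -
  have "norm (lat k) \<le> dil n * (1 + \<epsilon>0 / 2)" using freqs_bounds(2)[OF i k] by simp
  \<comment> \<open>The outer radius is at most 3/2 because \<open>\<epsilon>0 < 1\<close>; then
    \<open>4 * (3 / 2)\<^sup>2 = 9\<close>.\<close>
  also have "\<dots> \<le> dil n * (3 / 2)" using eps by (intro mult_left_mono) auto
  finally have "(norm (lat k))\<^sup>2 \<le> (dil n * (3 / 2))\<^sup>2" by (rule power_mono) simp
  hence "4 * pi\<^sup>2 * (norm (lat k))\<^sup>2 \<le> 4 * pi\<^sup>2 * (dil n * (3 / 2))\<^sup>2" by (rule mult_left_mono) simp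
  thus ?thesis by (simp add: heat_rate_def power_mult_distrib power2_eq_square)
qed

lemma dissipation_le:
  assumes i: "i \<in> {1..m}"
  shows "\<bar>\<Sum>k\<in>freqs i n. heat_rate k * (U k t \<bullet> W i n k)\<bar> \<le> 9 * pi\<^sup>2 * (dil n)\<^sup>2 * sqrt (2 * E i n t)"
  by (rule weighted_inner_le[OF i]) (use heat_rate_le[OF i] heat_rate_nonneg in auto)

lemma dissipation_nonneg: "(\<Sum>k\<in>freqs i n. heat_rate k * (norm (U k t))\<^sup>2) \<ge> 0"
  by (intro sum_nonneg mult_nonneg_nonneg heat_rate_nonneg) auto

lemma modes_neg: "i \<in> {1..m} \<Longrightarrow> n < 0 \<Longrightarrow> t \<ge> 0 \<Longrightarrow> X i n t = 0 \<and> E i n t = 0"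
  by (simp add: X_eq E_eq freqs_neg)

text \<open>In every product occurring in \<open>rhs i n\<close> one of the two factors has an index at most \<open>n\<close>,
  so the modes below \<open>n0\<close> are driven linearly by themselves and Gronwall's argument applies.\<close>

lemma modes_below_vanish:
  assumes i: "i \<in> {1..m}" and n: "n < int n0" and t: "t \<ge> 0"
  shows "X i n t = 0 \<and> E i n t = 0"
proof (cases "n < 0")
  case True
  thus ?thesis using modes_neg i t by simp
next
  case False
  obtain M where M: "M \<ge> 0" "\<And>s. s \<in> {0..t} \<Longrightarrow> H s \<le> M" using H_bounded[of t] by blast
  define J where "J = {1..m} \<times> {0..<int n0}"
  define Y where "Y s = (\<Sum>(j, l)\<in>J. E j l s)" for s
  define A where "A j l = (\<Sum>i1\<in>{1..m}. \<Sum>i2\<in>{1..m}. \<Sum>(\<mu>1,\<mu>2,\<mu>3)\<in>shift_set.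
    \<bar>\<alpha> i1 i2 j \<mu>1 \<mu>2 \<mu>3\<bar> * (1 + \<epsilon>0) powr (5 * real_of_int (l - \<mu>3) / 2))" for j l
  define L where "L = (\<Sum>(j, l)\<in>J. 2 * A j l * M)"
  have finJ: "finite J" by (simp add: J_def)
  have E_le_Y: "E j l s \<le> Y s" if "(j, l) \<in> J" for j l s
  proof -
    have "(case (j, l) of (j, l) \<Rightarrow> E j l s) \<le> Y s"
      unfolding Y_def using that finJ by (intro member_le_sum) (auto simp: J_def E_nonneg)
    thus ?thesis by simp
  qed
  have Y_nonneg: "Y s \<ge> 0" for s unfolding Y_def by (intro sum_nonneg) (auto simp: J_def E_nonneg)
  have X_le: "\<bar>X j l s\<bar> \<le> sqrt (2 * Y s)" if "j \<in> {1..m}" "l < int n0" "s \<ge> 0" for j l s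
  proof (cases "l < 0")
    case True
    thus ?thesis using modes_neg that Y_nonneg by simp
  next
    case False
    hence "E j l s \<le> Y s" using that by (intro E_le_Y) (auto simp: J_def)
    hence "sqrt (2 * E j l s) \<le> sqrt (2 * Y s)" by simp
    thus ?thesis using X_le_sqrt_E[OF that(1,3), of l] by linarith
  qed
  have rhs_le: "\<bar>rhs j l s\<bar> \<le> A j l * (M * sqrt (2 * Y s))" if j: "j \<in> {1..m}" and l: "l < int n0" and s: "s \<in> {0..t}" for j l s
  proof -
    have s0: "s \<ge> 0" using s by simp
    have XM: "\<bar>X j l s\<bar> \<le> M" if "j \<in> {1..m}" for j l
      using X_le_H(1)[OF that s0, of l] M(2)[OF s] by linarith
    have "\<bar>rhs j l s\<bar> \<le> (\<Sum>i1\<in>{1..m}. \<Sum>i2\<in>{1..m}. \<Sum>(\<mu>1,\<mu>2,\<mu>3)\<in>shift_set.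
      \<bar>\<alpha> i1 i2 j \<mu>1 \<mu>2 \<mu>3\<bar> * (1 + \<epsilon>0) powr (5 * real_of_int (l - \<mu>3) / 2) * (M * sqrt (2 * Y s)))"
      unfolding rhs_def cascade_rhs_def
    proof (intro order_trans[OF sum_abs] sum_mono)
      fix i1 i2 \<mu> assume i12: "i1 \<in> {1..m}" "i2 \<in> {1..m}" and "\<mu> \<in> shift_set"
      obtain \<mu>1 \<mu>2 \<mu>3 where \<mu>: "\<mu> = (\<mu>1, \<mu>2, \<mu>3)" by (metis prod_cases3)
      have cases: "l - \<mu>3 + \<mu>1 < int n0 \<or> l - \<mu>3 + \<mu>2 < int n0"
        using \<open>\<mu> \<in> shift_set\<close> l by (auto simp: \<mu> shift_set_def)
      \<comment> \<open>The factor of low scale is measured by \<open>Y\<close>; the other may have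
        scale \<open>n0\<close> and is bounded by the Sobolev bound \<open>M\<close>. Multiplied by
        one more low mode this is linear in \<open>Y\<close>.\<close>
      have "\<bar>X i1 (l - \<mu>3 + \<mu>1) s\<bar> * \<bar>X i2 (l - \<mu>3 + \<mu>2) s\<bar> \<le> M * sqrt (2 * Y s)"
        using cases
      proof
        assume "l - \<mu>3 + \<mu>1 < int n0"
        hence "\<bar>X i1 (l - \<mu>3 + \<mu>1) s\<bar> * \<bar>X i2 (l - \<mu>3 + \<mu>2) s\<bar> \<le> sqrt (2 * Y s) * M"
          using X_le[OF i12(1) _ s0] XM[OF i12(2)] Y_nonneg by (intro mult_mono) auto
        thus ?thesis by (simp add: mult.commute)
      next
        assume "l - \<mu>3 + \<mu>2 < int n0"
        thus ?thesis using X_le[OF i12(2) _ s0] XM[OF i12(1)] M(1) by (intro mult_mono) auto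
      qed
      hence "\<bar>\<alpha> i1 i2 j \<mu>1 \<mu>2 \<mu>3\<bar> * (1 + \<epsilon>0) powr (5 * real_of_int (l - \<mu>3) / 2) *
          (\<bar>X i1 (l - \<mu>3 + \<mu>1) s\<bar> * \<bar>X i2 (l - \<mu>3 + \<mu>2) s\<bar>) \<le>
        \<bar>\<alpha> i1 i2 j \<mu>1 \<mu>2 \<mu>3\<bar> * (1 + \<epsilon>0) powr (5 * real_of_int (l - \<mu>3) / 2) * (M * sqrt (2 * Y s))"
        by (intro mult_left_mono) auto
      thus "\<bar>case \<mu> of (\<mu>1, \<mu>2, \<mu>3) \<Rightarrow> \<alpha> i1 i2 j \<mu>1 \<mu>2 \<mu>3 * (1 + \<epsilon>0) powr (5 * real_of_int (l - \<mu>3) / 2)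
          * X i1 (l - \<mu>3 + \<mu>1) s * X i2 (l - \<mu>3 + \<mu>2) s\<bar> \<le>
        (case \<mu> of (\<mu>1, \<mu>2, \<mu>3) \<Rightarrow> \<bar>\<alpha> i1 i2 j \<mu>1 \<mu>2 \<mu>3\<bar> * (1 + \<epsilon>0) powr (5 * real_of_int (l - \<mu>3) / 2) * (M * sqrt (2 * Y s)))"
        by (simp add: \<mu> abs_mult mult.assoc)
    qed
    also have "\<dots> = A j l * (M * sqrt (2 * Y s))"
      unfolding A_def sum_distrib_right by (intro sum.cong refl) (auto simp: case_prod_beta)
    finally show ?thesis .
  qed
  define Y' where "Y' s = (\<Sum>(j, l)\<in>J. rhs j l s * X j l s - (\<Sum>k\<in>freqs j l. heat_rate k * (norm (U k s))\<^sup>2))" for s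
  have Y_deriv: "(Y has_real_derivative Y' s) (at s within {0..})" if "s \<ge> 0" for s
    unfolding Y_def[abs_def] Y'_def case_prod_beta
    by (intro DERIV_sum E_derivative that) (auto simp: J_def)
  have Y'_le: "Y' s \<le> L * Y s" if s: "s \<in> {0..t}" for s
  proof -
    have s0: "s \<ge> 0" using s by simp
    have "rhs j l s * X j l s - (\<Sum>k\<in>freqs j l. heat_rate k * (norm (U k s))\<^sup>2) \<le> 2 * A j l * M * Y s"
      if "(j, l) \<in> J" for j l
    proof -
      have jl: "j \<in> {1..m}" "l < int n0" using that by (auto simp: J_def)
      have A: "A j l \<ge> 0" unfolding A_def by (intro sum_nonneg) auto
      have "rhs j l s * X j l s \<le> \<bar>rhs j l s\<bar> * \<bar>X j l s\<bar>" by (simp flip: abs_mult)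
      also have "\<dots> \<le> A j l * (M * sqrt (2 * Y s)) * sqrt (2 * Y s)"
        using rhs_le[OF jl s] X_le[OF jl s0] A M(1) Y_nonneg by (intro mult_mono) auto
      also have "\<dots> = A j l * M * (sqrt (2 * Y s))\<^sup>2" by (simp only: power2_eq_square mult_ac)
      also have "\<dots> = 2 * A j l * M * Y s" using Y_nonneg by simp
      finally show ?thesis using dissipation_nonneg[where i = j and n = l and t = s] by linarith
    qed
    hence "Y' s \<le> (\<Sum>(j, l)\<in>J. 2 * A j l * M * Y s)"
      unfolding Y'_def by (intro sum_mono) auto
    also have "\<dots> = L * Y s"
      unfolding L_def sum_distrib_right by (intro sum.cong refl) auto
    finally show ?thesis .
  qed
  \<comment> \<open>Integrating factor for \<open>Y' s \<le> L * Y s\<close>; the initial datum has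
    scale \<open>n0\<close>, outside \<open>J\<close>, so \<open>Y 0 = 0\<close>.\<close>
  have "exp (- L * t) * Y t \<le> exp (- L * 0) * Y 0"
  proof (rule nonpos_derivative_le_initial[OF t, of "\<lambda>s. exp (- L * s) * Y s"])
    fix s assume s: "0 \<le> s" "s \<le> t"
    have "((\<lambda>s. exp (- L * s) * Y s) has_real_derivative exp (- L * s) * (Y' s - L * Y s)) (at s within {0..})"
      by (rule derivative_eq_intros Y_deriv s refl | simp add: algebra_simps)+
    moreover have "exp (- L * s) * (Y' s - L * Y s) \<le> 0"
      using Y'_le[of s] s by (intro mult_nonneg_nonpos) auto
    ultimately show "\<exists>D. ((\<lambda>s. exp (- L * s) * Y s) has_real_derivative D) (at s within {0..}) \<and> D \<le> 0" by blast
  qed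
  moreover have "Y 0 = 0"
    unfolding Y_def by (intro sum.neutral) (auto simp: J_def E_0 X_0)
  ultimately have "Y t \<le> 0" by (simp add: mult_le_0_iff)
  moreover have "E i n t \<le> Y t" using i n False by (intro E_le_Y) (auto simp: J_def)
  ultimately have "E i n t = 0" using E_nonneg[OF i, of n t] by linarith
  thus ?thesis using X_le_sqrt_E[OF i t, of n] by simp
qed

lemma rhs_below_vanish:
  assumes i: "i \<in> {1..m}" and n: "n < int n0" and t: "t \<ge> 0"
  shows "rhs i n t = 0"
  unfolding rhs_def cascade_rhs_def
  by (intro sum.neutral ballI) (use n t in \<open>auto simp: shift_set_def modes_below_vanish\<close>)

text \<open>From \<open>n0\<close> on the norm is 1. Below \<open>n0\<close> it may be 0, but there
  the forcing vanishes.\<close>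

lemma rhs_normalized:
  assumes i: "i \<in> {1..m}" and t: "t \<ge> 0"
  shows "rhs i n t * (norm_T (wavelet i n))\<^sup>2 = rhs i n t"
  using rhs_below_vanish[OF i _ t, of n] normalized[OF i, of n] by (cases "n < int n0") auto

lemma X_equation:
  assumes i: "i \<in> {1..m}" and t: "t \<ge> 0"
  shows "\<exists>X'. (X i n has_real_derivative X') (at t within {0..}) \<and>
    \<bar>X' - rhs i n t\<bar> \<le> 18 * pi\<^sup>2 * ((dil n)\<^sup>2 * sqrt (E i n t))"
proof (intro exI conjI)
  show "(X i n has_real_derivative (rhs i n t - (\<Sum>k\<in>freqs i n. heat_rate k * (U k t \<bullet> W i n k)))) (at t within {0..})"
    using X_derivative[OF i t, of n] unfolding rhs_normalized[OF i t] .
  \<comment> \<open>Rounding \<open>sqrt 2\<close> up to 2 gives the same constant as in the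
    comparison of energy and mode.\<close>
  have "sqrt 2 \<le> sqrt (2\<^sup>2)" by (intro real_sqrt_le_mono) simp
  hence sqrt2: "sqrt 2 \<le> 2" by simp
  have "\<bar>\<Sum>k\<in>freqs i n. heat_rate k * (U k t \<bullet> W i n k)\<bar> \<le> sqrt 2 * (9 * pi\<^sup>2 * (dil n)\<^sup>2 * sqrt (E i n t))"
    using dissipation_le[OF i, where n = n and t = t] by (simp add: real_sqrt_mult mult_ac)
  also have "\<dots> \<le> 2 * (9 * pi\<^sup>2 * (dil n)\<^sup>2 * sqrt (E i n t))"
    using E_nonneg[OF i] sqrt2 by (intro mult_right_mono) auto
  finally show "\<bar>rhs i n t - (\<Sum>k\<in>freqs i n. heat_rate k * (U k t \<bullet> W i n k)) - rhs i n t\<bar> \<le> 18 * pi\<^sup>2 * ((dil n)\<^sup>2 * sqrt (E i n t))"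
    by simp
qed

lemma E_equation:
  assumes i: "i \<in> {1..m}" and t: "t \<ge> 0"
  shows "\<exists>E'. (E i n has_real_derivative E') (at t within {0..}) \<and> E' \<le> rhs i n t * X i n t"
  using E_derivative[OF i t, of n] dissipation_nonneg[where i = i and n = n and t = t] by (intro exI conjI) auto

lemma E_integrable: "i \<in> {1..m} \<Longrightarrow> E i n integrable_on {0..t}"
  by (intro integrable_continuous_real continuous_on_subset[OF E_continuous]) auto

lemma X_sq_le_E:
  assumes i: "i \<in> {1..m}" and t: "t \<ge> 0"
  shows "(X i n t)\<^sup>2 / 2 \<le> E i n t"
proof -
  have "\<bar>X i n t\<bar>\<^sup>2 \<le> (sqrt (2 * E i n t))\<^sup>2" by (intro power_mono X_le_sqrt_E i t) auto
  thus ?thesis using E_nonneg[OF i, of n t] by simp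
qed

text \<open>In the derivative of \<open>E - X\<^sup>2 / 2\<close> the forcing cancels. What remains
  is the dissipation of the energy, which has a good sign, and \<open>X\<close> times the
  dissipation of the mode, at most the constant times \<open>E\<close>. Subtracting the time
  integral makes \<open>f\<close> nonincreasing from 0.\<close>

lemma E_le_X_sq:
  assumes i: "i \<in> {1..m}" and t: "t \<ge> 0"
  shows "E i n t \<le> (X i n t)\<^sup>2 / 2 + 18 * pi\<^sup>2 * ((dil n)\<^sup>2 * integral {0..t} (E i n))"
proof -
  let ?K = "18 * pi\<^sup>2 * (dil n)\<^sup>2"
  define f where "f s = E i n s - (X i n s)\<^sup>2 / 2 - ?K * integral {0..s} (E i n)" for s
  have "f t \<le> f 0"
  proof (rule nonpos_derivative_le_initial[OF t])
    fix s assume s: "0 \<le> s" "s \<le> t"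
    let ?d = "\<Sum>k\<in>freqs i n. heat_rate k * (U k s \<bullet> W i n k)"
    let ?e = "\<Sum>k\<in>freqs i n. heat_rate k * (norm (U k s))\<^sup>2"
    have X': "(X i n has_real_derivative (rhs i n s - ?d)) (at s within {0..})"
      using X_derivative[OF i s(1), of n] unfolding rhs_normalized[OF i s(1)] .
    have "((\<lambda>t. integral {0..t} (E i n)) has_real_derivative E i n s) (at s within {0..s + 1})"
      using s by (intro integral_has_real_derivative continuous_on_subset[OF E_continuous[OF i]]) auto
    hence I': "((\<lambda>t. integral {0..t} (E i n)) has_real_derivative E i n s) (at s within {0..})"
      unfolding at_within_atLeast[OF s(1)] .
    have "(f has_real_derivative (rhs i n s * X i n s - ?e) - X i n s * (rhs i n s - ?d) - ?K * E i n s) (at s within {0..})"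
      unfolding f_def[abs_def]
      by (rule derivative_eq_intros X' I' E_derivative[OF i s(1)] refl | simp add: power2_eq_square)+
    moreover have "(rhs i n s * X i n s - ?e) - X i n s * (rhs i n s - ?d) - ?K * E i n s \<le> 0"
    proof -
      have "X i n s * ?d \<le> \<bar>X i n s\<bar> * \<bar>?d\<bar>" by (simp flip: abs_mult)
      also have "\<dots> \<le> sqrt (2 * E i n s) * (9 * pi\<^sup>2 * (dil n)\<^sup>2 * sqrt (2 * E i n s))"
        using E_nonneg[OF i] by (intro mult_mono X_le_sqrt_E dissipation_le i s) auto
      also have "\<dots> = 9 * pi\<^sup>2 * (dil n)\<^sup>2 * (sqrt (2 * E i n s))\<^sup>2" by (simp only: power2_eq_square mult_ac)
      also have "\<dots> = ?K * E i n s" using E_nonneg[OF i, of n s] by simp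
      finally have "X i n s * ?d \<le> ?K * E i n s" .
      thus ?thesis using dissipation_nonneg[where i = i and n = n and t = s] by (simp add: algebra_simps)
    qed
    ultimately show "\<exists>D. (f has_real_derivative D) (at s within {0..}) \<and> D \<le> 0" by blast
  qed
  also have "f 0 = 0" by (simp add: f_def E_0[OF i])
  finally show ?thesis by (simp add: f_def mult.assoc)
qed

lemma weighted_sup_finite:
  "(SUP t\<in>{0..T}. SUP n. SUP i\<in>{1..m}.
      ereal ((1 + (1 + \<epsilon>0) powr (10 * real_of_int n)) * \<bar>X i n t\<bar>)) < \<infinity>"
  "(SUP t\<in>{0..T}. SUP n. SUP i\<in>{1..m}.
      ereal ((1 + (1 + \<epsilon>0) powr (10 * real_of_int n)) * \<bar>E i n t\<bar>)) < \<infinity>"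
proof -
  obtain M where M: "M \<ge> 0" "\<And>s. s \<in> {0..T} \<Longrightarrow> H s \<le> M" using H_bounded[of T] by blast
  have "(SUP t\<in>{0..T}. SUP n. SUP i\<in>{1..m}.
      ereal ((1 + (1 + \<epsilon>0) powr (10 * real_of_int n)) * \<bar>X i n t\<bar>)) \<le> ereal (2 * M)"
  proof (intro SUP_least)
    fix t n i assume t: "t \<in> {0..T}" and i: "i \<in> {1..m}"
    have "(1 + (1 + \<epsilon>0) powr (10 * real_of_int n)) * \<bar>X i n t\<bar> \<le> 2 * H t" using t by (intro X_le_H i) auto
    thus "ereal ((1 + (1 + \<epsilon>0) powr (10 * real_of_int n)) * \<bar>X i n t\<bar>) \<le> ereal (2 * M)" using M(2)[OF t] by simp
  qed
  thus "(SUP t\<in>{0..T}. SUP n. SUP i\<in>{1..m}.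
      ereal ((1 + (1 + \<epsilon>0) powr (10 * real_of_int n)) * \<bar>X i n t\<bar>)) < \<infinity>"
    by (rule le_less_trans) simp
  have "(SUP t\<in>{0..T}. SUP n. SUP i\<in>{1..m}.
      ereal ((1 + (1 + \<epsilon>0) powr (10 * real_of_int n)) * \<bar>E i n t\<bar>)) \<le> ereal (M\<^sup>2)"
  proof (intro SUP_least)
    fix t n i assume t: "t \<in> {0..T}" and i: "i \<in> {1..m}"
    have "(1 + (1 + \<epsilon>0) powr (10 * real_of_int n)) * \<bar>E i n t\<bar> \<le> (H t)\<^sup>2" using t by (intro X_le_H i) auto
    also have "\<dots> \<le> M\<^sup>2" using M(2)[OF t] H_nonneg by (intro power_mono) auto
    finally show "ereal ((1 + (1 + \<epsilon>0) powr (10 * real_of_int n)) * \<bar>E i n t\<bar>) \<le> ereal (M\<^sup>2)" by simp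
  qed
  thus "(SUP t\<in>{0..T}. SUP n. SUP i\<in>{1..m}.
      ereal ((1 + (1 + \<epsilon>0) powr (10 * real_of_int n)) * \<bar>E i n t\<bar>)) < \<infinity>"
    by (rule le_less_trans) simp
qed

lemma dil_sq: "(dil n)\<^sup>2 = (1 + \<epsilon>0) powr (2 * real_of_int n)"
  using eps by (simp add: dil_def powr_power mult.commute)

end

theorem lemma3p1:
  fixes \<epsilon>0 :: real and m :: nat and B :: "nat \<Rightarrow> (real ^ 3) set"
    and \<psi> :: "nat \<Rightarrow> vfield" and \<alpha> :: structure_constants
  assumes "0 < \<epsilon>0" and "\<epsilon>0 < 1" and "1 \<le> m"
    and "\<forall>i\<in>{1..m}. \<exists>c r. 0 < r \<and> B i = ball c r"
    and "\<forall>i\<in>{1..m}. B i \<subseteq> {\<xi>. 1 < norm \<xi> \<and> norm \<xi> < 1 + \<epsilon>0 / 2}"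
    and "disjoint_family_on (\<lambda>(i, \<sigma>::real). (\<lambda>\<xi>. \<sigma> *\<^sub>R \<xi>) ` B i) ({1..m} \<times> {1, -1})"
    and "\<forall>i\<in>{1..m}. schwartz (\<psi> i) \<and> div_free (\<psi> i)"
    and "\<forall>i\<in>{1..m}. \<forall>\<xi>. \<xi> \<notin> B i \<union> uminus ` B i \<longrightarrow> fourier_R (\<psi> i) \<xi> = 0"
    and "\<forall>i\<in>{1..m}. sqrt (LINT x|lborel. (norm (\<psi> i x))\<^sup>2) = 1"
    and "symmetry_condition m \<alpha>" and "cancellation_condition m \<alpha>"
  shows "\<exists>K>0. \<exists>N::nat. \<forall>n0\<ge>N. \<forall>u.
    mild_solution (cascade_op \<epsilon>0 m \<alpha> \<psi>) (psi_tilde \<epsilon>0 \<psi> 1 (int n0)) u \<longrightarrow>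
    (let X = X_mode \<epsilon>0 \<psi> u; E = E_mode \<epsilon>0 B u in
      (\<forall>T>0.
        (SUP t\<in>{0..T}. SUP n. SUP i\<in>{1..m}.
          ereal ((1 + (1 + \<epsilon>0) powr (10 * real_of_int n)) * \<bar>X i n t\<bar>)) < \<infinity> \<and>
        (SUP t\<in>{0..T}. SUP n. SUP i\<in>{1..m}.
          ereal ((1 + (1 + \<epsilon>0) powr (10 * real_of_int n)) * \<bar>E i n t\<bar>)) < \<infinity>) \<and>
      (\<forall>n. \<forall>i\<in>{1..m}.
        E i n 0 = (X i n 0)\<^sup>2 / 2 \<and> X i n 0 = (if (i, n) = (1, int n0) then 1 else 0)) \<and>
      (\<forall>n. \<forall>i\<in>{1..m}. \<forall>t\<ge>0.
        (\<exists>X'. (X i n has_real_derivative X') (at t within {0..}) \<and>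
          \<bar>X' - cascade_rhs \<epsilon>0 m \<alpha> X i n t\<bar>
            \<le> K * ((1 + \<epsilon>0) powr (2 * real_of_int n) * sqrt (E i n t))) \<and>
        (\<exists>E'. (E i n has_real_derivative E') (at t within {0..}) \<and>
          E' \<le> cascade_rhs \<epsilon>0 m \<alpha> X i n t * X i n t)) \<and>
      (\<forall>n. \<forall>i\<in>{1..m}. \<forall>t\<ge>0.
        E i n integrable_on {0..t} \<and>
        (X i n t)\<^sup>2 / 2 \<le> E i n t \<and>
        E i n t \<le> (X i n t)\<^sup>2 / 2 + K * ((1 + \<epsilon>0) powr (2 * real_of_int n) * integral {0..t} (E i n))) \<and>
      (\<forall>n. \<forall>i\<in>{1..m}. \<forall>t\<ge>0. n < int n0 \<longrightarrow> X i n t = 0 \<and> E i n t = 0))"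
proof -
  interpret W: cascade_wavelets \<epsilon>0 m B \<psi>
    using assms(1,2,5-9) by unfold_locales auto
  obtain N :: nat where N: "\<And>n i. n \<ge> int N \<Longrightarrow> i \<in> {1..m} \<Longrightarrow> norm_T (psi_tilde \<epsilon>0 \<psi> i n) = 1"
    using W.norm_T_wavelet_eventually by blast
  show ?thesis
  \<comment> \<open>The constant is numerical and the threshold \<open>N\<close> comes from the
    wavelets alone; both are fixed before \<open>n0\<close> and the solution.\<close>
  proof (rule exI[of _ "18 * pi\<^sup>2"], intro conjI, simp, rule exI[of _ N], intro allI impI)
    fix n0 u assume n0: "N \<le> n0"
      and sol: "mild_solution (cascade_op \<epsilon>0 m \<alpha> \<psi>) (psi_tilde \<epsilon>0 \<psi> 1 (int n0)) u"
    interpret S: cascade_solution \<epsilon>0 m B \<psi> \<alpha> n0 u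
      using sol assms(3) n0 by unfold_locales (auto intro!: N)
    show "let X = X_mode \<epsilon>0 \<psi> u; E = E_mode \<epsilon>0 B u in
      (\<forall>T>0.
        (SUP t\<in>{0..T}. SUP n. SUP i\<in>{1..m}.
          ereal ((1 + (1 + \<epsilon>0) powr (10 * real_of_int n)) * \<bar>X i n t\<bar>)) < \<infinity> \<and>
        (SUP t\<in>{0..T}. SUP n. SUP i\<in>{1..m}.
          ereal ((1 + (1 + \<epsilon>0) powr (10 * real_of_int n)) * \<bar>E i n t\<bar>)) < \<infinity>) \<and>
      (\<forall>n. \<forall>i\<in>{1..m}.
        E i n 0 = (X i n 0)\<^sup>2 / 2 \<and> X i n 0 = (if (i, n) = (1, int n0) then 1 else 0)) \<and>
      (\<forall>n. \<forall>i\<in>{1..m}. \<forall>t\<ge>0.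
        (\<exists>X'. (X i n has_real_derivative X') (at t within {0..}) \<and>
          \<bar>X' - cascade_rhs \<epsilon>0 m \<alpha> X i n t\<bar>
            \<le> 18 * pi\<^sup>2 * ((1 + \<epsilon>0) powr (2 * real_of_int n) * sqrt (E i n t))) \<and>
        (\<exists>E'. (E i n has_real_derivative E') (at t within {0..}) \<and>
          E' \<le> cascade_rhs \<epsilon>0 m \<alpha> X i n t * X i n t)) \<and>
      (\<forall>n. \<forall>i\<in>{1..m}. \<forall>t\<ge>0.
        E i n integrable_on {0..t} \<and>
        (X i n t)\<^sup>2 / 2 \<le> E i n t \<and>
        E i n t \<le> (X i n t)\<^sup>2 / 2 + 18 * pi\<^sup>2 * ((1 + \<epsilon>0) powr (2 * real_of_int n) * integral {0..t} (E i n))) \<and>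
      (\<forall>n. \<forall>i\<in>{1..m}. \<forall>t\<ge>0. n < int n0 \<longrightarrow> X i n t = 0 \<and> E i n t = 0)"
      unfolding Let_def S.X_def[symmetric] S.E_def[symmetric] S.rhs_def[symmetric] S.dil_sq[symmetric]
      by (intro conjI allI ballI impI S.weighted_sup_finite S.E_0 S.X_0 S.X_equation S.E_equation
          S.E_integrable S.X_sq_le_E S.E_le_X_sq S.modes_below_vanish[THEN conjunct1] S.modes_below_vanish[THEN conjunct2])
  qed
qed

end
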